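(* Let $T>0$, let $K\in L^\gamma([0,T];\mathbb{R})$ for some $\gamma>2$ be a completely monotone kernel with measure $\mu$, let $\sigma:\mathbb{R}\to\mathbb{R}$ be bounded and Lipschitz continuous, and let $x_0:[0,T]\to\mathbb{R}$ be continuous. For $N>0$, $n\in\mathbb{N}$ and nodes $x_i\in[u_{i-1},u_i)$, $i=1,\dots,n$, where $u_i:=\frac{iN}{n}$, set $w_i:=\mu([u_{i-1},u_i))$ and $$K^N(t)=\int_{[0,N)}e^{-xt}\,\mu(\mathrm{d}x),\qquad \widehat{K}^{N,n}(t)=\sum_{i=1}^n w_i e^{-x_it},\qquad t>0.$$ Let $X$, $X^N$ and $\widehat{X}^{N,n}$ be the solutions of the stochastic Volterra equation $$Z_t=x_0(t)+\int_0^t k(t-s)\sigma(Z_s)\,\mathrm{d}W_s,\qquad t\in[0,T],$$ with kernel $k=K$, $k=K^N$ and $k=\widehat{K}^{N,n}$, respectively. Then for any $p\ge1$ there is a constant $C>0$, independent of $(x_i,w_i)_{i=1}^n$, $n$ and $N$, such that $$\mathbb{E}\left[\sup_{t\in[0,T]}\left|X_t-X^N_t\right|^p\right]^{1/p}\le C\int_{[N,\infty)}x^{-\frac1\gamma}\,\mu(\mathrm{d}x)$$ and $$\mathbb{E}\left[\sup_{t\in[0,T]}\left|X^N_t-\widehat{X}^{N,n}_t\right|^p\right]^{1/p}\le C\,\frac{\mu([0,N))\,N}{n}.$$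
   Context: Fix a filtered probability space $(\Omega,\mathcal{F},(\mathcal{F}_t)_{t\ge0},\mathbb{P})$ satisfying the usual conditions and carrying a one-dimensional Brownian motion $W$. A kernel $K:(0,\infty)\to\mathbb{R}$ is called completely monotone (with measure $\mu$) if there exists a non-negative measure $\mu$ on $[0,\infty)$ such that $K(t)=\int_0^\infty e^{-xt}\,\mu(\mathrm{d}x)$ for all $t>0$. By standard results each of the stochastic Volterra equations above has a unique solution, and it satisfies $\sup_{t\in[0,T]}\mathbb{E}|Z_t|^p<\infty$. *)

theory Defs
  imports "HOL-Probability.Probability"
begin

section \<open>Stochastic basis\<close>

text \<open>Time is \<open>[0,\<infinity>)\<close>, embedded in the type \<^typ>\<open>real\<close>; the values of a filtration or of a process
  at negative times are never constrained nor used.\<close>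

locale usual_stochastic_basis = prob_space M + complete_measure M
  for M :: "'a measure" +
  fixes F :: "real \<Rightarrow> 'a measure"
  assumes filtration_subalgebra: "0 \<le> t \<Longrightarrow> subalgebra M (F t)"
    and filtration_mono: "0 \<le> s \<Longrightarrow> s \<le> t \<Longrightarrow> sets (F s) \<subseteq> sets (F t)"
    and filtration_right_continuous: "0 \<le> t \<Longrightarrow> sets (F t) = (\<Inter>u\<in>{t<..}. sets (F u))"
    and filtration_complete: "null_sets M \<subseteq> sets (F 0)"

locale brownian_motion = usual_stochastic_basis M F
  for M :: "'a measure" and F :: "real \<Rightarrow> 'a measure" +
  fixes W :: "real \<Rightarrow> 'a \<Rightarrow> real"
  assumes adapted: "0 \<le> t \<Longrightarrow> W t \<in> borel_measurable (F t)"
    and starts_at_zero: "AE \<omega> in M. W 0 \<omega> = 0"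
    and normal_increments: "0 \<le> s \<Longrightarrow> s < t \<Longrightarrow>
      distributed M lborel (\<lambda>\<omega>. W t \<omega> - W s \<omega>) (normal_density 0 (sqrt (t - s)))"
    and independent_increments: "0 \<le> s \<Longrightarrow> s < t \<Longrightarrow>
      indep_set (sets (F s)) {(\<lambda>\<omega>. W t \<omega> - W s \<omega>) -` B \<inter> space M | B. B \<in> sets borel}"
    and continuous_paths: "AE \<omega> in M. continuous_on {0..} (\<lambda>t. W t \<omega>)"

section \<open>The Ito integral\<close>

definition progressive_on :: "(real \<Rightarrow> 'a measure) \<Rightarrow> real \<Rightarrow> (real \<Rightarrow> 'a \<Rightarrow> real) \<Rightarrow> bool" where
  "progressive_on F T H \<longleftrightarrow> (\<forall>t\<in>{0..T}.
     (\<lambda>(s, \<omega>). H s \<omega>) \<in> borel_measurable (restrict_space borel {0..t} \<Otimes>\<^sub>M F t))"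

text \<open>The data \<open>(m, \<tau>, \<xi>)\<close> encode the elementary process that equals \<open>\<xi> i\<close> on
  \<open>(\<tau> i, \<tau> (i + 1)]\<close> for \<open>i < m\<close> and vanishes elsewhere.\<close>

definition elementary_data ::
    "(real \<Rightarrow> 'a measure) \<Rightarrow> nat \<Rightarrow> (nat \<Rightarrow> real) \<Rightarrow> (nat \<Rightarrow> 'a \<Rightarrow> real) \<Rightarrow> bool" where
  "elementary_data F m \<tau> \<xi> \<longleftrightarrow> 0 \<le> \<tau> 0 \<and>
     (\<forall>i<m. \<tau> i \<le> \<tau> (Suc i) \<and> \<xi> i \<in> borel_measurable (F (\<tau> i)) \<and>
            bounded (\<xi> i ` space (F (\<tau> i))))"

definition elementary_process ::
    "nat \<Rightarrow> (nat \<Rightarrow> real) \<Rightarrow> (nat \<Rightarrow> 'a \<Rightarrow> real) \<Rightarrow> real \<Rightarrow> 'a \<Rightarrow> real" where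
  "elementary_process m \<tau> \<xi> s \<omega> = (\<Sum>i<m. \<xi> i \<omega> * indicator {\<tau> i<..\<tau> (Suc i)} s)"

definition elementary_integral ::
    "(real \<Rightarrow> 'a \<Rightarrow> real) \<Rightarrow> nat \<Rightarrow> (nat \<Rightarrow> real) \<Rightarrow> (nat \<Rightarrow> 'a \<Rightarrow> real) \<Rightarrow> real \<Rightarrow> 'a \<Rightarrow> real" where
  "elementary_integral W m \<tau> \<xi> t \<omega> =
     (\<Sum>i<m. \<xi> i \<omega> * (W (min t (\<tau> (Suc i))) \<omega> - W (min t (\<tau> i)) \<omega>))"

text \<open>\<open>I\<close> is (a version of) \<open>\<integral>\<^sub>0\<^sup>t H\<^sub>s dW\<^sub>s\<close>, for progressively measurable \<open>H\<close> in
  \<open>L\<^sup>2([0,t] \<times> \<Omega>)\<close>: the \<open>L\<^sup>2\<close>-limit of the integrals of elementary processes approximating \<open>H\<close>.\<close>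

definition has_ito_integral ::
    "'a measure \<Rightarrow> (real \<Rightarrow> 'a measure) \<Rightarrow> (real \<Rightarrow> 'a \<Rightarrow> real) \<Rightarrow> real
      \<Rightarrow> (real \<Rightarrow> 'a \<Rightarrow> real) \<Rightarrow> ('a \<Rightarrow> real) \<Rightarrow> bool" where
  "has_ito_integral M F W t H I \<longleftrightarrow>
     progressive_on F t H \<and> I \<in> borel_measurable M \<and>
     (\<exists>m \<tau> \<xi>. (\<forall>k. elementary_data F (m k) (\<tau> k) (\<xi> k)) \<and>
        (\<lambda>k. \<integral>\<^sup>+\<omega>. (\<integral>\<^sup>+s\<in>{0..t}.
            ennreal ((H s \<omega> - elementary_process (m k) (\<tau> k) (\<xi> k) s \<omega>)\<^sup>2) \<partial>lborel) \<partial>M)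
          \<longlonglongrightarrow> 0 \<and>
        (\<lambda>k. \<integral>\<^sup>+\<omega>. ennreal ((I \<omega> - elementary_integral W (m k) (\<tau> k) (\<xi> k) t \<omega>)\<^sup>2) \<partial>M)
          \<longlonglongrightarrow> 0)"

section \<open>Stochastic Volterra equations\<close>

text \<open>\<open>Z\<^sub>t = x0(t) + \<integral>\<^sub>0\<^sup>t k(t-s) \<sigma>(Z\<^sub>s) dW\<^sub>s\<close> almost surely, for every \<open>t \<in> [0,T]\<close>. The value \<open>k 0\<close>
  is immaterial: it only enters the integrand at \<open>s = t\<close>.\<close>

definition volterra_solution ::
    "'a measure \<Rightarrow> (real \<Rightarrow> 'a measure) \<Rightarrow> (real \<Rightarrow> 'a \<Rightarrow> real) \<Rightarrow> real
      \<Rightarrow> (real \<Rightarrow> real) \<Rightarrow> (real \<Rightarrow> real) \<Rightarrow> (real \<Rightarrow> real) \<Rightarrow> (real \<Rightarrow> 'a \<Rightarrow> real) \<Rightarrow> bool" where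
  "volterra_solution M F W T x0 \<sigma> k Z \<longleftrightarrow>
     progressive_on F T Z \<and>
     (AE \<omega> in M. continuous_on {0..T} (\<lambda>t. Z t \<omega>)) \<and>
     (\<forall>t\<in>{0..T}. \<exists>I. has_ito_integral M F W t (\<lambda>s \<omega>. k (t - s) * \<sigma> (Z s \<omega>)) I \<and>
        (AE \<omega> in M. Z t \<omega> = x0 t + I \<omega>))"

section \<open>Completely monotone kernels and their approximations\<close>

text \<open>Kernels live on \<open>(0,\<infinity>)\<close>; their values elsewhere are arbitrary. The measure \<open>\<mu>\<close> has
  underlying space \<open>[0,\<infinity>)\<close>.\<close>

definition completely_monotone_with :: "(real \<Rightarrow> real) \<Rightarrow> real measure \<Rightarrow> bool" where
  "completely_monotone_with K \<mu> \<longleftrightarrow>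
     sets \<mu> = sets (restrict_space borel {0..}) \<and>
     (\<forall>t>0. has_bochner_integral \<mu> (\<lambda>x. exp (- x * t)) (K t))"

definition in_Lp_on :: "real \<Rightarrow> real set \<Rightarrow> (real \<Rightarrow> real) \<Rightarrow> bool" where
  "in_Lp_on \<gamma> A f \<longleftrightarrow> set_borel_measurable lborel A f \<and>
     set_integrable lborel A (\<lambda>t. \<bar>f t\<bar> powr \<gamma>)"

definition truncated_kernel :: "real measure \<Rightarrow> real \<Rightarrow> real \<Rightarrow> real" where
  "truncated_kernel \<mu> N t = (LINT x:{0..<N}|\<mu>. exp (- x * t))"

definition grid_point :: "real \<Rightarrow> nat \<Rightarrow> nat \<Rightarrow> real" where
  "grid_point N n i = real i * N / real n"

definition grid_weight :: "real measure \<Rightarrow> real \<Rightarrow> nat \<Rightarrow> nat \<Rightarrow> real" where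
  "grid_weight \<mu> N n i = measure \<mu> {grid_point N n (i - 1)..<grid_point N n i}"

definition discretized_kernel ::
    "real measure \<Rightarrow> real \<Rightarrow> nat \<Rightarrow> (nat \<Rightarrow> real) \<Rightarrow> real \<Rightarrow> real" where
  "discretized_kernel \<mu> N n x t = (\<Sum>i=1..n. grid_weight \<mu> N n i * exp (- x i * t))"

section \<open>Norms of suprema\<close>

text \<open>Both are \<^typ>\<open>ennreal\<close>-valued, so that an infinite supremum or moment counts as \<open>\<infinity>\<close>.\<close>

definition ennreal_powr :: "ennreal \<Rightarrow> real \<Rightarrow> ennreal" where
  "ennreal_powr a p = (if a = \<infinity> then \<infinity> else ennreal (enn2real a powr p))"

definition Lp_norm_sup_dist ::
    "'a measure \<Rightarrow> real \<Rightarrow> real \<Rightarrow> (real \<Rightarrow> 'a \<Rightarrow> real) \<Rightarrow> (real \<Rightarrow> 'a \<Rightarrow> real) \<Rightarrow> ennreal" where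
  "Lp_norm_sup_dist M p T Y Z =
     ennreal_powr
       (\<integral>\<^sup>+\<omega>. ennreal_powr (SUP t\<in>{0..T}. ennreal \<bar>Y t \<omega> - Z t \<omega>\<bar>) p \<partial>M) (1 / p)"

end

(* Everything happens on the dyadic grids of [0,T], on which the Ito integrals of the solutions are
   L^2 limits of left-point sums, by the isometry; martingale sums there satisfy an explicit 2m-th
   moment bound (binomial expansion and the Gaussian moments). Two mechanisms turn this into the theorem.

   (1) Chaining bounds the b-Hoelder constant R of the grid martingale M of an integrand, b < 1/2, by an
   explicit dyadic sum of controlled expectation. For a kernel h, Abel summation rewrites
   sum_i h(t - s_i) (M_(i+1) - M_i) through the increments M_t - M_s, so it is at most R times a constant
   A(h), simultaneously in t. For h(u) = int e^(-xu) nu(dx) that constant is of the order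
   int min(1, x^(-b)) nu(dx), which for a completely monotone kernel in L^gamma is finite once
   b > 1/gamma; for h(0) = 0 it is of the order of the Lipschitz constant of h. No stochastic Fubini
   theorem is needed.

   (2) The difference of two solutions is a sum with the kernel difference and a bounded integrand plus a
   sum with the truncated kernel and the Lipschitz increments of sigma. A Gronwall argument with weight
   e^(-rho t), rho so large that int K^2 e^(-rho u) du is small, bounds its moments at fixed times; then
   (1) applied to both sums, Fatou's lemma and path continuity give the supremum. *)

theory Submission
  imports Defs
begin

section \<open>Chaining and Abel summation on dyadic grids\<close>

text \<open>Martingale inequalities do not reach the supremum over t: in a convolution the integrand
  changes with t, and the process is in general no semimartingale. All uniformity in t is therefore
  taken from the paths of the grid martingale, on which the kernels act deterministically. The
  exponent b needs room on both sides: b > 1/\<gamma> makes x^(-b) integrable at infinity, because K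
  in L^\<gamma> forces \<mu>([0,x)) = O(x^(1/\<gamma>)), and b < 1/2 is what the martingale paths
  allow. The room exists because \<gamma> > 2. Uniformity in N, n and the nodes comes from an
  asymmetry. In both estimates the truncated kernel is the reference \<open>k\<close>, and it enters
  the constant only through bounds free of N. The other kernel \<open>k'\<close> enters
  quantitatively only through the number A that bounds the difference; its own majorant
  \<open>\<kappa>'\<close> serves to know that moments are finite, and the Gronwall iteration then
  forgets it. Boundedness of \<sigma> makes the kernel-difference term independent of the size of
  the solutions.\<close>

lemma abel_summation:
  fixes e N :: "nat \<Rightarrow> real"
  assumes "N 0 = 0"
  shows "(\<Sum>d=1..j. e d * (N d - N (d - 1))) = e j * N j + (\<Sum>d=1..<j. (e d - e (Suc d)) * N d)"
proof (induction j)
  case 0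
  then show ?case using assms by simp
next
  case (Suc j)
  show ?case
  proof (cases "j = 0")
    case True
    then show ?thesis using assms by simp
  next
    case False
    then have "{1..<Suc j} = insert j {1..<j}" by auto
    then show ?thesis using Suc by (simp add: algebra_simps)
  qed
qed

text \<open>Induction on the number L of scales: both end points are rounded inward to even indices,
  at the price of at most one finest step each, and the path k -> M (2k) with the shifted bounds
  \<open>D (Suc r)\<close> takes over. Two steps per scale give the factor 2. L is tied to j - i and
  not to J, so that only scales up to the distance of the two points are paid for.\<close>

lemma dyadic_chaining_aux:
  fixes M :: "nat \<Rightarrow> real" and D :: "nat \<Rightarrow> real"
  assumes "\<And>r k. (k + 1) * 2 ^ r \<le> J \<Longrightarrow> \<bar>M ((k + 1) * 2 ^ r) - M (k * 2 ^ r)\<bar> \<le> D r"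
    and "i \<le> j" "j \<le> J" "j - i < 2 ^ L" and "\<And>r. 0 \<le> D r"
  shows "\<bar>M j - M i\<bar> \<le> 2 * (\<Sum>r<L. D r)"
  using assms
proof (induction L arbitrary: M D i j J)
  case 0
  then show ?case by simp
next
  case (Suc L)
  \<comment> \<open>Ceiling of i/2 and floor of j/2, so that i \<le> 2i' and 2j' \<le> j; from i < j
    it follows that i' \<le> j'.\<close>
  define i' where "i' = (i + 1) div 2"
  define j' where "j' = j div 2"
  show ?case
  proof (cases "i = j")
    case True
    then show ?thesis using Suc.prems(5) by (simp add: sum_nonneg)
  next
    case False
    with Suc.prems have ij: "i < j" by simp
    have step: "\<bar>M (k + 1) - M k\<bar> \<le> D 0" if "k < j" for k
      using Suc.prems(1)[of k 0] Suc.prems(3) that by simp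
    have "i' \<le> j'" using ij unfolding i'_def j'_def by linarith
    have a: "\<bar>M (2 * i') - M i\<bar> \<le> D 0"
    proof (cases "even i")
      case True
      then show ?thesis using Suc.prems(5) by (auto simp: i'_def elim!: evenE)
    next
      case False
      then have "2 * i' = i + 1" by (auto simp: i'_def elim!: oddE)
      then show ?thesis using step[of i] ij by simp
    qed
    have b: "\<bar>M j - M (2 * j')\<bar> \<le> D 0"
    proof (cases "even j")
      case True
      then show ?thesis using Suc.prems(5) by (auto simp: j'_def)
    next
      case False
      then have "j = 2 * j' + 1" by (auto simp: j'_def elim!: oddE)
      then show ?thesis using step[of "2 * j'"] by simp
    qed
    have c: "\<bar>M (2 * j') - M (2 * i')\<bar> \<le> 2 * (\<Sum>r<L. D (Suc r))"
    proof (rule Suc.IH[where M="\<lambda>k. M (2 * k)" and J="J div 2"])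
      fix r k :: nat assume "(k + 1) * 2 ^ r \<le> J div 2"
      then have "2 * ((k + 1) * 2 ^ r) \<le> J" by linarith
      then have "(k + 1) * 2 ^ Suc r \<le> J" by (simp add: algebra_simps)
      from Suc.prems(1)[OF this]
      show "\<bar>M (2 * ((k + 1) * 2 ^ r)) - M (2 * (k * 2 ^ r))\<bar> \<le> D (Suc r)"
        by (simp add: algebra_simps)
    next
      show "j' - i' < 2 ^ L" using Suc.prems(4) unfolding i'_def j'_def power_Suc by linarith
    qed (use \<open>i' \<le> j'\<close> Suc.prems in \<open>auto simp: j'_def\<close>)
    have "\<bar>M j - M i\<bar> \<le> 2 * D 0 + 2 * (\<Sum>r<L. D (Suc r))"
      using a b c by linarith
    then show ?thesis by (simp add: sum.lessThan_Suc_shift del: sum.lessThan_Suc)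
  qed
qed

text \<open>Since b > 0, the geometric series of the scale bounds is dominated by its largest scale,
  which is comparable to j - i. With 2^L \<le> 2(j - i) the series is at most (2(j - i))^b / (2^b -
  1); this and the factor 2 of the rounding give the constant.\<close>

lemma dyadic_chaining:
  fixes M :: "nat \<Rightarrow> real"
  assumes incr: "\<And>r k. (k + 1) * 2 ^ r \<le> J \<Longrightarrow>
      \<bar>M ((k + 1) * 2 ^ r) - M (k * 2 ^ r)\<bar> \<le> Q * (2 ^ r * \<delta>) powr b"
    and ij: "i \<le> j" "j \<le> J" and Q: "0 \<le> Q" and \<delta>: "0 < \<delta>" and b: "0 < b"
  shows "\<bar>M j - M i\<bar> \<le> 2 * 2 powr b / (2 powr b - 1) * Q * (real (j - i) * \<delta>) powr b"
proof (cases "i = j")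
  case False
  define L where "L = Suc (floor_log (j - i))"
  have d: "0 < j - i" using ij False by simp
  have L: "j - i < 2 ^ L" "2 ^ L \<le> 2 * (j - i)"
    using floor_log_exp2_gt[of "j - i"] floor_log_exp2_le[OF d] unfolding L_def by simp_all
  have b1: "1 < 2 powr b" using b by simp
  have pw: "(2 ^ r * \<delta>) powr b = (2 powr b) ^ r * \<delta> powr b" for r :: nat
    using \<delta> by (simp add: powr_mult powr_powr mult.commute powr_realpow[symmetric])
  have "\<bar>M j - M i\<bar> \<le> 2 * (\<Sum>r<L. Q * (2 ^ r * \<delta>) powr b)"
    by (rule dyadic_chaining_aux[where J=J, OF _ ij L(1)]) (use Q incr in auto)
  also have "(\<Sum>r<L. Q * (2 ^ r * \<delta>) powr b) = Q * \<delta> powr b * (\<Sum>r<L. (2 powr b) ^ r)"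
    unfolding pw sum_distrib_left by (simp add: mult_ac)
  finally have *: "\<bar>M j - M i\<bar> \<le> 2 * (Q * \<delta> powr b * (\<Sum>r<L. (2 powr b) ^ r))" .
  have "(\<Sum>r<L. (2 powr b) ^ r) = ((2 powr b) ^ L - 1) / (2 powr b - 1)"
    using b1 by (subst geometric_sum) auto
  also have "\<dots> \<le> (2 * real (j - i)) powr b / (2 powr b - 1)"
  proof (rule divide_right_mono)
    have "(2 powr b) ^ L = (2 ^ L) powr b"
      by (simp add: powr_powr mult.commute powr_realpow[symmetric])
    also have "\<dots> \<le> (2 * real (j - i)) powr b"
    proof (rule powr_mono2)
      have "real (2 ^ L) \<le> real (2 * (j - i))" using L(2) by (rule of_nat_mono)
      then show "2 ^ L \<le> 2 * real (j - i)" by simp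
    qed (use b in auto)
    finally show "(2 powr b) ^ L - 1 \<le> (2 * real (j - i)) powr b" by simp
  qed (use b1 in simp)
  finally have "2 * (Q * \<delta> powr b * (\<Sum>r<L. (2 powr b) ^ r))
      \<le> 2 * (Q * \<delta> powr b * ((2 * real (j - i)) powr b / (2 powr b - 1)))"
    using Q \<delta> by (intro mult_left_mono) auto
  also have "\<dots> = 2 * 2 powr b / (2 powr b - 1) * Q * (real (j - i) * \<delta>) powr b"
    using \<delta> by (simp add: powr_mult mult_ac)
  finally show ?thesis using * by linarith
qed simp

text \<open>The Hoelder majorant (x d \<delta>)^b is replaced by the affine 1 + x d \<delta>. Abel
  summation can then be undone with the majorant in place of N, which leaves the jump 1 at the first
  step and a right-endpoint Riemann sum of x e^(-xu), at most 1: hence the constant 2.\<close>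

lemma exp_kernel_bound:
  fixes N :: "nat \<Rightarrow> real"
  assumes N0: "N 0 = 0" and N: "\<And>d. d \<le> j \<Longrightarrow> \<bar>N d\<bar> \<le> R * (real d * \<delta>) powr b"
    and b: "0 < b" "b \<le> 1" and x: "0 < x" and \<delta>: "0 < \<delta>" and R: "0 \<le> R"
  shows "\<bar>\<Sum>d=1..j. exp (- x * (real d * \<delta>)) * (N d - N (d - 1))\<bar> \<le> R * (2 * x powr (- b))"
proof -
  define e where "e d = exp (- x * (real d * \<delta>))" for d :: nat
  \<comment> \<open>The value 0 at d = 0 is what Abel summation requires of its sequence when it is
    read backwards below.\<close>
  define c where "c d = (if d = 0 then 0 else 1 + x * (real d * \<delta>))" for d :: nat
  have e0: "0 \<le> e d" for d by (simp add: e_def)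
  have emono: "e (Suc d) \<le> e d" for d using x \<delta> by (simp add: e_def)
  have Nc: "\<bar>N d\<bar> \<le> R * x powr (- b) * c d" if "d \<le> j" for d
  proof (cases "d = 0")
    case False
    have "(x * (real d * \<delta>)) powr b \<le> max 1 (x * (real d * \<delta>))"
    proof (cases "x * (real d * \<delta>) \<le> 1")
      case True
      then have "(x * (real d * \<delta>)) powr b \<le> 1" using b x \<delta> by (intro powr_le1) auto
      then show ?thesis by simp
    next
      case False
      then have "(x * (real d * \<delta>)) powr b \<le> (x * (real d * \<delta>)) powr 1"
        using b by (intro powr_mono) auto
      then show ?thesis using False by simp
    qed
    also have "\<dots> \<le> c d" using False x \<delta> by (simp add: c_def)
    finally have "x powr b * (real d * \<delta>) powr b \<le> c d"
      using x \<delta> by (simp add: powr_mult)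
    then have "(real d * \<delta>) powr b \<le> x powr (- b) * c d"
      using x by (simp add: powr_minus field_simps)
    then have "R * (real d * \<delta>) powr b \<le> R * (x powr (- b) * c d)"
      using R by (rule mult_left_mono)
    then show ?thesis using N[OF that] by (simp add: mult.assoc)
  qed (simp add: N0 c_def)
  have "\<bar>\<Sum>d=1..j. e d * (N d - N (d - 1))\<bar> = \<bar>e j * N j + (\<Sum>d=1..<j. (e d - e (Suc d)) * N d)\<bar>"
    by (simp only: abel_summation[of N, OF N0])
  also have "\<dots> \<le> \<bar>e j * N j\<bar> + (\<Sum>d=1..<j. \<bar>(e d - e (Suc d)) * N d\<bar>)"
    by (intro order_trans[OF abs_triangle_ineq] add_left_mono sum_abs)
  also have "\<dots> \<le> e j * (R * x powr (- b) * c j)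
      + (\<Sum>d=1..<j. (e d - e (Suc d)) * (R * x powr (- b) * c d))"
    using e0 emono Nc by (intro add_mono sum_mono) (auto simp: abs_mult intro!: mult_left_mono)
  also have "\<dots> = R * x powr (- b) * (e j * c j + (\<Sum>d=1..<j. (e d - e (Suc d)) * c d))"
    by (simp add: algebra_simps sum_distrib_left)
  finally have *: "\<bar>\<Sum>d=1..j. e d * (N d - N (d - 1))\<bar>
      \<le> R * x powr (- b) * (e j * c j + (\<Sum>d=1..<j. (e d - e (Suc d)) * c d))" .
  have "e j * c j + (\<Sum>d=1..<j. (e d - e (Suc d)) * c d) = (\<Sum>d=1..j. e d * (c d - c (d - 1)))"
    by (subst abel_summation) (auto simp: c_def)
  also have "\<dots> \<le> 2"
  proof -
    \<comment> \<open>By 1 + y \<le> e^y at y = x \<delta>, each term is at most e (d - 1) - e d,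
      and the sum telescopes.\<close>
    have g: "(\<Sum>d=1..j. e d * (x * \<delta>)) \<le> 1 - e j"
    proof (induction j)
      case (Suc j)
      have "1 + x * \<delta> \<le> exp (x * \<delta>)" by (rule exp_ge_add_one_self)
      then have "e (Suc j) * (1 + x * \<delta>) \<le> e (Suc j) * exp (x * \<delta>)"
        using e0 by (intro mult_left_mono)
      also have "\<dots> = e j" by (simp add: e_def exp_add[symmetric] algebra_simps)
      finally show ?case using Suc by (simp add: algebra_simps)
    qed (simp add: e_def)
    have "(\<Sum>d=1..j. e d * (c d - c (d - 1))) \<le> (\<Sum>d=1..j. e d * (x * \<delta>) + (if d = 1 then 1 else 0))"
    proof (rule sum_mono)
      fix d assume d: "d \<in> {1..j}"
      show "e d * (c d - c (d - 1)) \<le> e d * (x * \<delta>) + (if d = 1 then 1 else 0)"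
      proof (cases "d = 1")
        case True
        have "e 1 \<le> 1" using x \<delta> by (simp add: e_def)
        then show ?thesis using True by (simp add: c_def algebra_simps)
      next
        case False
        then have "c d - c (d - 1) = x * \<delta>" using d by (simp add: c_def algebra_simps)
        then show ?thesis using False by simp
      qed
    qed
    also have "\<dots> \<le> (\<Sum>d=1..j. e d * (x * \<delta>)) + 1"
      by (simp add: sum.distrib)
    also have "\<dots> \<le> 2" using g e0[of j] by linarith
    finally show ?thesis .
  qed
  finally have "R * x powr (- b) * (e j * c j + (\<Sum>d=1..<j. (e d - e (Suc d)) * c d))
      \<le> R * x powr (- b) * 2"
    using R by (intro mult_left_mono) auto
  with * show ?thesis by (simp add: e_def)
qed

lemma dyadic_le:
  assumes "d \<le> 2 ^ n" "0 < T" shows "real d * (T / 2 ^ n) \<le> T"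
proof -
  have "real d \<le> real (2 ^ n)" using assms(1) by (rule of_nat_mono)
  then show ?thesis using assms(2) by (simp add: field_simps)
qed

text \<open>Complements \<open>exp_kernel_bound\<close> for small x, where x^(-b) explodes. After
  Abel summation the weights e j and e d - e (d + 1) are nonnegative and telescope to e 1 \<le> 1; x
  = 0 is included.\<close>

lemma exp_kernel_bound_uniform:
  fixes N :: "nat \<Rightarrow> real"
  assumes N0: "N 0 = 0" and N: "\<And>d. d \<le> j \<Longrightarrow> \<bar>N d\<bar> \<le> B"
    and x: "0 \<le> x" and \<delta>: "0 < \<delta>"
  shows "\<bar>\<Sum>d=1..j. exp (- x * (real d * \<delta>)) * (N d - N (d - 1))\<bar> \<le> B"
proof -
  define e where "e d = exp (- x * (real d * \<delta>))" for d :: nat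
  have B: "0 \<le> B" using N[of 0] N0 by simp
  have e0: "0 \<le> e d" for d by (simp add: e_def)
  have emono: "e (Suc d) \<le> e d" for d using x \<delta> by (simp add: e_def mult_left_mono)
  have "\<bar>\<Sum>d=1..j. e d * (N d - N (d - 1))\<bar> = \<bar>e j * N j + (\<Sum>d=1..<j. (e d - e (Suc d)) * N d)\<bar>"
    by (simp only: abel_summation[of N, OF N0])
  also have "\<dots> \<le> \<bar>e j * N j\<bar> + (\<Sum>d=1..<j. \<bar>(e d - e (Suc d)) * N d\<bar>)"
    by (intro order_trans[OF abs_triangle_ineq] add_left_mono sum_abs)
  also have "\<dots> \<le> e j * B + (\<Sum>d=1..<j. (e d - e (Suc d)) * B)"
    using e0 emono N by (intro add_mono sum_mono) (auto simp: abs_mult intro!: mult_left_mono)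
  also have "\<dots> = B * (e j + (\<Sum>d=1..<j. e d - e (Suc d)))"
    by (simp add: algebra_simps sum_distrib_left)
  also have "e j + (\<Sum>d=1..<j. e d - e (Suc d)) \<le> 1"
  proof (cases "j = 0")
    case False
    then have "(\<Sum>d=1..<j. e d - e (Suc d)) = e 1 - e j"
      using sum_Suc_diff'[of 1 j "\<lambda>d. - e d"] by simp
    moreover have "e 1 \<le> 1" using x \<delta> by (simp add: e_def)
    ultimately show ?thesis by simp
  qed (simp add: e_def)
  finally show ?thesis using B by (simp add: e_def mult_left_mono)
qed

text \<open>A bound for the operator norm of integrating h against b-Hoelder paths, uniform over the
  dyadic grids. The index d counts steps back from the final time, so h is never read at 0. Since
  the path is arbitrary and R enters linearly, the bound applies to each \<omega> separately, with a
  random Hoelder constant.\<close>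

definition increment_bound :: "real \<Rightarrow> real \<Rightarrow> (real \<Rightarrow> real) \<Rightarrow> real \<Rightarrow> bool" where
  "increment_bound T b h A \<longleftrightarrow> (\<forall>n j N R. j \<le> 2 ^ n \<longrightarrow> 0 \<le> R \<longrightarrow> N 0 = 0 \<longrightarrow>
     (\<forall>d\<le>j. \<bar>N d\<bar> \<le> R * (real d * (T / 2 ^ n)) powr b) \<longrightarrow>
     \<bar>\<Sum>d=1..j. h (real d * (T / 2 ^ n)) * (N d - N (d - 1))\<bar> \<le> R * A)"

text \<open>The increment bound for the single kernel e^(-xu), whose convolution is of
  Ornstein-Uhlenbeck type. The two branches are the two Abel bounds above; the order is min(1,
  x^(-b)).\<close>

definition ou_weight :: "real \<Rightarrow> real \<Rightarrow> real \<Rightarrow> real" where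
  "ou_weight T b x = (if x < 1 then T powr b else 2 * x powr (- b))"

lemma ou_weight_measurable[measurable]: "ou_weight T b \<in> borel_measurable borel"
  unfolding ou_weight_def by measurable

lemma ou_weight_nonneg: "0 \<le> ou_weight T b x"
  by (simp add: ou_weight_def)

lemma increment_bound_exp:
  fixes N :: "nat \<Rightarrow> real"
  assumes T: "0 < T" and b: "0 < b" "b \<le> 1" and j: "j \<le> 2 ^ n" and R: "0 \<le> R" and N0: "N 0 = 0"
    and N: "\<And>d. d \<le> j \<Longrightarrow> \<bar>N d\<bar> \<le> R * (real d * (T / 2 ^ n)) powr b" and x: "0 \<le> x"
  shows "\<bar>\<Sum>d=1..j. exp (- x * (real d * (T / 2 ^ n))) * (N d - N (d - 1))\<bar> \<le> R * ou_weight T b x"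
proof (cases "x < 1")
  case True
  have "\<bar>N d\<bar> \<le> R * T powr b" if "d \<le> j" for d
  proof -
    have "real d * (T / 2 ^ n) \<le> T" using that j T by (intro dyadic_le) auto
    then have "(real d * (T / 2 ^ n)) powr b \<le> T powr b" using T b by (intro powr_mono2) auto
    then show ?thesis using order_trans[OF N[OF that] mult_left_mono[OF _ R]] by simp
  qed
  from exp_kernel_bound_uniform[of N, OF N0 this x, where \<delta>="T / 2 ^ n"] show ?thesis
    using T True by (simp add: ou_weight_def)
next
  case False
  then show ?thesis
    using exp_kernel_bound[of N j R "T / 2 ^ n" b x] N0 N b T R by (simp add: ou_weight_def)
qed

text \<open>After Abel summation the boundary value of h and its variation along the grid are each
  at most c T, against |N| \<le> R T^b. The condition h(0) = 0 is what makes the boundary value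
  small together with c.\<close>

lemma increment_bound_lipschitz:
  assumes T: "0 < T" and b: "0 < b" and c: "0 \<le> c"
    and lip: "\<And>u v. 0 \<le> u \<Longrightarrow> u \<le> v \<Longrightarrow> v \<le> T \<Longrightarrow> \<bar>h v - h u\<bar> \<le> c * (v - u)" and h0: "h 0 = 0"
  shows "increment_bound T b h (2 * T * T powr b * c)"
  unfolding increment_bound_def
proof (intro allI impI)
  fix n j :: nat and N :: "nat \<Rightarrow> real" and R :: real
  assume j: "j \<le> 2 ^ n" and R: "0 \<le> R" and N0: "N 0 = 0"
    and N: "\<forall>d\<le>j. \<bar>N d\<bar> \<le> R * (real d * (T / 2 ^ n)) powr b"
  define \<delta> where "\<delta> = T / 2 ^ n"
  have \<delta>: "0 < \<delta>" using T by (simp add: \<delta>_def)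
  have dT: "real d * \<delta> \<le> T" if "d \<le> j" for d
    unfolding \<delta>_def using that j T by (intro dyadic_le) auto
  have NB: "\<bar>N d\<bar> \<le> R * T powr b" if "d \<le> j" for d
  proof -
    have "(real d * \<delta>) powr b \<le> T powr b" using dT[OF that] \<delta> b by (intro powr_mono2) auto
    then show ?thesis using order_trans[OF N[rule_format, OF that] mult_left_mono[OF _ R]] by (simp add: \<delta>_def)
  qed
  have "\<bar>\<Sum>d=1..j. h (real d * \<delta>) * (N d - N (d - 1))\<bar>
      = \<bar>h (real j * \<delta>) * N j + (\<Sum>d=1..<j. (h (real d * \<delta>) - h (real (Suc d) * \<delta>)) * N d)\<bar>"
    by (simp only: abel_summation[of N, OF N0])
  also have "\<dots> \<le> \<bar>h (real j * \<delta>) * N j\<bar>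
      + (\<Sum>d=1..<j. \<bar>(h (real d * \<delta>) - h (real (Suc d) * \<delta>)) * N d\<bar>)"
    by (intro order_trans[OF abs_triangle_ineq] add_left_mono sum_abs)
  also have "\<dots> \<le> (c * T) * (R * T powr b) + (\<Sum>d=1..<j. (c * \<delta>) * (R * T powr b))"
  proof (intro add_mono sum_mono)
    have "\<bar>h (real j * \<delta>)\<bar> \<le> c * (real j * \<delta>)"
      using lip[of 0 "real j * \<delta>"] h0 dT[of j] \<delta> by simp
    also have "\<dots> \<le> c * T" using c dT[of j] by (intro mult_left_mono) auto
    finally show "\<bar>h (real j * \<delta>) * N j\<bar> \<le> c * T * (R * T powr b)"
      unfolding abs_mult by (intro mult_mono NB) (use c T in auto)
    fix d assume d: "d \<in> {1..<j}"
    have "\<bar>h (real (Suc d) * \<delta>) - h (real d * \<delta>)\<bar> \<le> c * (real (Suc d) * \<delta> - real d * \<delta>)"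
      using d \<delta> dT[of "Suc d"] by (intro lip) (auto intro: mult_right_mono)
    also have "\<dots> = c * \<delta>" by (simp add: algebra_simps)
    finally have "\<bar>h (real d * \<delta>) - h (real (Suc d) * \<delta>)\<bar> \<le> c * \<delta>" by (subst abs_minus_commute)
    then show "\<bar>(h (real d * \<delta>) - h (real (Suc d) * \<delta>)) * N d\<bar> \<le> c * \<delta> * (R * T powr b)"
      unfolding abs_mult using d by (intro mult_mono NB) (use c \<delta> in auto)
  qed
  also have "\<dots> = (c * (R * T powr b)) * (T + real (j - 1) * \<delta>)"
    by (simp add: algebra_simps)
  also have "\<dots> \<le> (c * (R * T powr b)) * (T + T)"
    using c R dT[of "j - 1"] by (intro mult_left_mono) auto
  finally show "\<bar>\<Sum>d=1..j. h (real d * (T / 2 ^ n)) * (N d - N (d - 1))\<bar> \<le> R * (2 * T * T powr b * c)"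
    by (simp add: \<delta>_def algebra_simps)
qed

section \<open>Completely monotone kernels\<close>

lemma cm_sets: "completely_monotone_with K \<mu> \<Longrightarrow> sets \<mu> = sets (restrict_space borel {0..})"
  by (simp add: completely_monotone_with_def)

lemma cm_space: "completely_monotone_with K \<mu> \<Longrightarrow> space \<mu> = {0..}"
  by (drule cm_sets[THEN sets_eq_imp_space_eq]) simp

lemma cm_sets_iff:
  assumes "completely_monotone_with K \<mu>"
  shows "A \<in> sets \<mu> \<longleftrightarrow> A \<in> sets borel \<and> A \<subseteq> {0..}"
  by (auto simp: cm_sets[OF assms] sets_restrict_space_iff)

lemma cm_measurable:
  assumes "completely_monotone_with K \<mu>" "f \<in> borel_measurable borel"
  shows "f \<in> borel_measurable \<mu>"
  by (subst measurable_cong_sets[OF cm_sets[OF assms(1)] refl], rule measurable_restrict_space1)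
    (fact assms(2))

lemma cm_integrable:
  assumes "completely_monotone_with K \<mu>" "0 < t"
  shows "integrable \<mu> (\<lambda>x. exp (- x * t))" "(LINT x|\<mu>. exp (- x * t)) = K t"
  using assms by (auto simp: completely_monotone_with_def has_bochner_integral_iff)

lemma cm_set_integrable:
  assumes "completely_monotone_with K \<mu>" "0 < t" "A \<in> sets \<mu>"
  shows "set_integrable \<mu> A (\<lambda>x. exp (- x * t))"
  unfolding set_integrable_def
  by (rule integrable_mult_indicator[OF assms(3) cm_integrable(1)[OF assms(1,2)]])

text \<open>On [0,N) the integrand e^(-x) of K(1) is at least e^(-N).\<close>

lemma cm_finite:
  assumes "completely_monotone_with K \<mu>"
  shows "emeasure \<mu> {0..<N} < \<infinity>"
proof -
  have s: "{0..<N} \<in> sets \<mu>" by (auto simp: cm_sets_iff[OF assms])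
  have "integrable \<mu> (\<lambda>x. indicator {0..<N} x :: real)"
  proof (rule Bochner_Integration.integrable_bound)
    show "integrable \<mu> (\<lambda>x. exp N * exp (- x * 1))"
      using cm_integrable(1)[OF assms, of 1] by simp
    show "AE x in \<mu>. norm (indicator {0..<N} x :: real) \<le> norm (exp N * exp (- x * 1))"
      by (intro AE_I2) (auto simp: indicator_def mult_exp_exp)
  qed (use s in simp)
  moreover have "{0..<N} \<inter> space \<mu> = {0..<N}" by (auto simp: cm_space[OF assms])
  ultimately show ?thesis by (simp only: integrable_indicator_iff)
qed

text \<open>For a fixed path and grid the convolution is a finite sum, so it can be exchanged with
  the \<mu>-integral of the exponentials, and the bound for each x is then integrated.\<close>

lemma increment_bound_cm:
  assumes cm: "completely_monotone_with K \<mu>" and A: "A \<in> sets \<mu>"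
    and h: "\<And>u. 0 < u \<Longrightarrow> h u = (LINT x:A|\<mu>. exp (- x * u))"
    and T: "0 < T" and b: "0 < b" "b \<le> 1" and int: "set_integrable \<mu> A (ou_weight T b)"
  shows "increment_bound T b h (LINT x:A|\<mu>. ou_weight T b x)"
  unfolding increment_bound_def
proof (intro allI impI)
  fix n j :: nat and N :: "nat \<Rightarrow> real" and R :: real
  assume j: "j \<le> 2 ^ n" and R: "0 \<le> R" and N0: "N 0 = 0"
    and N: "\<forall>d\<le>j. \<bar>N d\<bar> \<le> R * (real d * (T / 2 ^ n)) powr b"
  define \<delta> where "\<delta> = T / 2 ^ n"
  have \<delta>: "0 < \<delta>" using T by (simp add: \<delta>_def)
  have i: "integrable \<mu> (\<lambda>x. indicator A x *\<^sub>R exp (- x * (real d * \<delta>)) * (N d - N (d - 1)))"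
    if "d \<in> {1..j}" for d
    using cm_set_integrable[OF cm _ A, of "real d * \<delta>"] \<delta> that unfolding set_integrable_def by auto
  have "(\<Sum>d=1..j. h (real d * \<delta>) * (N d - N (d - 1)))
      = (\<Sum>d=1..j. (LINT x|\<mu>. indicator A x *\<^sub>R exp (- x * (real d * \<delta>)) * (N d - N (d - 1))))"
    using \<delta> by (intro sum.cong refl, subst h) (auto simp: set_lebesgue_integral_def)
  also have "\<dots> = (LINT x|\<mu>. (\<Sum>d=1..j. indicator A x *\<^sub>R exp (- x * (real d * \<delta>)) * (N d - N (d - 1))))"
    using i by (subst Bochner_Integration.integral_sum) auto
  also have "\<bar>\<dots>\<bar> \<le> (LINT x|\<mu>. R * (indicator A x *\<^sub>R ou_weight T b x))"
  proof (rule integral_abs_bound_integral)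
    show "integrable \<mu> (\<lambda>x. R * (indicator A x *\<^sub>R ou_weight T b x))"
      using int unfolding set_integrable_def by simp
    fix x assume "x \<in> space \<mu>"
    then have x: "0 \<le> x" by (simp add: cm_space[OF cm])
    have eq: "(\<Sum>d=1..j. indicator A x *\<^sub>R exp (- x * (real d * \<delta>)) * (N d - N (d - 1)))
      = indicator A x * (\<Sum>d=1..j. exp (- x * (real d * \<delta>)) * (N d - N (d - 1)))"
      unfolding sum_distrib_left by (simp add: mult_ac)
    show "\<bar>\<Sum>d=1..j. indicator A x *\<^sub>R exp (- x * (real d * \<delta>)) * (N d - N (d - 1))\<bar>
       \<le> R * (indicator A x *\<^sub>R ou_weight T b x)"
      unfolding eq using increment_bound_exp[of T b j n R N x] T b j R N0 N x
      by (auto simp: indicator_def \<delta>_def)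
  qed (use i in \<open>intro Bochner_Integration.integrable_sum, auto\<close>)
  finally show "\<bar>\<Sum>d=1..j. h (real d * (T / 2 ^ n)) * (N d - N (d - 1))\<bar>
      \<le> R * (LINT x:A|\<mu>. ou_weight T b x)"
    by (simp add: \<delta>_def set_lebesgue_integral_def)
qed

lemma integrable_indicator_bounded:
  fixes A :: "real set"
  assumes "bounded A" "A \<in> sets borel"
  shows "integrable lborel (indicator A :: real \<Rightarrow> real)"
  using assms by (intro integrable_real_indicator emeasure_bounded_finite) auto

lemma cm_kernel_nonneg: "0 \<le> (LINT x:A|\<mu>. exp (- x * u :: real))"
  by (simp add: set_lebesgue_integral_def integral_nonneg_AE)

lemma cm_kernel_antimono:
  assumes "completely_monotone_with K \<mu>" "A \<in> sets \<mu>" "0 < u" "u \<le> v"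
  shows "(LINT x:A|\<mu>. exp (- x * v)) \<le> (LINT x:A|\<mu>. exp (- x * u))"
  using assms by (intro set_integral_mono cm_set_integrable[OF assms(1)])
    (auto simp: cm_sets_iff[OF assms(1)] mult_left_mono)

lemma cm_kernel_le:
  assumes "completely_monotone_with K \<mu>" "A \<in> sets \<mu>" "0 < u"
  shows "(LINT x:A|\<mu>. exp (- x * u)) \<le> K u"
  unfolding cm_integrable(2)[OF assms(1,3), symmetric] set_lebesgue_integral_def
  using cm_set_integrable[OF assms(1,3,2)] cm_integrable(1)[OF assms(1,3)]
  by (intro integral_mono) (auto simp: set_integrable_def indicator_def)

lemma cm_kernel_continuous:
  assumes cm: "completely_monotone_with K \<mu>" and A: "A \<in> sets \<mu>"
  shows "continuous_on {0<..} (\<lambda>u. LINT x:A|\<mu>. exp (- x * u))"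
proof (rule continuous_on_sequentiallyI)
  fix u :: "nat \<Rightarrow> real" and a assume u: "\<forall>n. u n \<in> {0<..}" "a \<in> {0<..}" "u \<longlonglongrightarrow> a"
  \<comment> \<open>Eventually u n > a/2, so that e^(-x a/2) is an integrable majorant.\<close>
  then have "\<forall>\<^sub>F n in sequentially. a / 2 < u n" by (intro order_tendstoD) auto
  then obtain n0 where n0: "\<And>n. n0 \<le> n \<Longrightarrow> a / 2 < u n" by (auto simp: eventually_sequentially)
  have "(\<lambda>n. LINT x:A|\<mu>. exp (- x * u (n + n0))) \<longlonglongrightarrow> (LINT x:A|\<mu>. exp (- x * a))"
    unfolding set_lebesgue_integral_def
  proof (rule integral_dominated_convergence)
    show "integrable \<mu> (\<lambda>x. exp (- x * (a / 2)))" using u by (intro cm_integrable[OF cm]) auto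
    have "(\<lambda>n. u (n + n0)) \<longlonglongrightarrow> a" using u(3) by (rule LIMSEQ_ignore_initial_segment)
    then show "AE x in \<mu>. (\<lambda>n. indicator A x *\<^sub>R exp (- x * u (n + n0))) \<longlonglongrightarrow> indicator A x *\<^sub>R exp (- x * a)"
      by (intro AE_I2 tendsto_intros)
    show "AE x in \<mu>. norm (indicator A x *\<^sub>R exp (- x * u (n + n0))) \<le> exp (- x * (a / 2))" for n
    proof (intro AE_I2)
      fix x assume "x \<in> space \<mu>"
      then have "0 \<le> x" by (simp add: cm_space[OF cm])
      then have "x * (a / 2) \<le> x * u (n + n0)" using n0[of "n + n0"] by (intro mult_left_mono) auto
      then show "norm (indicator A x *\<^sub>R exp (- x * u (n + n0))) \<le> exp (- x * (a / 2))"
        by (auto simp: indicator_def)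
    qed
  next
    have [measurable]: "(\<lambda>x. exp (- x * v)) \<in> borel_measurable \<mu>" for v :: real
      by (rule cm_measurable[OF cm]) measurable
    note A[measurable]
    show "(\<lambda>x. indicator A x *\<^sub>R exp (- x * a)) \<in> borel_measurable \<mu>" by measurable
    show "(\<lambda>x. indicator A x *\<^sub>R exp (- x * u (n + n0))) \<in> borel_measurable \<mu>" for n by measurable
  qed
  then show "(\<lambda>n. LINT x:A|\<mu>. exp (- x * u n)) \<longlonglongrightarrow> (LINT x:A|\<mu>. exp (- x * a))"
    by (rule LIMSEQ_offset)
qed

lemma cm_full:
  assumes "completely_monotone_with K \<mu>" "0 < u"
  shows "K u = (LINT x:space \<mu>|\<mu>. exp (- x * u))"
  using cm_integrable[OF assms] by (simp add: set_integral_space)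

lemma cm_kernel_tail:
  assumes cm: "completely_monotone_with K \<mu>" and "0 < u" "0 < N"
  shows "K u - truncated_kernel \<mu> N u = (LINT x:{N..}|\<mu>. exp (- x * u))"
proof -
  have s: "{0..<N} \<in> sets \<mu>" "{N..} \<in> sets \<mu>" using assms by (auto simp: cm_sets_iff[OF cm])
  have "K u = (LINT x:{0..<N} \<union> {N..}|\<mu>. exp (- x * u))"
    using assms by (subst cm_full[OF cm]) (auto simp: cm_space[OF cm] intro!: arg_cong[where f="\<lambda>A. set_lebesgue_integral \<mu> A _"])
  also have "\<dots> = truncated_kernel \<mu> N u + (LINT x:{N..}|\<mu>. exp (- x * u))"
    unfolding truncated_kernel_def using s assms
    by (intro set_integral_Un cm_set_integrable[OF cm]) auto
  finally show ?thesis by simp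
qed

lemma cm_nonneg: "completely_monotone_with K \<mu> \<Longrightarrow> 0 < u \<Longrightarrow> 0 \<le> K u"
  by (simp only: cm_full cm_kernel_nonneg)

lemma cm_antimono: 
  assumes "completely_monotone_with K \<mu>" "0 < u" "u \<le> v"
  shows "K v \<le> K u"
  using cm_kernel_antimono[OF assms(1) sets.top assms(2,3)] assms cm_full[OF assms(1), of u]
    cm_full[OF assms(1), of v] by simp

text \<open>Chernoff bound at t = 1/x: the indicator of [0,x) at y is at most e times e^(-y/x). The
  growth of K at 0 thus controls the growth of \<mu> at infinity.\<close>

lemma cm_measure_bound:
  assumes cm: "completely_monotone_with K \<mu>" and x: "0 < x"
  shows "measure \<mu> {0..<x} \<le> exp 1 * K (1 / x)"
proof -
  have s: "{0..<x} \<in> sets \<mu>" by (auto simp: cm_sets_iff[OF cm])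
  have f: "emeasure \<mu> {0..<x} < \<infinity>" by (rule cm_finite[OF cm])
  have "measure \<mu> {0..<x} = (LINT y|\<mu>. indicator {0..<x} y)" using s f by simp
  also have "\<dots> \<le> (LINT y|\<mu>. exp 1 * exp (- y * (1 / x)))"
  proof (rule integral_mono)
    show "integrable \<mu> (\<lambda>y. indicator {0..<x} y :: real)" using s f by simp
    show "integrable \<mu> (\<lambda>y. exp 1 * exp (- y * (1 / x)))" using cm_integrable(1)[OF cm, of "1 / x"] x by simp
    fix y show "indicator {0..<x} y \<le> exp 1 * exp (- y * (1 / x))"
      using x by (auto simp: indicator_def mult_exp_exp)
  qed
  also have "\<dots> = exp 1 * K (1 / x)" using cm_integrable(2)[OF cm, of "1 / x"] x by simp
  finally show ?thesis .
qed

text \<open>K decreases, so t K(t)^\<gamma> is at most the integral of K^\<gamma> over (0,t]. The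
  range (0,1] instead of (0,T] is what the later substitution t = 1/x with x \<ge> 1 needs, whatever
  T is.\<close>

lemma cm_Lp_power_bound:
  assumes cm: "completely_monotone_with K \<mu>" and T: "0 < T" and \<gamma>: "0 < \<gamma>" and Lp: "in_Lp_on \<gamma> {0..T} K"
  obtains c where "0 \<le> c" "\<And>t. 0 < t \<Longrightarrow> t \<le> 1 \<Longrightarrow> K t \<le> c * t powr (- 1 / \<gamma>)"
proof -
  define I where "I = (LINT t:{0..T}|lborel. \<bar>K t\<bar> powr \<gamma>)"
  have I0: "0 \<le> I" unfolding I_def set_lebesgue_integral_def by (intro integral_nonneg_AE) auto
  have a: "K t \<le> I powr (1 / \<gamma>) * t powr (- 1 / \<gamma>)" if t: "0 < t" "t \<le> T" for t
  proof -
    have "t * K t powr \<gamma> = (LINT s:{0<..t}|lborel. K t powr \<gamma>)"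
      using t by (simp add: set_integral_const)
    also have "\<dots> \<le> (LINT s:{0..T}|lborel. \<bar>K s\<bar> powr \<gamma>)"
      unfolding set_lebesgue_integral_def
    proof (rule integral_mono)
      show "integrable lborel (\<lambda>s. indicator {0<..t} s *\<^sub>R K t powr \<gamma>)"
        by (intro integrable_scaleR_left integrable_indicator_bounded) auto
      show "integrable lborel (\<lambda>s. indicator {0..T} s *\<^sub>R \<bar>K s\<bar> powr \<gamma>)"
        using Lp by (simp add: in_Lp_on_def set_integrable_def)
      fix s show "indicator {0<..t} s *\<^sub>R K t powr \<gamma> \<le> indicator {0..T} s *\<^sub>R \<bar>K s\<bar> powr \<gamma>"
      proof (cases "s \<in> {0<..t}")
        case True
        then have "K t \<le> K s" "0 \<le> K t" using t by (auto intro: cm_antimono[OF cm] cm_nonneg[OF cm])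
        then have "K t powr \<gamma> \<le> \<bar>K s\<bar> powr \<gamma>" using \<gamma> by (intro powr_mono2) auto
        then show ?thesis using True t by simp
      qed simp
    qed
    finally have "K t powr \<gamma> \<le> I / t" using t by (simp add: I_def field_simps)
    then have "(K t powr \<gamma>) powr (1 / \<gamma>) \<le> (I / t) powr (1 / \<gamma>)" using \<gamma> by (intro powr_mono2) auto
    moreover have "(I / t) powr (1 / \<gamma>) = I powr (1 / \<gamma>) * t powr (- 1 / \<gamma>)"
      using I0 t by (simp add: powr_divide powr_minus_divide)
    ultimately show ?thesis using \<gamma> t cm_nonneg[OF cm, of t] by (simp add: powr_powr)
  qed
  \<comment> \<open>The factor max 1 (T^(-1/\<gamma>)) pays for T < t \<le> 1, where K(t) \<le>
    K(T).\<close>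
  define c where "c = I powr (1 / \<gamma>) * max 1 (T powr (- 1 / \<gamma>))"
  have "K t \<le> c * t powr (- 1 / \<gamma>)" if t: "0 < t" "t \<le> 1" for t
  proof (cases "t \<le> T")
    case True
    have "K t \<le> I powr (1 / \<gamma>) * 1 * t powr (- 1 / \<gamma>)" using a[OF t(1) True] by simp
    also have "\<dots> \<le> c * t powr (- 1 / \<gamma>)" unfolding c_def by (intro mult_right_mono mult_left_mono) auto
    finally show ?thesis .
  next
    case False
    then have "K t \<le> K T" using T by (intro cm_antimono[OF cm]) auto
    also have "\<dots> \<le> I powr (1 / \<gamma>) * T powr (- 1 / \<gamma>)" using a[of T] T by simp
    also have "\<dots> \<le> c" unfolding c_def by (intro mult_left_mono) auto
    also have "c * 1 \<le> c * t powr (- 1 / \<gamma>)"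
    proof (rule mult_left_mono)
      have "t powr (1 / \<gamma>) \<le> 1" using t \<gamma> by (intro powr_le1) auto
      then show "1 \<le> t powr (- 1 / \<gamma>)" using t by (simp add: powr_minus one_le_inverse)
    qed (simp add: c_def)
    finally show ?thesis by simp
  qed
  then show ?thesis by (intro that[of c]) (auto simp: c_def)
qed

text \<open>Dyadic shells: by the two preceding bounds the shell [2^l, 2^(l+1)) has mass
  O(2^(l/\<gamma>)), while the weight on it is at most 2 * 2^(-bl). The shells therefore sum to a
  geometric series of ratio 2^(1/\<gamma> - b) < 1.\<close>

lemma ou_weight_integrable:
  assumes cm: "completely_monotone_with K \<mu>" and T: "0 < T" and \<gamma>: "0 < \<gamma>" and Lp: "in_Lp_on \<gamma> {0..T} K"
    and b: "1 / \<gamma> < b"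
  shows "integrable \<mu> (ou_weight T b)"
proof -
  obtain c where c: "0 \<le> c" "\<And>t. 0 < t \<Longrightarrow> t \<le> 1 \<Longrightarrow> K t \<le> c * t powr (- 1 / \<gamma>)"
    using cm_Lp_power_bound[OF cm T \<gamma> Lp] by blast
  have b0: "0 < b" using b \<gamma> by (meson divide_pos_pos less_trans zero_less_one)
  define I where "I l = {2 ^ l..<(2 ^ Suc l :: real)}" for l :: nat
  have Is[measurable]: "I l \<in> sets \<mu>" for l by (auto simp: I_def cm_sets_iff[OF cm] intro: order_trans[of 0 "2 ^ l"])
  have I0s[measurable]: "{0..<1} \<in> sets \<mu>" by (auto simp: cm_sets_iff[OF cm])
  define w where "w l = 2 * (2 powr (- b)) ^ l" for l :: nat
  have pw: "(2::real) ^ l = 2 powr (real l)" for l :: nat by (simp add: powr_realpow)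
  have em: "emeasure \<mu> (I l) \<le> ennreal (exp 1 * c * 2 powr (1 / \<gamma>) * (2 powr (1 / \<gamma>)) ^ l)" for l
  proof -
    have "emeasure \<mu> (I l) \<le> emeasure \<mu> {0..<2 ^ Suc l}"
      by (intro emeasure_mono) (auto simp: I_def cm_sets_iff[OF cm] intro: order_trans[of 0 "2 ^ l"])
    also have "\<dots> = ennreal (measure \<mu> {0..<2 ^ Suc l})"
      using cm_finite[OF cm, of "2 ^ Suc l"] by (simp add: emeasure_eq_ennreal_measure)
    also have "\<dots> \<le> ennreal (exp 1 * (c * (1 / 2 ^ Suc l) powr (- 1 / \<gamma>)))"
    proof (intro ennreal_leI order_trans[OF cm_measure_bound[OF cm]] mult_left_mono c(2))
      show "1 / 2 ^ Suc l \<le> (1::real)" using two_realpow_ge_one[of "Suc l"] by (simp del: power_Suc)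
    qed auto
    also have "(1 / 2 ^ Suc l) powr (- 1 / \<gamma>) = (2 powr (1 / \<gamma>)) ^ Suc l"
    proof -
      have "(1 / 2 ^ Suc l) = 2 powr (- real (Suc l))" by (simp only: pw powr_minus_divide)
      then have "(1 / 2 ^ Suc l) powr (- 1 / \<gamma>) = 2 powr (1 / \<gamma> * real (Suc l))"
        using \<gamma> by (simp only: powr_powr, intro arg_cong[where f="(powr) 2"]) (simp add: field_simps)
      also have "\<dots> = (2 powr (1 / \<gamma>)) powr real (Suc l)" by (simp only: powr_powr)
      also have "\<dots> = (2 powr (1 / \<gamma>)) ^ Suc l" by (rule powr_realpow) simp
      finally show ?thesis .
    qed
    finally show ?thesis by (simp add: mult_ac)
  qed
  have "(\<integral>\<^sup>+x. ennreal (ou_weight T b x) \<partial>\<mu>)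
      \<le> (\<integral>\<^sup>+x. ennreal (T powr b) * indicator {0..<1} x + (\<Sum>l. ennreal (w l) * indicator (I l) x) \<partial>\<mu>)"
  proof (rule nn_integral_mono)
    fix x assume "x \<in> space \<mu>"
    then have x: "0 \<le> x" by (simp add: cm_space[OF cm])
    show "ennreal (ou_weight T b x)
        \<le> ennreal (T powr b) * indicator {0..<1} x + (\<Sum>l. ennreal (w l) * indicator (I l) x)"
    proof (cases "x < 1")
      case True
      then show ?thesis using x by (simp add: ou_weight_def)
    next
      case False
      define l where "l = nat \<lfloor>log 2 x\<rfloor>"
      have lx: "real l \<le> log 2 x" "log 2 x < real l + 1"
        using False unfolding l_def by (auto simp: zero_le_log_cancel_iff)
      then have "2 powr real l \<le> x" "x < 2 powr (real l + 1)"
        using False by (auto simp: le_log_iff log_less_iff)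
      then have xl: "x \<in> I l" by (auto simp: I_def powr_realpow powr_add)
      have "ou_weight T b x \<le> w l"
      proof -
        have "x powr (- b) \<le> (2 powr real l) powr (- b)"
          using \<open>2 powr real l \<le> x\<close> b0 by (intro powr_mono2') auto
        also have "\<dots> = (2 powr (- b)) ^ l" by (simp add: powr_realpow[symmetric] powr_powr mult.commute)
        finally show ?thesis using False by (simp add: ou_weight_def w_def)
      qed
      then have "ennreal (ou_weight T b x) \<le> ennreal (w l) * indicator (I l) x"
        using xl by (simp add: ennreal_leI)
      also have "\<dots> \<le> (\<Sum>l. ennreal (w l) * indicator (I l) x)"
        using sum_le_suminf[of "\<lambda>l. ennreal (w l) * indicator (I l) x" "{l}"] by (simp del: sum_mult_indicator)
      finally show ?thesis by (meson add_increasing zero_le)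
    qed
  qed
  also have "\<dots> = ennreal (T powr b) * emeasure \<mu> {0..<1} + (\<Sum>l. ennreal (w l) * emeasure \<mu> (I l))"
    by (simp add: nn_integral_add nn_integral_suminf nn_integral_cmult)
  also have "\<dots> \<le> ennreal (T powr b) * emeasure \<mu> {0..<1}
      + (\<Sum>l. ennreal (w l) * ennreal (exp 1 * c * 2 powr (1 / \<gamma>) * (2 powr (1 / \<gamma>)) ^ l))"
    by (intro add_left_mono suminf_le mult_left_mono em) auto
  also have "(\<lambda>l. ennreal (w l) * ennreal (exp 1 * c * 2 powr (1 / \<gamma>) * (2 powr (1 / \<gamma>)) ^ l))
      = (\<lambda>l. ennreal ((2 * exp 1 * c * 2 powr (1 / \<gamma>)) * (2 powr (1 / \<gamma> - b)) ^ l))"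
    using c by (intro ext) (simp add: w_def ennreal_mult[symmetric] power_mult_distrib[symmetric] powr_add[symmetric] mult_ac)
  also have "ennreal (T powr b) * emeasure \<mu> {0..<1} + (\<Sum>l. ennreal ((2 * exp 1 * c * 2 powr (1 / \<gamma>)) * (2 powr (1 / \<gamma> - b)) ^ l)) < \<infinity>"
  proof -
    have "2 powr (1 / \<gamma> - b) < 2 powr 0" using b by (intro powr_less_mono) auto
    then have "summable (\<lambda>l. (2 * exp 1 * c * 2 powr (1 / \<gamma>)) * (2 powr (1 / \<gamma> - b)) ^ l)"
      by (intro summable_mult summable_geometric) auto
    then show ?thesis using c cm_finite[OF cm, of 1]
      by (subst suminf_ennreal2) (auto simp: ennreal_mult_less_top)
  qed
  finally show ?thesis
    by (intro integrableI_nonneg cm_measurable[OF cm]) (auto simp: ou_weight_nonneg)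
qed

section \<open>Energy of the kernel, exponential discounting and Riemann sums\<close>

lemma cm_square_integrable:
  assumes T: "0 < T" and \<gamma>: "2 < \<gamma>" and Lp: "in_Lp_on \<gamma> {0..T} K"
  shows "set_integrable lborel {0<..T} (\<lambda>u. (K u)\<^sup>2)"
proof -
  have m: "(\<lambda>u. indicator {0..T} u * K u) \<in> borel_measurable borel"
    using Lp by (simp add: in_Lp_on_def set_borel_measurable_def)
  \<comment> \<open>\<open>in_Lp_on\<close> gives measurability of K only after multiplication by
    the indicator of [0,T], which is why that indicator stays inside the square.\<close>
  have "integrable lborel (\<lambda>u. indicator {0<..T} u * (indicator {0..T} u * K u)\<^sup>2)"
  proof (rule Bochner_Integration.integrable_bound)
    show "integrable lborel (\<lambda>u. indicator {0..T} u + indicator {0..T} u *\<^sub>R \<bar>K u\<bar> powr \<gamma>)"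
      using Lp by (intro Bochner_Integration.integrable_add) (auto simp: in_Lp_on_def set_integrable_def intro: integrable_indicator_bounded)
    have sq: "(K u)\<^sup>2 \<le> 1 + \<bar>K u\<bar> powr \<gamma>" for u
    proof (cases "\<bar>K u\<bar> \<le> 1")
      case True
      then have "(K u)\<^sup>2 \<le> 1" by (simp add: abs_square_le_1)
      then show ?thesis by (simp add: add_increasing2)
    next
      case False
      then have "\<bar>K u\<bar> powr 2 \<le> \<bar>K u\<bar> powr \<gamma>" using \<gamma> by (intro powr_mono) auto
      then show ?thesis using False by (simp add: powr_numeral)
    qed
    show "AE u in lborel. norm (indicator {0<..T} u * (indicator {0..T} u * K u)\<^sup>2)
        \<le> norm (indicator {0..T} u + indicator {0..T} u *\<^sub>R \<bar>K u\<bar> powr \<gamma>)"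
      using sq by (intro AE_I2) (auto simp: indicator_def)
  qed (use m in measurable)
  also have "(\<lambda>u. indicator {0<..T} u * (indicator {0..T} u * K u)\<^sup>2) = (\<lambda>u. indicator {0<..T} u *\<^sub>R (K u)\<^sup>2)"
    by (auto simp: indicator_def)
  finally show ?thesis by (simp add: set_integrable_def)
qed

lemma discounted_energy_integrable:
  assumes "set_integrable lborel {0<..T} (\<lambda>u. (K u :: real)\<^sup>2)" "0 \<le> r"
  shows "set_integrable lborel {0<..T} (\<lambda>u. (K u)\<^sup>2 * exp (- r * u))"
  unfolding set_integrable_def
proof (rule Bochner_Integration.integrable_bound)
  show i: "integrable lborel (\<lambda>u. indicator {0<..T} u *\<^sub>R (K u)\<^sup>2)" using assms(1) by (simp add: set_integrable_def)
  have "(\<lambda>u. (indicator {0<..T} u *\<^sub>R (K u)\<^sup>2) * exp (- r * u)) \<in> borel_measurable lborel"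
    using borel_measurable_integrable[OF i] by measurable
  then show "(\<lambda>u. indicator {0<..T} u *\<^sub>R ((K u)\<^sup>2 * exp (- r * u))) \<in> borel_measurable lborel"
    by (simp add: mult_ac)
  show "AE u in lborel. norm (indicator {0<..T} u *\<^sub>R ((K u)\<^sup>2 * exp (- r * u))) \<le> norm (indicator {0<..T} u *\<^sub>R (K u)\<^sup>2)"
    using assms(2) by (intro AE_I2) (auto simp: indicator_def abs_mult intro!: mult_left_le)
qed

text \<open>Dominated convergence along integer rates: e^(-nu) tends to 0 for every u > 0, and the
  interval is open at 0.\<close>

lemma discounted_energy_small:
  assumes int: "set_integrable lborel {0<..T} (\<lambda>u. (K u :: real)\<^sup>2)" and \<epsilon>: "0 < \<epsilon>"
  obtains r where "0 \<le> r" "(LINT u:{0<..T}|lborel. (K u)\<^sup>2 * exp (- r * u)) < \<epsilon>"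
proof -
  have "(\<lambda>n. LINT u:{0<..T}|lborel. (K u)\<^sup>2 * exp (- real n * u)) \<longlonglongrightarrow> (LINT u:{0<..T}|lborel. 0)"
    unfolding set_lebesgue_integral_def
  proof (rule integral_dominated_convergence[where w="\<lambda>u. indicator {0<..T} u *\<^sub>R (K u)\<^sup>2"])
    show "integrable lborel (\<lambda>u. indicator {0<..T} u *\<^sub>R (K u)\<^sup>2)" using int by (simp add: set_integrable_def)
    show "(\<lambda>u. indicator {0<..T} u *\<^sub>R ((K u)\<^sup>2 * exp (- real n * u))) \<in> borel_measurable lborel" for n
      using discounted_energy_integrable[OF int, of "real n"] unfolding set_integrable_def
      by (intro borel_measurable_integrable) simp
    show "AE u in lborel. norm (indicator {0<..T} u *\<^sub>R ((K u)\<^sup>2 * exp (- real n * u))) \<le> indicator {0<..T} u *\<^sub>R (K u)\<^sup>2" for n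
      by (intro AE_I2) (auto simp: indicator_def abs_mult intro!: mult_left_le)
    show "AE u in lborel. (\<lambda>n. indicator {0<..T} u *\<^sub>R ((K u)\<^sup>2 * exp (- real n * u))) \<longlonglongrightarrow> indicator {0<..T} u *\<^sub>R 0"
    proof (intro AE_I2)
      fix u :: real
      show "(\<lambda>n. indicator {0<..T} u *\<^sub>R ((K u)\<^sup>2 * exp (- real n * u))) \<longlonglongrightarrow> indicator {0<..T} u *\<^sub>R 0"
      proof (cases "u \<in> {0<..T}")
        case True
        have "exp (- real n * u) = exp (- u) ^ n" for n by (simp add: exp_of_nat_mult[symmetric])
        moreover have "(\<lambda>n. exp (- u) ^ n) \<longlonglongrightarrow> 0" using True by (intro LIMSEQ_realpow_zero) auto
        ultimately have "(\<lambda>n. (K u)\<^sup>2 * exp (- real n * u)) \<longlonglongrightarrow> (K u)\<^sup>2 * 0"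
          by (intro tendsto_mult) auto
        then show ?thesis using True by simp
      qed simp
    qed
  qed simp
  then have "\<forall>\<^sub>F n in sequentially. (LINT u:{0<..T}|lborel. (K u)\<^sup>2 * exp (- real n * u)) < \<epsilon>"
    using \<epsilon> by (intro order_tendstoD) auto
  then obtain n where "(LINT u:{0<..T}|lborel. (K u)\<^sup>2 * exp (- real n * u)) < \<epsilon>"
    by (auto simp: eventually_sequentially)
  then show ?thesis using that[of "real n"] by simp
qed

text \<open>Right-endpoint sums of a decreasing function lie below the integral, also when f is
  singular at 0. No discretization error is left to estimate, so the moment bounds hold on every
  grid with the same constant.\<close>

lemma riemann_sum_le_integral:
  fixes f :: "real \<Rightarrow> real"
  assumes anti: "\<And>u v. 0 < u \<Longrightarrow> u \<le> v \<Longrightarrow> v \<le> T \<Longrightarrow> f v \<le> f u" and nonneg: "\<And>u. 0 < u \<Longrightarrow> u \<le> T \<Longrightarrow> 0 \<le> f u"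
    and int: "set_integrable lborel {0<..T} f" and \<delta>: "0 < \<delta>" and j: "real j * \<delta> \<le> T"
  shows "(\<Sum>d=1..j. f (real d * \<delta>) * \<delta>) \<le> (LINT u:{0<..T}|lborel. f u)"
proof -
  have sub: "set_integrable lborel A f" if "A \<in> sets borel" "A \<subseteq> {0<..T}" for A
    using set_integrable_subset[OF int _ that(2)] that(1) by simp
  have "(\<Sum>d=1..j. f (real d * \<delta>) * \<delta>) \<le> (LINT u:{0<..real j * \<delta>}|lborel. f u)"
    using j
  proof (induction j)
    case (Suc j)
    have le: "real j * \<delta> \<le> real (Suc j) * \<delta>" using \<delta> by (intro mult_right_mono) auto
    have pos: "0 < x" if "real j * \<delta> < x" for x
      using that \<delta> by (meson le_less_trans mult_nonneg_nonneg of_nat_0_le_iff less_imp_le)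
    have jT: "real j * \<delta> \<le> T" using le Suc.prems by simp
    have "f (real (Suc j) * \<delta>) * \<delta> = (LINT u:{real j * \<delta><..real (Suc j) * \<delta>}|lborel. f (real (Suc j) * \<delta>))"
      using \<delta> by (simp add: set_integral_const algebra_simps)
    also have "\<dots> \<le> (LINT u:{real j * \<delta><..real (Suc j) * \<delta>}|lborel. f u)"
    proof (rule set_integral_mono)
      show "set_integrable lborel {real j * \<delta><..real (Suc j) * \<delta>} f"
        using Suc.prems pos by (intro sub) auto
      fix u assume u: "u \<in> {real j * \<delta><..real (Suc j) * \<delta>}"
      moreover have "0 \<le> real j * \<delta>" using \<delta> by simp
      ultimately show "f (real (Suc j) * \<delta>) \<le> f u" using Suc.prems by (intro anti) auto
    qed (auto simp: set_integrable_def intro: integrable_indicator_bounded)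
    finally have "(\<Sum>d=1..Suc j. f (real d * \<delta>) * \<delta>)
       \<le> (LINT u:{0<..real j * \<delta>}|lborel. f u) + (LINT u:{real j * \<delta><..real (Suc j) * \<delta>}|lborel. f u)"
      using Suc.IH[OF jT] by simp
    also have "\<dots> = (LINT u:{0<..real j * \<delta>} \<union> {real j * \<delta><..real (Suc j) * \<delta>}|lborel. f u)"
      using jT Suc.prems pos by (intro set_integral_Un[symmetric] sub) auto
    also have "{0<..real j * \<delta>} \<union> {real j * \<delta><..real (Suc j) * \<delta>} = {0<..real (Suc j) * \<delta>}"
      using le \<delta> by (intro ivl_disj_un_two) auto
    finally show ?case .
  qed (simp add: set_lebesgue_integral_def)
  also have "\<dots> \<le> (LINT u:{0<..T}|lborel. f u)"
    unfolding set_lebesgue_integral_def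
  proof (rule integral_mono)
    show "integrable lborel (\<lambda>u. indicator {0<..real j * \<delta>} u *\<^sub>R f u)"
      using sub[of "{0<..real j * \<delta>}"] j unfolding set_integrable_def by force
    show "integrable lborel (\<lambda>u. indicator {0<..T} u *\<^sub>R f u)" using int unfolding set_integrable_def .
  qed (use j nonneg in \<open>auto simp: indicator_def\<close>)
  finally show ?thesis .
qed

section \<open>Moments of martingale sums\<close>

text \<open>A crude Young inequality: both factors are replaced by the larger of |u| and |v|. It
  gives the integrability of mixed moments and, after normalization, their size.\<close>

lemma abs_power_mult_le:
  fixes u v :: real
  assumes "k \<le> n"
  shows "\<bar>u ^ k * v ^ (n - k)\<bar> \<le> \<bar>u\<bar> ^ n + \<bar>v\<bar> ^ n"
proof -
  define w where "w = max \<bar>u\<bar> \<bar>v\<bar>"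
  have "\<bar>u ^ k * v ^ (n - k)\<bar> \<le> w ^ k * w ^ (n - k)"
    unfolding abs_mult power_abs by (intro mult_mono power_mono) (auto simp: w_def)
  also have "\<dots> = w ^ n" using assms by (simp add: power_add[symmetric])
  also have "\<dots> \<le> \<bar>u\<bar> ^ n + \<bar>v\<bar> ^ n" by (simp add: w_def max_def)
  finally show ?thesis .
qed

lemma integrable_power_mult:
  fixes u v :: "'b \<Rightarrow> real"
  assumes [measurable]: "u \<in> borel_measurable N" "v \<in> borel_measurable N"
    and int: "integrable N (\<lambda>x. u x ^ (2 * m))" "integrable N (\<lambda>x. v x ^ (2 * m))" and k: "k \<le> 2 * m"
  shows "integrable N (\<lambda>x. u x ^ k * v x ^ (2 * m - k))"
proof (rule Bochner_Integration.integrable_bound)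
  show "integrable N (\<lambda>x. u x ^ (2 * m) + v x ^ (2 * m))" using int by simp
  show "AE x in N. norm (u x ^ k * v x ^ (2 * m - k)) \<le> norm (u x ^ (2 * m) + v x ^ (2 * m))"
  proof (intro AE_I2)
    fix x
    have "norm (u x ^ k * v x ^ (2 * m - k)) \<le> u x ^ (2 * m) + v x ^ (2 * m)"
      using abs_power_mult_le[OF k, of "u x" "v x"] by (simp add: power_even_abs)
    then show "norm (u x ^ k * v x ^ (2 * m - k)) \<le> norm (u x ^ (2 * m) + v x ^ (2 * m))" by simp
  qed
qed measurable

context brownian_motion
begin

lemma F_space: "0 \<le> t \<Longrightarrow> space (F t) = space M"
  using filtration_subalgebra[of t] by (simp add: subalgebra_def)

lemma F_measurable: "0 \<le> t \<Longrightarrow> f \<in> borel_measurable (F t) \<Longrightarrow> f \<in> borel_measurable M"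
  using filtration_subalgebra[of t] by (rule measurable_from_subalg)

lemma F_measurable_mono:
  assumes "0 \<le> s" "s \<le> t" "f \<in> borel_measurable (F s)"
  shows "f \<in> borel_measurable (F t)"
proof -
  have "subalgebra (F t) (F s)"
    using assms filtration_mono[of s t] by (auto simp: subalgebra_def F_space)
  then show ?thesis using assms(3) by (rule measurable_from_subalg)
qed

lemma W_measurable: "0 \<le> s \<Longrightarrow> s \<le> t \<Longrightarrow> W s \<in> borel_measurable (F t)"
  using F_measurable_mono[OF _ _ adapted] by simp

lemma W_measurable_M: "0 \<le> s \<Longrightarrow> W s \<in> borel_measurable M"
  using F_measurable[OF _ adapted] by simp

lemma increment_integrable:
  assumes "0 \<le> s" "s \<le> t"
  shows "integrable M (\<lambda>\<omega>. (W t \<omega> - W s \<omega>) ^ l)"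
proof (cases "s = t")
  case False
  then have st: "s < t" using assms by simp
  have "0 < sqrt (t - s)" using st by simp
  then show ?thesis
    using distributed_integrable[OF normal_increments[OF assms(1) st], of "\<lambda>x. x ^ l"]
      integrable_normal_moment[of "sqrt (t - s)" 0 l] by (simp add: normal_density_nonneg)
qed simp

lemma increment_moment_odd:
  assumes "0 \<le> s" "s \<le> t"
  shows "expectation (\<lambda>\<omega>. (W t \<omega> - W s \<omega>) ^ (2 * k + 1)) = 0"
proof (cases "s = t")
  case False
  then have st: "s < t" using assms by simp
  have "0 < sqrt (t - s)" using st by simp
  then show ?thesis
    using distributed_integral[OF normal_increments[OF assms(1) st], of "\<lambda>x. x ^ (2 * k + 1)"]
      integral_normal_moment_odd[of "sqrt (t - s)" 0 k] by (simp add: normal_density_nonneg)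
qed simp

lemma increment_moment_even:
  assumes "0 \<le> s" "s \<le> t"
  shows "expectation (\<lambda>\<omega>. (W t \<omega> - W s \<omega>) ^ (2 * k)) = fact (2 * k) / (2 ^ k * fact k) * (t - s) ^ k"
proof (cases "s = t")
  case True
  then show ?thesis by (cases k) (simp_all add: prob_space)
next
  case False
  then have st: "s < t" using assms by simp
  have "0 < sqrt (t - s)" using st by simp
  then show ?thesis
    using distributed_integral[OF normal_increments[OF assms(1) st], of "\<lambda>x. x ^ (2 * k)"]
      integral_normal_moment_even[of "sqrt (t - s)" 0 k] st
    by (simp add: normal_density_nonneg power_divide mult_ac)
qed

text \<open>Independence of the increment from \<open>F s\<close> passes to the sigma-algebra
  generated by V, and from there to products of expectations. The case s = t is separate because the
  Brownian axioms speak of s < t.\<close>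

lemma increment_independent:
  assumes s: "0 \<le> s" "s \<le> t" and V: "V \<in> borel_measurable (F s)" and int: "integrable M V"
  shows "integrable M (\<lambda>\<omega>. V \<omega> * (W t \<omega> - W s \<omega>) ^ l)"
    and "expectation (\<lambda>\<omega>. V \<omega> * (W t \<omega> - W s \<omega>) ^ l) = expectation V * expectation (\<lambda>\<omega>. (W t \<omega> - W s \<omega>) ^ l)"
proof -
  have "integrable M (\<lambda>\<omega>. V \<omega> * (W t \<omega> - W s \<omega>) ^ l) \<and>
    expectation (\<lambda>\<omega>. V \<omega> * (W t \<omega> - W s \<omega>) ^ l) = expectation V * expectation (\<lambda>\<omega>. (W t \<omega> - W s \<omega>) ^ l)"
  proof (cases "s = t")
    case True
    then show ?thesis using int by (cases l) (simp_all add: prob_space)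
  next
    case False
    then have st: "s < t" using s by simp
    let ?D = "\<lambda>\<omega>. W t \<omega> - W s \<omega>"
    have D: "?D \<in> borel_measurable M" using s by (intro borel_measurable_diff W_measurable_M) auto
    \<comment> \<open>The preimages already form a sigma-algebra, so the generated one in the
      characterization of \<open>indep_var\<close> is the same family.\<close>
    have vim: "{?D -` B \<inter> space M | B. B \<in> sets borel} = sets (vimage_algebra (space M) ?D borel)"
      by (subst sets_vimage_algebra2) auto
    have sig: "sigma_sets (space M) {?D -` B \<inter> space M | B. B \<in> sets borel} = {?D -` B \<inter> space M | B. B \<in> sets borel}"
      unfolding vim using sets.sigma_sets_eq[of "vimage_algebra (space M) ?D borel"] by simp
    have sub: "sigma_sets (space M) {V -` A \<inter> space M | A. A \<in> sets borel} \<subseteq> sets (F s)"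
    proof -
      have "sigma_sets (space (F s)) {V -` A \<inter> space M | A. A \<in> sets borel} \<subseteq> sets (F s)"
        using V F_space[OF s(1)] by (intro sets.sigma_sets_subset) (auto dest: measurable_sets)
      then show ?thesis using F_space[OF s(1)] by simp
    qed
    have ind: "indep_var borel V borel ?D"
      unfolding indep_var_eq
    proof (intro conjI)
      show "indep_set (sigma_sets (space M) {V -` A \<inter> space M |A. A \<in> sets borel})
         (sigma_sets (space M) {?D -` A \<inter> space M |A. A \<in> sets borel})"
        unfolding sig using independent_increments[OF s(1) st] sub
        unfolding indep_set_def by (elim indep_sets_mono_sets) (auto split: bool.splits)
    qed (use F_measurable[OF s(1) V] D in auto)
    have ind': "indep_var borel V borel (\<lambda>\<omega>. ?D \<omega> ^ l)"
      using indep_var_compose[OF ind, of "\<lambda>x. x" borel "\<lambda>x. x ^ l" borel] by (simp add: comp_def)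
    show ?thesis
      using indep_var_lebesgue_integral[OF ind' int increment_integrable[OF s]]
        indep_var_integrable[OF ind' int increment_integrable[OF s]] by simp
  qed
  then show "integrable M (\<lambda>\<omega>. V \<omega> * (W t \<omega> - W s \<omega>) ^ l)"
    and "expectation (\<lambda>\<omega>. V \<omega> * (W t \<omega> - W s \<omega>) ^ l) = expectation V * expectation (\<lambda>\<omega>. (W t \<omega> - W s \<omega>) ^ l)"
    by auto
qed

text \<open>One step of a Burkholder-type inequality with explicit constant. In the binomial
  expansion the odd powers of the increment have mean 0, and the even terms are compared one by one
  with the expansion of (y + 4 m^2 b (t - s))^m. In this form the m-th root of the moment bound
  grows additively, so the steps of a martingale sum add up without loss.\<close>

lemma moment_step:
  assumes s: "0 \<le> s" "s \<le> t" and V: "V \<in> borel_measurable (F s)" and \<xi>: "\<xi> \<in> borel_measurable (F s)"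
    and Vi: "integrable M (\<lambda>\<omega>. V \<omega> ^ (2 * m))" and \<xi>i: "integrable M (\<lambda>\<omega>. \<xi> \<omega> ^ (2 * m))"
    and Vy: "expectation (\<lambda>\<omega>. V \<omega> ^ (2 * m)) \<le> y ^ m" and \<xi>b: "expectation (\<lambda>\<omega>. \<xi> \<omega> ^ (2 * m)) \<le> b ^ m"
    and y: "0 < y" and b: "0 < b"
  shows "integrable M (\<lambda>\<omega>. (V \<omega> + \<xi> \<omega> * (W t \<omega> - W s \<omega>)) ^ (2 * m))"
    and "expectation (\<lambda>\<omega>. (V \<omega> + \<xi> \<omega> * (W t \<omega> - W s \<omega>)) ^ (2 * m)) \<le> (y + 4 * (real m)\<^sup>2 * b * (t - s)) ^ m"
proof -
  note VM[measurable] = F_measurable[OF s(1) V] and \<xi>M[measurable] = F_measurable[OF s(1) \<xi>]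
  define D where "D \<omega> = W t \<omega> - W s \<omega>" for \<omega>
  define U where "U l \<omega> = \<xi> \<omega> ^ l * V \<omega> ^ (2 * m - l)" for l \<omega>
  have UF: "U l \<in> borel_measurable (F s)" for l
    unfolding U_def using V \<xi> by (intro borel_measurable_times borel_measurable_power)
  have Ui: "integrable M (U l)" if "l \<le> 2 * m" for l
    unfolding U_def using that by (intro integrable_power_mult Vi \<xi>i) auto
  have UDi: "integrable M (\<lambda>\<omega>. U l \<omega> * D \<omega> ^ l)" if "l \<le> 2 * m" for l
    unfolding D_def by (rule increment_independent(1)[OF s UF Ui[OF that]])
  have UDe: "expectation (\<lambda>\<omega>. U l \<omega> * D \<omega> ^ l) = expectation (U l) * expectation (\<lambda>\<omega>. D \<omega> ^ l)" if "l \<le> 2 * m" for l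
    unfolding D_def by (rule increment_independent(2)[OF s UF Ui[OF that]])
  have ex: "(V \<omega> + \<xi> \<omega> * D \<omega>) ^ (2 * m) = (\<Sum>l\<le>2 * m. real (2 * m choose l) * (U l \<omega> * D \<omega> ^ l))" for \<omega>
    unfolding U_def by (subst add.commute, subst binomial_ring) (simp add: power_mult_distrib mult_ac)
  show "integrable M (\<lambda>\<omega>. (V \<omega> + \<xi> \<omega> * (W t \<omega> - W s \<omega>)) ^ (2 * m))"
    using UDi unfolding D_def[symmetric] ex by auto
  \<comment> \<open>The constant must be exactly 1 at k = 0, since otherwise it would multiply up
    over the steps of a sum; for k \<ge> 1 the 2 is absorbed by 2^k k!. Dividing by y and b first
    gives the crude Young inequality the right homogeneity, and so both are taken positive.\<close>
  have U2: "expectation (U (2 * k)) \<le> (if k = 0 then 1 else 2) * (b ^ k * y ^ (m - k))" if k: "k \<le> m" for k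
  proof (cases "k = 0")
    case True
    have "U 0 = (\<lambda>\<omega>. V \<omega> ^ (2 * m))" by (simp add: U_def fun_eq_iff)
    then show ?thesis using Vy True by simp
  next
    case False
    have pt: "U (2 * k) \<omega> \<le> (b ^ k * y ^ (m - k)) * (\<xi> \<omega> ^ (2 * m) / b ^ m + V \<omega> ^ (2 * m) / y ^ m)" for \<omega>
    proof -
      have "U (2 * k) \<omega> = (b ^ k * y ^ (m - k)) * (((\<xi> \<omega>)\<^sup>2 / b) ^ k * ((V \<omega>)\<^sup>2 / y) ^ (m - k))"
        using y b k by (simp add: U_def power_divide power_mult[symmetric] diff_mult_distrib2)
      also have "\<dots> \<le> (b ^ k * y ^ (m - k)) * (\<bar>(\<xi> \<omega>)\<^sup>2 / b\<bar> ^ m + \<bar>(V \<omega>)\<^sup>2 / y\<bar> ^ m)"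
        using abs_power_mult_le[OF k, of "(\<xi> \<omega>)\<^sup>2 / b" "(V \<omega>)\<^sup>2 / y"] b y by (intro mult_left_mono) auto
      also have "\<dots> = (b ^ k * y ^ (m - k)) * (\<xi> \<omega> ^ (2 * m) / b ^ m + V \<omega> ^ (2 * m) / y ^ m)"
        using b y by (simp add: power_divide power_mult[symmetric])
      finally show ?thesis .
    qed
    have "expectation (U (2 * k)) \<le> expectation (\<lambda>\<omega>. (b ^ k * y ^ (m - k)) * (\<xi> \<omega> ^ (2 * m) / b ^ m + V \<omega> ^ (2 * m) / y ^ m))"
      using Ui[of "2 * k"] k Vi \<xi>i pt by (intro integral_mono) auto
    also have "\<dots> = (b ^ k * y ^ (m - k)) * (expectation (\<lambda>\<omega>. \<xi> \<omega> ^ (2 * m)) / b ^ m + expectation (\<lambda>\<omega>. V \<omega> ^ (2 * m)) / y ^ m)"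
      using Vi \<xi>i by simp
    also have "\<dots> \<le> (b ^ k * y ^ (m - k)) * (1 + 1)"
      using Vy \<xi>b b y by (intro mult_left_mono add_mono) (auto simp: divide_le_eq)
    finally show ?thesis using False by simp
  qed
  define g where "g l = real (2 * m choose l) * (expectation (U l) * expectation (\<lambda>\<omega>. D \<omega> ^ l))" for l
  have "expectation (\<lambda>\<omega>. (V \<omega> + \<xi> \<omega> * D \<omega>) ^ (2 * m)) = (\<Sum>l\<le>2 * m. g l)"
    unfolding ex g_def by (subst Bochner_Integration.integral_sum) (auto simp: UDi UDe)
  also have "\<dots> = (\<Sum>l\<in>(\<lambda>k. 2 * k) ` {..m}. g l)"
  proof (rule sum.mono_neutral_right)
    show "\<forall>l\<in>{..2 * m} - (\<lambda>k. 2 * k) ` {..m}. g l = 0"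
    proof
      fix l assume l: "l \<in> {..2 * m} - (\<lambda>k. 2 * k) ` {..m}"
      have "odd l"
      proof
        assume "even l"
        then obtain k where "l = 2 * k" by (elim evenE)
        then show False using l by auto
      qed
      then obtain k where "l = 2 * k + 1" by (elim oddE)
      then show "g l = 0" using increment_moment_odd[OF s, of k] by (simp add: g_def D_def)
    qed
  qed auto
  also have "\<dots> = (\<Sum>k\<le>m. g (2 * k))" by (subst sum.reindex) (auto simp: inj_on_def)
  also have "\<dots> \<le> (\<Sum>k\<le>m. real (m choose k) * (4 * (real m)\<^sup>2 * b * (t - s)) ^ k * y ^ (m - k))"
  proof (rule sum_mono)
    fix k assume "k \<in> {..m}"
    then have k: "k \<le> m" by simp
    define e where "e = (if k = 0 then 1 else 2 :: real)"
    have d0: "0 \<le> (t - s) ^ k" using s by simp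
    have ed: "expectation (\<lambda>\<omega>. D \<omega> ^ (2 * k)) = fact (2 * k) / (2 ^ k * fact k) * (t - s) ^ k"
      unfolding D_def by (rule increment_moment_even[OF s])
    have "g (2 * k) \<le> real (2 * m choose (2 * k)) * ((e * (b ^ k * y ^ (m - k))) * (fact (2 * k) / (2 ^ k * fact k) * (t - s) ^ k))"
      unfolding g_def ed e_def using d0 by (intro mult_left_mono mult_right_mono U2[OF k]) auto
    also have "\<dots> = (real (2 * m choose (2 * k)) * fact (2 * k)) * (e / (2 ^ k * fact k)) * (b ^ k * y ^ (m - k) * (t - s) ^ k)"
      by simp
    \<comment> \<open>(2m choose 2k) (2k)! \<le> (2m)^(2k) = (4 m^2)^k, the Gaussian denominator 2^k
      k! beats \<open>e\<close>, and (m choose k) \<ge> 1 is inserted to reach the target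
      expansion.\<close>
    also have "\<dots> \<le> (real (m choose k) * (4 * (real m)\<^sup>2) ^ k) * 1 * (b ^ k * y ^ (m - k) * (t - s) ^ k)"
    proof (rule mult_right_mono, rule mult_mono)
      have "real ((2 * m choose (2 * k)) * fact (2 * k)) \<le> real ((2 * m) ^ (2 * k))"
        by (rule of_nat_mono) (rule binomial_fact_pow)
      also have "\<dots> = 1 * (4 * (real m)\<^sup>2) ^ k" by (simp add: power_mult power_mult_distrib)
      also have "\<dots> \<le> real (m choose k) * (4 * (real m)\<^sup>2) ^ k"
      proof (rule mult_right_mono)
        have "0 < m choose k" using k by simp
        then show "1 \<le> real (m choose k)" by linarith
      qed simp
      finally show "real (2 * m choose (2 * k)) * fact (2 * k) \<le> real (m choose k) * (4 * (real m)\<^sup>2) ^ k"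
        by (simp add: of_nat_mult)
      show "e / (2 ^ k * fact k) \<le> 1"
      proof (cases "k = 0")
        case False
        then have "(2::real) ^ 1 * 1 \<le> 2 ^ k * fact k" by (intro mult_mono power_increasing) (auto simp: fact_ge_1)
        then show ?thesis using False by (simp add: e_def)
      qed (simp add: e_def)
    qed (use b y d0 in \<open>auto simp: e_def\<close>)
    also have "\<dots> = real (m choose k) * (4 * (real m)\<^sup>2 * b * (t - s)) ^ k * y ^ (m - k)"
      by (simp add: power_mult_distrib mult_ac)
    finally show "g (2 * k) \<le> real (m choose k) * (4 * (real m)\<^sup>2 * b * (t - s)) ^ k * y ^ (m - k)" .
  qed
  also have "\<dots> = (4 * (real m)\<^sup>2 * b * (t - s) + y) ^ m" by (simp add: binomial_ring)
  finally show "expectation (\<lambda>\<omega>. (V \<omega> + \<xi> \<omega> * (W t \<omega> - W s \<omega>)) ^ (2 * m)) \<le> (y + 4 * (real m)\<^sup>2 * b * (t - s)) ^ m"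
    by (simp add: D_def add.commute)
qed

lemma martingale_sum_measurable:
  fixes j :: nat
  assumes \<tau>: "0 \<le> \<tau> 0" "\<And>i. i < j \<Longrightarrow> \<tau> i \<le> \<tau> (Suc i)"
    and \<xi>: "\<And>i. i < j \<Longrightarrow> \<xi> i \<in> borel_measurable (F (\<tau> i))"
  shows "0 \<le> \<tau> j \<and> (\<lambda>\<omega>. \<Sum>i<j. \<xi> i \<omega> * (W (\<tau> (Suc i)) \<omega> - W (\<tau> i) \<omega>)) \<in> borel_measurable (F (\<tau> j))"
  using assms
proof (induction j)
  case (Suc j)
  have IH: "0 \<le> \<tau> j" "(\<lambda>\<omega>. \<Sum>i<j. \<xi> i \<omega> * (W (\<tau> (Suc i)) \<omega> - W (\<tau> i) \<omega>)) \<in> borel_measurable (F (\<tau> j))"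
    using Suc by auto
  have le: "\<tau> j \<le> \<tau> (Suc j)" using Suc.prems(2)[of j] by simp
  have "(\<lambda>\<omega>. (\<Sum>i<j. \<xi> i \<omega> * (W (\<tau> (Suc i)) \<omega> - W (\<tau> i) \<omega>)) + \<xi> j \<omega> * (W (\<tau> (Suc j)) \<omega> - W (\<tau> j) \<omega>)) \<in> borel_measurable (F (\<tau> (Suc j)))"
    using IH(1) le Suc.prems(3)[of j]
    by (intro borel_measurable_add borel_measurable_times borel_measurable_diff W_measurable
        F_measurable_mono[OF IH(1) le IH(2)] F_measurable_mono[OF IH(1) le]) auto
  then show ?case using IH(1) le by simp
qed simp

lemma martingale_sum_moment:
  fixes j :: nat
  assumes \<tau>: "0 \<le> \<tau> 0" "\<And>i. i < j \<Longrightarrow> \<tau> i \<le> \<tau> (Suc i)"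
    and \<xi>: "\<And>i. i < j \<Longrightarrow> \<xi> i \<in> borel_measurable (F (\<tau> i))"
    and \<xi>i: "\<And>i. i < j \<Longrightarrow> integrable M (\<lambda>\<omega>. \<xi> i \<omega> ^ (2 * m))"
    and \<beta>: "\<And>i. i < j \<Longrightarrow> 0 \<le> \<beta> i" "\<And>i. i < j \<Longrightarrow> expectation (\<lambda>\<omega>. \<xi> i \<omega> ^ (2 * m)) \<le> \<beta> i ^ m"
  shows "integrable M (\<lambda>\<omega>. (\<Sum>i<j. \<xi> i \<omega> * (W (\<tau> (Suc i)) \<omega> - W (\<tau> i) \<omega>)) ^ (2 * m))" (is "integrable M (\<lambda>\<omega>. ?V j \<omega> ^ _)")
    and "expectation (\<lambda>\<omega>. (\<Sum>i<j. \<xi> i \<omega> * (W (\<tau> (Suc i)) \<omega> - W (\<tau> i) \<omega>)) ^ (2 * m))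
      \<le> (\<Sum>i<j. 4 * (real m)\<^sup>2 * \<beta> i * (\<tau> (Suc i) - \<tau> i)) ^ m"
proof -
  \<comment> \<open>\<open>moment_step\<close> wants positive bounds, whereas the empty sum and the
    \<beta> i may be 0. All are raised by \<epsilon>, which tends to 0 at the end.\<close>
  have main: "integrable M (\<lambda>\<omega>. ?V j \<omega> ^ (2 * m)) \<and>
    expectation (\<lambda>\<omega>. ?V j \<omega> ^ (2 * m)) \<le> (\<epsilon> + (\<Sum>i<j. 4 * (real m)\<^sup>2 * (\<beta> i + \<epsilon>) * (\<tau> (Suc i) - \<tau> i))) ^ m"
    if \<epsilon>: "0 < \<epsilon>" for \<epsilon> :: real
    using assms
  proof (induction j)
    case 0
    then show ?case using \<epsilon> by (cases "m = 0") (auto simp: prob_space power_0_left)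
  next
    case (Suc j)
    let ?y = "\<lambda>j. \<epsilon> + (\<Sum>i<j. 4 * (real m)\<^sup>2 * (\<beta> i + \<epsilon>) * (\<tau> (Suc i) - \<tau> i))"
    have IH: "integrable M (\<lambda>\<omega>. ?V j \<omega> ^ (2 * m))" "expectation (\<lambda>\<omega>. ?V j \<omega> ^ (2 * m)) \<le> ?y j ^ m"
      using Suc.IH Suc.prems by auto
    have mV: "0 \<le> \<tau> j" "?V j \<in> borel_measurable (F (\<tau> j))"
      using martingale_sum_measurable[of \<tau> j \<xi>] Suc.prems by auto
    have y0: "0 < ?y j"
      using \<epsilon> Suc.prems(2,5) by (intro add_pos_nonneg sum_nonneg mult_nonneg_nonneg) (auto intro: add_nonneg_nonneg)
    have \<beta>j: "expectation (\<lambda>\<omega>. \<xi> j \<omega> ^ (2 * m)) \<le> (\<beta> j + \<epsilon>) ^ m" "0 < \<beta> j + \<epsilon>"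
      using Suc.prems(5,6)[of j] \<epsilon> by (auto intro: order_trans[OF _ power_mono] add_nonneg_pos)
    have le: "\<tau> j \<le> \<tau> (Suc j)" using Suc.prems(2)[of j] by simp
    have \<xi>j: "\<xi> j \<in> borel_measurable (F (\<tau> j))" "integrable M (\<lambda>\<omega>. \<xi> j \<omega> ^ (2 * m))" using Suc.prems by auto
    note st = moment_step[OF mV(1) le mV(2) \<xi>j(1) IH(1) \<xi>j(2) IH(2) \<beta>j(1) y0 \<beta>j(2)]
    show ?case using st by (simp add: add.assoc)
  qed
  show "integrable M (\<lambda>\<omega>. ?V j \<omega> ^ (2 * m))" using main[of 1] by simp
  have "((\<lambda>\<epsilon>. (\<epsilon> + (\<Sum>i<j. 4 * (real m)\<^sup>2 * (\<beta> i + \<epsilon>) * (\<tau> (Suc i) - \<tau> i))) ^ m) \<longlongrightarrow>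
      (0 + (\<Sum>i<j. 4 * (real m)\<^sup>2 * (\<beta> i + 0) * (\<tau> (Suc i) - \<tau> i))) ^ m) (at_right 0)"
    by (intro tendsto_intros)
  moreover have "\<forall>\<^sub>F \<epsilon> in at_right 0. expectation (\<lambda>\<omega>. ?V j \<omega> ^ (2 * m))
      \<le> (\<epsilon> + (\<Sum>i<j. 4 * (real m)\<^sup>2 * (\<beta> i + \<epsilon>) * (\<tau> (Suc i) - \<tau> i))) ^ m"
    using main by (auto simp: eventually_at_right_less eventually_at_filter)
  ultimately have "expectation (\<lambda>\<omega>. ?V j \<omega> ^ (2 * m))
      \<le> (0 + (\<Sum>i<j. 4 * (real m)\<^sup>2 * (\<beta> i + 0) * (\<tau> (Suc i) - \<tau> i))) ^ m"
    by (intro tendsto_lowerbound) auto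
  then show "expectation (\<lambda>\<omega>. ?V j \<omega> ^ (2 * m)) \<le> (\<Sum>i<j. 4 * (real m)\<^sup>2 * \<beta> i * (\<tau> (Suc i) - \<tau> i)) ^ m"
    by simp
qed

end

section \<open>The Ito isometry\<close>

lemma integral_indicator_Ioc_mult:
  fixes a b c d :: real
  assumes "a \<le> b" "c \<le> d"
  shows "integrable lborel (\<lambda>s. indicator {a<..b} s * indicator {c<..d} s :: real)"
    and "(LINT s|lborel. indicator {a<..b} s * indicator {c<..d} s) = max 0 (min b d - max a c)"
proof -
  have eq: "(\<lambda>s. indicator {a<..b} s * indicator {c<..d} s :: real) = indicator {max a c<..min b d}"
    by (auto simp: indicator_def fun_eq_iff)
  show "integrable lborel (\<lambda>s. indicator {a<..b} s * indicator {c<..d} s :: real)"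
    unfolding eq by (intro integrable_indicator_bounded) auto
  show "(LINT s|lborel. indicator {a<..b} s * indicator {c<..d} s) = max 0 (min b d - max a c)"
    unfolding eq by (cases "max a c \<le> min b d") (auto simp: max_def)
qed

context brownian_motion
begin

lemma bounded_mult_integrable:
  fixes \<xi> V :: "'a \<Rightarrow> real"
  assumes "\<xi> \<in> borel_measurable M" "bounded (\<xi> ` space M)" "integrable M V"
  shows "integrable M (\<lambda>\<omega>. \<xi> \<omega> * V \<omega>)"
proof -
  obtain B where B: "\<And>\<omega>. \<omega> \<in> space M \<Longrightarrow> norm (\<xi> \<omega>) \<le> B"
    using assms(2) by (auto simp: bounded_iff)
  show ?thesis
  proof (rule Bochner_Integration.integrable_bound)
    show "integrable M (\<lambda>\<omega>. B * V \<omega>)" using assms(3) by simp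
    show "AE \<omega> in M. norm (\<xi> \<omega> * V \<omega>) \<le> norm (B * V \<omega>)"
      using B by (intro AE_I2) (force simp: abs_mult intro!: mult_right_mono)
  qed (use assms in auto)
qed

lemma bounded_mult:
  fixes \<xi> \<eta> :: "'a \<Rightarrow> real"
  assumes "bounded (\<xi> ` S)" "bounded (\<eta> ` S)"
  shows "bounded ((\<lambda>\<omega>. \<xi> \<omega> * \<eta> \<omega>) ` S)"
proof -
  obtain B C where "\<And>\<omega>. \<omega> \<in> S \<Longrightarrow> \<bar>\<xi> \<omega>\<bar> \<le> B" "\<And>\<omega>. \<omega> \<in> S \<Longrightarrow> \<bar>\<eta> \<omega>\<bar> \<le> C"
    using assms by (auto simp: bounded_iff)
  then have "\<bar>\<xi> \<omega> * \<eta> \<omega>\<bar> \<le> \<bar>B\<bar> * \<bar>C\<bar>" if "\<omega> \<in> S" for \<omega>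
    unfolding abs_mult using that by (intro mult_mono) (auto intro: order_trans[OF _ abs_ge_self])
  then show ?thesis by (auto simp: bounded_iff)
qed

lemma bounded_integrable:
  fixes \<xi> :: "'a \<Rightarrow> real"
  assumes "\<xi> \<in> borel_measurable M" "bounded (\<xi> ` space M)"
  shows "integrable M \<xi>"
  using bounded_mult_integrable[OF assms, of "\<lambda>_. 1"] by simp

text \<open>If the intervals overlap, the product is split at c and at the earlier right end. Each
  mixed product contains an increment that is independent of the other factors and has mean 0; what
  survives is the squared increment over the intersection.\<close>

lemma covariance_aux:
  assumes a: "0 \<le> a" "a \<le> b" and c: "a \<le> c" "c \<le> d"
    and \<xi>: "\<xi> \<in> borel_measurable (F a)" "bounded (\<xi> ` space M)"
    and \<eta>: "\<eta> \<in> borel_measurable (F c)" "bounded (\<eta> ` space M)"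
  shows "integrable M (\<lambda>\<omega>. (\<xi> \<omega> * (W b \<omega> - W a \<omega>)) * (\<eta> \<omega> * (W d \<omega> - W c \<omega>)))"
    and "expectation (\<lambda>\<omega>. (\<xi> \<omega> * (W b \<omega> - W a \<omega>)) * (\<eta> \<omega> * (W d \<omega> - W c \<omega>)))
      = expectation (\<lambda>\<omega>. \<xi> \<omega> * \<eta> \<omega>) * max 0 (min b d - max a c)"
proof -
  have c0: "0 \<le> c" using a c by simp
  have inc: "(\<lambda>\<omega>. W v \<omega> - W u \<omega>) \<in> borel_measurable (F w)" if "0 \<le> u" "u \<le> v" "v \<le> w" for u v w
    using that by (intro borel_measurable_diff W_measurable) auto
  have \<xi>c: "\<xi> \<in> borel_measurable (F c)" by (rule F_measurable_mono[OF a(1) c(1) \<xi>(1)])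
  define \<zeta> where "\<zeta> \<omega> = \<xi> \<omega> * \<eta> \<omega>" for \<omega>
  have \<zeta>: "\<zeta> \<in> borel_measurable (F c)" "bounded (\<zeta> ` space M)"
    unfolding \<zeta>_def using \<xi>c \<eta> \<xi>(2) by (auto intro: bounded_mult)
  have zero: "integrable M (\<lambda>\<omega>. (\<zeta> \<omega> * V \<omega>) * (W d' \<omega> - W c' \<omega>))"
    "expectation (\<lambda>\<omega>. (\<zeta> \<omega> * V \<omega>) * (W d' \<omega> - W c' \<omega>)) = 0"
    if "c \<le> c'" "c' \<le> d'" "V \<in> borel_measurable (F c')" "integrable M V" for c' d' V
  proof -
    have m: "(\<lambda>\<omega>. \<zeta> \<omega> * V \<omega>) \<in> borel_measurable (F c')"
      using F_measurable_mono[OF c0 that(1) \<zeta>(1)] that(3) by simp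
    have i: "integrable M (\<lambda>\<omega>. \<zeta> \<omega> * V \<omega>)"
      using F_measurable[OF c0 \<zeta>(1)] \<zeta>(2) that(4) by (rule bounded_mult_integrable)
    have c'0: "0 \<le> c'" using c0 that by simp
    show "integrable M (\<lambda>\<omega>. (\<zeta> \<omega> * V \<omega>) * (W d' \<omega> - W c' \<omega>))"
      "expectation (\<lambda>\<omega>. (\<zeta> \<omega> * V \<omega>) * (W d' \<omega> - W c' \<omega>)) = 0"
      using increment_independent[OF c'0 that(2) m i, of 1] increment_moment_odd[OF c'0 that(2), of 0] by simp_all
  qed
  have inti: "integrable M (\<lambda>\<omega>. W v \<omega> - W u \<omega>)" if "0 \<le> u" "u \<le> v" for u v
    using increment_integrable[OF that, of 1] by simp
  show "integrable M (\<lambda>\<omega>. (\<xi> \<omega> * (W b \<omega> - W a \<omega>)) * (\<eta> \<omega> * (W d \<omega> - W c \<omega>)))"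
    and "expectation (\<lambda>\<omega>. (\<xi> \<omega> * (W b \<omega> - W a \<omega>)) * (\<eta> \<omega> * (W d \<omega> - W c \<omega>)))
      = expectation (\<lambda>\<omega>. \<xi> \<omega> * \<eta> \<omega>) * max 0 (min b d - max a c)"
  proof (atomize (full), cases "b \<le> c")
    case True
    have eq: "(\<lambda>\<omega>. (\<xi> \<omega> * (W b \<omega> - W a \<omega>)) * (\<eta> \<omega> * (W d \<omega> - W c \<omega>)))
        = (\<lambda>\<omega>. (\<zeta> \<omega> * (W b \<omega> - W a \<omega>)) * (W d \<omega> - W c \<omega>))"
      by (simp add: \<zeta>_def fun_eq_iff)
    show "integrable M (\<lambda>\<omega>. (\<xi> \<omega> * (W b \<omega> - W a \<omega>)) * (\<eta> \<omega> * (W d \<omega> - W c \<omega>))) \<and>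
      expectation (\<lambda>\<omega>. (\<xi> \<omega> * (W b \<omega> - W a \<omega>)) * (\<eta> \<omega> * (W d \<omega> - W c \<omega>)))
      = expectation (\<lambda>\<omega>. \<xi> \<omega> * \<eta> \<omega>) * max 0 (min b d - max a c)"
      unfolding eq using zero[OF order.refl c(2) inc[OF a True] inti[OF a]] True c by (simp add: max_def min_def)
  next
    case False
    \<comment> \<open>The overlap is (c, e]; between e and f only one of the two increments is still
      running.\<close>
    define e where "e = min b d"
    define f where "f = max b d"
    have e: "c \<le> e" "e \<le> f" using False c by (auto simp: e_def f_def)
    have eq: "(\<lambda>\<omega>. (\<xi> \<omega> * (W b \<omega> - W a \<omega>)) * (\<eta> \<omega> * (W d \<omega> - W c \<omega>)))
        = (\<lambda>\<omega>. (\<zeta> \<omega> * (W c \<omega> - W a \<omega>)) * (W d \<omega> - W c \<omega>)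
           + ((\<zeta> \<omega> * (W e \<omega> - W c \<omega>)) * (W f \<omega> - W e \<omega>) + \<zeta> \<omega> * (W e \<omega> - W c \<omega>) ^ 2))"
      by (auto simp: \<zeta>_def fun_eq_iff e_def f_def min_def max_def power2_eq_square algebra_simps)
    have "integrable M \<zeta>" using F_measurable[OF c0 \<zeta>(1)] \<zeta>(2) by (rule bounded_integrable)
    note sq = increment_independent[OF c0 e(1) \<zeta>(1) this, of 2]
    have sqe: "expectation (\<lambda>\<omega>. (W e \<omega> - W c \<omega>) ^ 2) = e - c"
      using increment_moment_even[OF c0 e(1), of 1] by simp
    note z1 = zero[OF order.refl c(2) inc[OF a(1) c(1) order.refl] inti[OF a(1) c(1)]]
    note z2 = zero[OF e inc[OF c0 e(1) order.refl] inti[OF c0 e(1)]]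
    have "max 0 (min b d - max a c) = e - c" using e c by (simp add: e_def)
    then show "integrable M (\<lambda>\<omega>. (\<xi> \<omega> * (W b \<omega> - W a \<omega>)) * (\<eta> \<omega> * (W d \<omega> - W c \<omega>))) \<and>
      expectation (\<lambda>\<omega>. (\<xi> \<omega> * (W b \<omega> - W a \<omega>)) * (\<eta> \<omega> * (W d \<omega> - W c \<omega>)))
      = expectation (\<lambda>\<omega>. \<xi> \<omega> * \<eta> \<omega>) * max 0 (min b d - max a c)"
      unfolding eq using z1 z2 sq sqe by (simp add: \<zeta>_def[symmetric])
  qed
qed

lemma covariance:
  assumes a: "0 \<le> a" "a \<le> b" and c: "0 \<le> c" "c \<le> d"
    and \<xi>: "\<xi> \<in> borel_measurable (F a)" "bounded (\<xi> ` space M)"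
    and \<eta>: "\<eta> \<in> borel_measurable (F c)" "bounded (\<eta> ` space M)"
  shows "integrable M (\<lambda>\<omega>. (\<xi> \<omega> * (W b \<omega> - W a \<omega>)) * (\<eta> \<omega> * (W d \<omega> - W c \<omega>)))"
    and "expectation (\<lambda>\<omega>. (\<xi> \<omega> * (W b \<omega> - W a \<omega>)) * (\<eta> \<omega> * (W d \<omega> - W c \<omega>)))
      = expectation (\<lambda>\<omega>. \<xi> \<omega> * \<eta> \<omega>) * max 0 (min b d - max a c)"
  using covariance_aux[OF a _ c(2) \<xi> \<eta>] covariance_aux[OF c _ a(2) \<eta> \<xi>]
  by (cases "a \<le> c"; simp add: mult.commute min.commute max.commute)+

text \<open>Any finite family of intervals is allowed, overlapping or not, so that two elementary
  processes on unrelated partitions can be subtracted without a common refinement. Both sides expand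
  into the double sum of E[\<xi> i \<xi> j] times the length of the intersection.\<close>

lemma ito_isometry_family:
  fixes a b :: "'i \<Rightarrow> real" and \<xi> :: "'i \<Rightarrow> 'a \<Rightarrow> real"
  assumes I: "finite I" and ab: "\<And>i. i \<in> I \<Longrightarrow> 0 \<le> a i" "\<And>i. i \<in> I \<Longrightarrow> a i \<le> b i"
    and \<xi>: "\<And>i. i \<in> I \<Longrightarrow> \<xi> i \<in> borel_measurable (F (a i))" "\<And>i. i \<in> I \<Longrightarrow> bounded (\<xi> i ` space M)"
  shows "(\<integral>\<^sup>+\<omega>. ennreal ((\<Sum>i\<in>I. \<xi> i \<omega> * (W (b i) \<omega> - W (a i) \<omega>))\<^sup>2) \<partial>M)
    = (\<integral>\<^sup>+\<omega>. (\<integral>\<^sup>+s. ennreal ((\<Sum>i\<in>I. \<xi> i \<omega> * indicator {a i<..b i} s)\<^sup>2) \<partial>lborel) \<partial>M)"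
proof -
  define l where "l i j = max 0 (min (b i) (b j) - max (a i) (a j))" for i j
  have \<xi>M: "\<xi> i \<in> borel_measurable M" if "i \<in> I" for i
    using F_measurable[OF ab(1)[OF that] \<xi>(1)[OF that]] .
  have \<xi>\<xi>: "integrable M (\<lambda>\<omega>. \<xi> i \<omega> * \<xi> j \<omega>)" if "i \<in> I" "j \<in> I" for i j
    using that by (intro bounded_mult_integrable bounded_integrable \<xi>M \<xi>)
  note cov = covariance[OF ab ab \<xi> \<xi>]
  let ?J = "\<lambda>\<omega>. \<Sum>i\<in>I. \<xi> i \<omega> * (W (b i) \<omega> - W (a i) \<omega>)"
  let ?e = "\<lambda>\<omega> s. \<Sum>i\<in>I. \<xi> i \<omega> * indicator {a i<..b i} s"
  have J2: "(?J \<omega>)\<^sup>2 = (\<Sum>i\<in>I. \<Sum>j\<in>I. (\<xi> i \<omega> * (W (b i) \<omega> - W (a i) \<omega>)) * (\<xi> j \<omega> * (W (b j) \<omega> - W (a j) \<omega>)))" for \<omega>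
    by (simp add: power2_eq_square sum_product)
  have e2: "(?e \<omega> s)\<^sup>2 = (\<Sum>i\<in>I. \<Sum>j\<in>I. (\<xi> i \<omega> * \<xi> j \<omega>) * (indicator {a i<..b i} s * indicator {a j<..b j} s))" for \<omega> s
    by (simp add: power2_eq_square sum_product mult_ac)
  have "(\<integral>\<^sup>+\<omega>. ennreal ((?J \<omega>)\<^sup>2) \<partial>M) = ennreal (expectation (\<lambda>\<omega>. (?J \<omega>)\<^sup>2))"
    unfolding J2 by (intro nn_integral_eq_integral Bochner_Integration.integrable_sum cov(1) AE_I2)
      (auto simp: J2[symmetric])
  also have "expectation (\<lambda>\<omega>. (?J \<omega>)\<^sup>2) = (\<Sum>i\<in>I. \<Sum>j\<in>I. expectation (\<lambda>\<omega>. \<xi> i \<omega> * \<xi> j \<omega>) * l i j)"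
    unfolding J2 l_def using cov by (simp add: Bochner_Integration.integral_sum)
  also have "\<dots> = expectation (\<lambda>\<omega>. \<Sum>i\<in>I. \<Sum>j\<in>I. (\<xi> i \<omega> * \<xi> j \<omega>) * l i j)"
    using \<xi>\<xi> by (simp add: Bochner_Integration.integral_sum)
  also have "(\<lambda>\<omega>. \<Sum>i\<in>I. \<Sum>j\<in>I. (\<xi> i \<omega> * \<xi> j \<omega>) * l i j) = (\<lambda>\<omega>. LINT s|lborel. (?e \<omega> s)\<^sup>2)"
    unfolding e2 l_def using integral_indicator_Ioc_mult[OF ab(2) ab(2)]
    by (intro ext) (simp add: Bochner_Integration.integral_sum)
  also have "ennreal (expectation (\<lambda>\<omega>. LINT s|lborel. (?e \<omega> s)\<^sup>2)) = (\<integral>\<^sup>+\<omega>. ennreal (LINT s|lborel. (?e \<omega> s)\<^sup>2) \<partial>M)"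
  proof (rule nn_integral_eq_integral[symmetric])
    have "(\<lambda>\<omega>. LINT s|lborel. (?e \<omega> s)\<^sup>2) = (\<lambda>\<omega>. \<Sum>i\<in>I. \<Sum>j\<in>I. (\<xi> i \<omega> * \<xi> j \<omega>) * l i j)"
      unfolding e2 l_def using integral_indicator_Ioc_mult[OF ab(2) ab(2)]
      by (intro ext) (simp add: Bochner_Integration.integral_sum)
    then show "integrable M (\<lambda>\<omega>. LINT s|lborel. (?e \<omega> s)\<^sup>2)" using \<xi>\<xi> by simp
  qed simp
  also have "\<dots> = (\<integral>\<^sup>+\<omega>. (\<integral>\<^sup>+s. ennreal ((?e \<omega> s)\<^sup>2) \<partial>lborel) \<partial>M)"
  proof (intro nn_integral_cong nn_integral_eq_integral[symmetric])
    fix \<omega>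
    show "integrable lborel (\<lambda>s. (?e \<omega> s)\<^sup>2)"
      unfolding e2 using integral_indicator_Ioc_mult[OF ab(2) ab(2)]
      by (intro Bochner_Integration.integrable_sum integrable_mult_right) auto
  qed simp
  finally show ?thesis .
qed

end

text \<open>The kernel is evaluated at the distance to the left end point, hence never at \<open>0\<close>; for a decreasing
  kernel these sums stay below the singularity.\<close>

definition ito_sum :: "(real \<Rightarrow> 'a \<Rightarrow> real) \<Rightarrow> (real \<Rightarrow> real) \<Rightarrow> (real \<Rightarrow> 'a \<Rightarrow> real) \<Rightarrow> real \<Rightarrow> nat \<Rightarrow> 'a \<Rightarrow> real" where
  "ito_sum W k g \<delta> J \<omega> =
    (\<Sum>i<J. k (real (J - i) * \<delta>) * g (real i * \<delta>) \<omega> * (W (real (Suc i) * \<delta>) \<omega> - W (real i * \<delta>) \<omega>))"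

section \<open>The Ito integral as the limit of left-point sums\<close>

lemma ennreal_sq_triangle:
  "ennreal ((x - z)\<^sup>2) \<le> 2 * ennreal ((x - y)\<^sup>2) + 2 * ennreal ((y - z)\<^sup>2)"
proof -
  have "0 \<le> (x - y - (y - z))\<^sup>2" by simp
  then have "(x - z)\<^sup>2 \<le> 2 * (x - y)\<^sup>2 + 2 * (y - z)\<^sup>2" by (simp add: power2_eq_square algebra_simps)
  then have "ennreal ((x - z)\<^sup>2) \<le> ennreal (2 * (x - y)\<^sup>2 + 2 * (y - z)\<^sup>2)" by (rule ennreal_leI)
  also have "\<dots> = 2 * ennreal ((x - y)\<^sup>2) + 2 * ennreal ((y - z)\<^sup>2)"
    by (simp add: ennreal_mult)
  finally show ?thesis .
qed

context brownian_motion
begin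

lemma elementary_data_nonneg:
  assumes "elementary_data F m \<tau> \<xi>" "i \<le> m"
  shows "0 \<le> \<tau> i"
  using assms(2)
proof (induction i)
  case 0
  then show ?case using assms(1) by (simp add: elementary_data_def)
next
  case (Suc i)
  then have "\<tau> i \<le> \<tau> (Suc i)" using assms(1) by (simp add: elementary_data_def)
  then show ?case using Suc by simp
qed

lemma elementary_data_measurable:
  assumes "elementary_data F m \<tau> \<xi>" "i < m"
  shows "\<xi> i \<in> borel_measurable M"
proof (rule F_measurable)
  show "0 \<le> \<tau> i" using elementary_data_nonneg[OF assms(1), of i] assms(2) by simp
  show "\<xi> i \<in> borel_measurable (F (\<tau> i))" using assms by (simp add: elementary_data_def)
qed

lemma elementary_integral_measurable:
  assumes "elementary_data F m \<tau> \<xi>" "0 \<le> t"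
  shows "elementary_integral W m \<tau> \<xi> t \<in> borel_measurable M"
  unfolding elementary_integral_def[abs_def]
  using assms elementary_data_nonneg[OF assms(1)]
  by (intro borel_measurable_sum borel_measurable_times borel_measurable_diff W_measurable_M
      elementary_data_measurable[OF assms(1)]) (auto simp: min_def)

text \<open>The two processes become one family over a disjoint union of index sets, the second with
  opposite sign and all times cut off at t.\<close>

lemma elementary_isometry:
  assumes e1: "elementary_data F m1 \<tau>1 \<xi>1" and e2: "elementary_data F m2 \<tau>2 \<xi>2" and t: "0 \<le> t"
  shows "(\<integral>\<^sup>+\<omega>. ennreal ((elementary_integral W m1 \<tau>1 \<xi>1 t \<omega> - elementary_integral W m2 \<tau>2 \<xi>2 t \<omega>)\<^sup>2) \<partial>M)
    = (\<integral>\<^sup>+\<omega>. (\<integral>\<^sup>+s\<in>{0..t}. ennreal ((elementary_process m1 \<tau>1 \<xi>1 s \<omega> - elementary_process m2 \<tau>2 \<xi>2 s \<omega>)\<^sup>2) \<partial>lborel) \<partial>M)"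
proof -
  define I where "I = {..<m1} <+> {..<m2}"
  define a where "a = case_sum (\<lambda>i. min t (\<tau>1 i)) (\<lambda>i. min t (\<tau>2 i))"
  define b where "b = case_sum (\<lambda>i. min t (\<tau>1 (Suc i))) (\<lambda>i. min t (\<tau>2 (Suc i)))"
  \<comment> \<open>For \<tau> i > t the clipped interval starts at t, while \<xi> i is only known
    to be \<open>F (\<tau> i)\<close>-measurable. Its increment vanishes there, so 0 is an
    \<open>F t\<close>-measurable substitute.\<close>
  define \<xi> where "\<xi> = case_sum (\<lambda>i \<omega>. if \<tau>1 i \<le> t then \<xi>1 i \<omega> else 0) (\<lambda>i \<omega>. if \<tau>2 i \<le> t then - \<xi>2 i \<omega> else 0)"
  have n: "0 \<le> \<tau>1 i" "0 \<le> \<tau>2 i'" if "i \<le> m1" "i' \<le> m2" for i i'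
    using elementary_data_nonneg[OF e1] elementary_data_nonneg[OF e2] that by auto
  have mono: "\<tau>1 i \<le> \<tau>1 (Suc i)" "\<tau>2 i' \<le> \<tau>2 (Suc i')" if "i < m1" "i' < m2" for i i'
    using e1 e2 that by (auto simp: elementary_data_def)
  have eqJ: "elementary_integral W m1 \<tau>1 \<xi>1 t \<omega> - elementary_integral W m2 \<tau>2 \<xi>2 t \<omega>
      = (\<Sum>i\<in>I. \<xi> i \<omega> * (W (b i) \<omega> - W (a i) \<omega>))" for \<omega>
  proof -
    have "elementary_integral W m1 \<tau>1 \<xi>1 t \<omega> = (\<Sum>i<m1. \<xi> (Inl i) \<omega> * (W (b (Inl i)) \<omega> - W (a (Inl i)) \<omega>))"
      unfolding elementary_integral_def
      using e1 by (intro sum.cong) (force simp: \<xi>_def b_def a_def min_def elementary_data_def)+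
    moreover have "- elementary_integral W m2 \<tau>2 \<xi>2 t \<omega> = (\<Sum>i<m2. \<xi> (Inr i) \<omega> * (W (b (Inr i)) \<omega> - W (a (Inr i)) \<omega>))"
      unfolding elementary_integral_def sum_negf[symmetric]
      using e2 by (intro sum.cong) (force simp: \<xi>_def b_def a_def min_def elementary_data_def algebra_simps)+
    ultimately show ?thesis by (simp add: I_def sum.Plus comp_def)
  qed
  have eqe: "ennreal ((elementary_process m1 \<tau>1 \<xi>1 s \<omega> - elementary_process m2 \<tau>2 \<xi>2 s \<omega>)\<^sup>2) * indicator {0..t} s
      = ennreal ((\<Sum>i\<in>I. \<xi> i \<omega> * indicator {a i<..b i} s)\<^sup>2)" for s \<omega>
  proof -
    have i1: "indicator {min t (\<tau>1 i)<..min t (\<tau>1 (Suc i))} s = (indicator {\<tau>1 i<..\<tau>1 (Suc i)} s * indicator {0..t} s :: real)"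
      if "i < m1" for i using n(1)[of i 0] that by (auto simp: indicator_def min_def)
    have i2: "indicator {min t (\<tau>2 i)<..min t (\<tau>2 (Suc i))} s = (indicator {\<tau>2 i<..\<tau>2 (Suc i)} s * indicator {0..t} s :: real)"
      if "i < m2" for i using n(2)[of 0 i] that by (auto simp: indicator_def min_def)
    have "elementary_process m1 \<tau>1 \<xi>1 s \<omega> * indicator {0..t} s = (\<Sum>i<m1. \<xi> (Inl i) \<omega> * indicator {a (Inl i)<..b (Inl i)} s)"
      unfolding elementary_process_def sum_distrib_right
      by (intro sum.cong) (auto simp: \<xi>_def b_def a_def i1, auto simp: indicator_def)
    moreover have "- elementary_process m2 \<tau>2 \<xi>2 s \<omega> * indicator {0..t} s = (\<Sum>i<m2. \<xi> (Inr i) \<omega> * indicator {a (Inr i)<..b (Inr i)} s)"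
      unfolding elementary_process_def sum_negf[symmetric] sum_distrib_right
      by (intro sum.cong) (auto simp: \<xi>_def b_def a_def i2, auto simp: indicator_def)
    ultimately have "(\<Sum>i\<in>I. \<xi> i \<omega> * indicator {a i<..b i} s)
        = (elementary_process m1 \<tau>1 \<xi>1 s \<omega> - elementary_process m2 \<tau>2 \<xi>2 s \<omega>) * indicator {0..t} s"
      by (simp add: I_def sum.Plus comp_def algebra_simps del: sum_mult_indicator)
    then show ?thesis by (auto simp: indicator_def)
  qed
  show ?thesis unfolding eqJ eqe
  proof (rule ito_isometry_family)
    show "finite I" by (simp add: I_def)
  next
    fix i assume "i \<in> I"
    then consider i' where "i = Inl i'" "i' < m1" | i' where "i = Inr i'" "i' < m2"
      by (auto simp: I_def)
    then have "0 \<le> a i \<and> a i \<le> b i \<and> \<xi> i \<in> borel_measurable (F (a i)) \<and> bounded (\<xi> i ` space M)"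
    proof cases
      case 1
      have "bounded (\<xi>1 i' ` space M)" "\<xi>1 i' \<in> borel_measurable (F (\<tau>1 i'))"
        using e1 1(2) F_space[OF n(1)[of i' 0]] by (auto simp: elementary_data_def)
      then show "0 \<le> a i \<and> a i \<le> b i \<and> \<xi> i \<in> borel_measurable (F (a i)) \<and> bounded (\<xi> i ` space M)"
        using n(1)[of i' 0] mono(1)[of i'] 1 t e1 e2
        by (auto simp: a_def b_def \<xi>_def min_def elementary_data_def bounded_iff)
    next
      case 2
      have "bounded (\<xi>2 i' ` space M)" "\<xi>2 i' \<in> borel_measurable (F (\<tau>2 i'))"
        using e2 2(2) F_space[OF n(2)[of 0 i']] by (auto simp: elementary_data_def)
      then show "0 \<le> a i \<and> a i \<le> b i \<and> \<xi> i \<in> borel_measurable (F (a i)) \<and> bounded (\<xi> i ` space M)"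
        using n(2)[of 0 i'] mono(2)[of 0 i'] 2 t e1 e2
        by (auto simp: a_def b_def \<xi>_def min_def elementary_data_def bounded_iff)
    qed
    then show "0 \<le> a i" "a i \<le> b i" "\<xi> i \<in> borel_measurable (F (a i))" "bounded (\<xi> i ` space M)"
      by auto
  qed
qed

lemma progressive_joint:
  assumes "progressive_on F t H" "0 \<le> t"
  shows "(\<lambda>(\<omega>, s). H s \<omega>) \<in> borel_measurable (M \<Otimes>\<^sub>M restrict_space lborel {0..t})"
proof -
  have H: "(\<lambda>(s, \<omega>). H s \<omega>) \<in> borel_measurable (restrict_space borel {0..t} \<Otimes>\<^sub>M F t)"
    using assms by (auto simp: progressive_on_def)
  have id: "(\<lambda>\<omega>. \<omega>) \<in> measurable M (F t)"
    using filtration_subalgebra[OF assms(2)] by (intro measurableI) (auto simp: subalgebra_def dest: sets.sets_into_space)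
  have "(\<lambda>p. (snd p, fst p)) \<in> measurable (M \<Otimes>\<^sub>M restrict_space lborel {0..t}) (restrict_space borel {0..t} \<Otimes>\<^sub>M F t)"
  proof (rule measurable_Pair)
    show "(\<lambda>x. fst x) \<in> measurable (M \<Otimes>\<^sub>M restrict_space lborel {0..t}) (F t)"
      by (rule measurable_compose[OF measurable_fst id])
    have "sets (restrict_space lborel {0..t}) = sets (restrict_space borel {0..t})"
      by (rule sets_restrict_space_cong) simp
    then show "(\<lambda>x. snd x) \<in> measurable (M \<Otimes>\<^sub>M restrict_space lborel {0..t}) (restrict_space borel {0..t})"
      by (subst measurable_cong_sets[OF refl, of _ "restrict_space lborel {0..t}"]) auto
  qed
  from measurable_compose[OF this H] show ?thesis by (simp add: case_prod_beta')
qed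

lemma elementary_process_joint:
  assumes "elementary_data F m \<tau> \<xi>"
  shows "(\<lambda>(\<omega>, s). elementary_process m \<tau> \<xi> s \<omega>) \<in> borel_measurable (M \<Otimes>\<^sub>M restrict_space lborel {0..t})"
proof -
  have s: "snd \<in> borel_measurable (M \<Otimes>\<^sub>M restrict_space lborel {0..t})"
    by (rule measurable_compose[OF measurable_snd]) (simp add: measurable_restrict_space1)
  show ?thesis
    unfolding elementary_process_def case_prod_beta'
    by (intro borel_measurable_sum borel_measurable_times measurable_compose[OF measurable_fst]
        elementary_data_measurable[OF assms] measurable_compose[OF s]) auto
qed

lemma inner_integral_measurable:
  fixes t :: real
  assumes "(\<lambda>(\<omega>, s). f s \<omega> :: real) \<in> borel_measurable (M \<Otimes>\<^sub>M restrict_space lborel {0..t})"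
  shows "(\<lambda>\<omega>. \<integral>\<^sup>+s\<in>{0..t}. ennreal ((f s \<omega>)\<^sup>2) \<partial>lborel) \<in> borel_measurable M"
proof -
  have sf: "sigma_finite_measure (restrict_space lborel {0..t})"
    by (rule sigma_finite_measure_restrict_space) (auto intro: sigma_finite_lborel)
  have "(\<lambda>\<omega>. \<integral>\<^sup>+s\<in>{0..t}. ennreal ((f s \<omega>)\<^sup>2) \<partial>lborel)
      = (\<lambda>\<omega>. \<integral>\<^sup>+s. ennreal ((f s \<omega>)\<^sup>2) \<partial>restrict_space lborel {0..t})"
    by (simp add: nn_integral_restrict_space)
  also have "\<dots> \<in> borel_measurable M"
    by (rule sigma_finite_measure.borel_measurable_nn_integral[OF sf]) (use assms in \<open>simp add: case_prod_beta'\<close>)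
  finally show ?thesis .
qed

lemma section_measurable:
  fixes t :: real
  assumes "(\<lambda>(\<omega>, s). f s \<omega> :: real) \<in> borel_measurable (M \<Otimes>\<^sub>M restrict_space lborel {0..t})" "\<omega> \<in> space M"
  shows "(\<lambda>s. ennreal ((f s \<omega>)\<^sup>2) * indicator {0..t} s) \<in> borel_measurable lborel"
proof -
  have "(\<lambda>s. f s \<omega>) \<in> borel_measurable (restrict_space lborel {0..t})"
    using measurable_compose[OF measurable_Pair1'[OF assms(2)] assms(1)] by simp
  then have "(\<lambda>s. ennreal ((f s \<omega>)\<^sup>2)) \<in> borel_measurable (restrict_space lborel {0..t})" by measurable
  then show ?thesis by (subst (asm) borel_measurable_restrict_space_iff_ennreal) auto
qed

text \<open>\<open>has_ito_integral\<close> provides one approximating sequence of its own choice.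
  By the isometry the integrals of any other sequence approximating H have the same limit, so I can
  be computed from left-point sums.\<close>

lemma ito_integral_limit:
  assumes ito: "has_ito_integral M F W t H I" and t: "0 \<le> t"
    and ed: "\<And>r. elementary_data F (m r) (\<tau> r) (\<xi> r)"
    and lim: "(\<lambda>r. \<integral>\<^sup>+\<omega>. (\<integral>\<^sup>+s\<in>{0..t}. ennreal ((H s \<omega> - elementary_process (m r) (\<tau> r) (\<xi> r) s \<omega>)\<^sup>2) \<partial>lborel) \<partial>M) \<longlonglongrightarrow> 0"
  shows "(\<lambda>r. \<integral>\<^sup>+\<omega>. ennreal ((I \<omega> - elementary_integral W (m r) (\<tau> r) (\<xi> r) t \<omega>)\<^sup>2) \<partial>M) \<longlonglongrightarrow> 0"
proof -
  obtain m' \<tau>' \<xi>' where ed': "\<And>k. elementary_data F (m' k) (\<tau>' k) (\<xi>' k)"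
    and lim': "(\<lambda>k. \<integral>\<^sup>+\<omega>. (\<integral>\<^sup>+s\<in>{0..t}. ennreal ((H s \<omega> - elementary_process (m' k) (\<tau>' k) (\<xi>' k) s \<omega>)\<^sup>2) \<partial>lborel) \<partial>M) \<longlonglongrightarrow> 0"
    and limI: "(\<lambda>k. \<integral>\<^sup>+\<omega>. ennreal ((I \<omega> - elementary_integral W (m' k) (\<tau>' k) (\<xi>' k) t \<omega>)\<^sup>2) \<partial>M) \<longlonglongrightarrow> 0"
    using ito by (auto simp: has_ito_integral_def)
  have H: "(\<lambda>(\<omega>, s). H s \<omega>) \<in> borel_measurable (M \<Otimes>\<^sub>M restrict_space lborel {0..t})"
    using ito t by (intro progressive_joint) (auto simp: has_ito_integral_def)
  have I[measurable]: "I \<in> borel_measurable M" using ito by (simp add: has_ito_integral_def)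
  define J where "J r = elementary_integral W (m r) (\<tau> r) (\<xi> r) t" for r
  define J' where "J' r = elementary_integral W (m' r) (\<tau>' r) (\<xi>' r) t" for r
  define e where "e r = elementary_process (m r) (\<tau> r) (\<xi> r)" for r
  define e' where "e' r = elementary_process (m' r) (\<tau>' r) (\<xi>' r)" for r
  have [measurable]: "J r \<in> borel_measurable M" "J' r \<in> borel_measurable M" for r
    unfolding J_def J'_def using ed ed' t by (auto intro: elementary_integral_measurable)
  have He: "(\<lambda>(\<omega>, s). H s \<omega> - e r s \<omega>) \<in> borel_measurable (M \<Otimes>\<^sub>M restrict_space lborel {0..t})"
    "(\<lambda>(\<omega>, s). e' r s \<omega> - H s \<omega>) \<in> borel_measurable (M \<Otimes>\<^sub>M restrict_space lborel {0..t})" for r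
    using borel_measurable_diff[OF H elementary_process_joint[OF ed]] borel_measurable_diff[OF elementary_process_joint[OF ed'] H]
    by (simp_all add: case_prod_beta' e_def e'_def)
  let ?A = "\<lambda>r \<omega>. \<integral>\<^sup>+s\<in>{0..t}. ennreal ((e' r s \<omega> - H s \<omega>)\<^sup>2) \<partial>lborel"
  let ?B = "\<lambda>r \<omega>. \<integral>\<^sup>+s\<in>{0..t}. ennreal ((H s \<omega> - e r s \<omega>)\<^sup>2) \<partial>lborel"
  \<comment> \<open>Two triangle inequalities, from I over J' to J and from e' over H to e, with the
    isometry in between.\<close>
  have bound: "(\<integral>\<^sup>+\<omega>. ennreal ((I \<omega> - J r \<omega>)\<^sup>2) \<partial>M)
      \<le> 2 * (\<integral>\<^sup>+\<omega>. ennreal ((I \<omega> - J' r \<omega>)\<^sup>2) \<partial>M) + 2 * (2 * (\<integral>\<^sup>+\<omega>. ?A r \<omega> \<partial>M) + 2 * (\<integral>\<^sup>+\<omega>. ?B r \<omega> \<partial>M))" for r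
  proof -
    have "(\<integral>\<^sup>+\<omega>. ennreal ((I \<omega> - J r \<omega>)\<^sup>2) \<partial>M)
        \<le> (\<integral>\<^sup>+\<omega>. 2 * ennreal ((I \<omega> - J' r \<omega>)\<^sup>2) + 2 * ennreal ((J' r \<omega> - J r \<omega>)\<^sup>2) \<partial>M)"
      by (intro nn_integral_mono ennreal_sq_triangle)
    also have "\<dots> = 2 * (\<integral>\<^sup>+\<omega>. ennreal ((I \<omega> - J' r \<omega>)\<^sup>2) \<partial>M) + 2 * (\<integral>\<^sup>+\<omega>. ennreal ((J' r \<omega> - J r \<omega>)\<^sup>2) \<partial>M)"
      by (subst nn_integral_add) (auto simp: nn_integral_cmult)
    also have "(\<integral>\<^sup>+\<omega>. ennreal ((J' r \<omega> - J r \<omega>)\<^sup>2) \<partial>M)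
        = (\<integral>\<^sup>+\<omega>. (\<integral>\<^sup>+s\<in>{0..t}. ennreal ((e' r s \<omega> - e r s \<omega>)\<^sup>2) \<partial>lborel) \<partial>M)"
      unfolding J_def J'_def e_def e'_def by (rule elementary_isometry[OF ed' ed t])
    also have "\<dots> \<le> (\<integral>\<^sup>+\<omega>. 2 * ?A r \<omega> + 2 * ?B r \<omega> \<partial>M)"
    proof (rule nn_integral_mono)
      fix \<omega> assume \<omega>: "\<omega> \<in> space M"
      note m = section_measurable[OF He(1) \<omega>] section_measurable[OF He(2) \<omega>]
      have "(\<integral>\<^sup>+s\<in>{0..t}. ennreal ((e' r s \<omega> - e r s \<omega>)\<^sup>2) \<partial>lborel)
         \<le> (\<integral>\<^sup>+s. 2 * (ennreal ((e' r s \<omega> - H s \<omega>)\<^sup>2) * indicator {0..t} s) + 2 * (ennreal ((H s \<omega> - e r s \<omega>)\<^sup>2) * indicator {0..t} s) \<partial>lborel)"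
        by (intro nn_integral_mono) (auto simp: indicator_def intro: ennreal_sq_triangle)
      also have "\<dots> = 2 * ?A r \<omega> + 2 * ?B r \<omega>"
        using m by (subst nn_integral_add) (auto simp: nn_integral_cmult simp del: measurable_lborel1 measurable_lborel2)
      finally show "(\<integral>\<^sup>+s\<in>{0..t}. ennreal ((e' r s \<omega> - e r s \<omega>)\<^sup>2) \<partial>lborel) \<le> 2 * ?A r \<omega> + 2 * ?B r \<omega>" .
    qed
    also have "\<dots> = 2 * (\<integral>\<^sup>+\<omega>. ?A r \<omega> \<partial>M) + 2 * (\<integral>\<^sup>+\<omega>. ?B r \<omega> \<partial>M)"
      using inner_integral_measurable[OF He(1)] inner_integral_measurable[OF He(2)]
      by (subst nn_integral_add) (auto simp: nn_integral_cmult)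
    finally show ?thesis by (meson add_left_mono mult_left_mono order_trans zero_le)
  qed
  have "(\<lambda>r. 2 * (\<integral>\<^sup>+\<omega>. ennreal ((I \<omega> - J' r \<omega>)\<^sup>2) \<partial>M) + 2 * (2 * (\<integral>\<^sup>+\<omega>. ?A r \<omega> \<partial>M) + 2 * (\<integral>\<^sup>+\<omega>. ?B r \<omega> \<partial>M)))
    \<longlonglongrightarrow> 2 * 0 + 2 * (2 * 0 + 2 * 0)"
    using lim lim' limI
    by (intro tendsto_add ennreal_tendsto_cmult) (auto simp: J'_def e_def e'_def power2_commute)
  then have "(\<lambda>r. 2 * (\<integral>\<^sup>+\<omega>. ennreal ((I \<omega> - J' r \<omega>)\<^sup>2) \<partial>M) + 2 * (2 * (\<integral>\<^sup>+\<omega>. ?A r \<omega> \<partial>M) + 2 * (\<integral>\<^sup>+\<omega>. ?B r \<omega> \<partial>M)))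
    \<longlonglongrightarrow> 0" by simp
  then have "(\<lambda>r. \<integral>\<^sup>+\<omega>. ennreal ((I \<omega> - J r \<omega>)\<^sup>2) \<partial>M) \<longlonglongrightarrow> 0"
    by (rule tendsto_sandwich[OF _ _ tendsto_const, rotated 2]) (use bound in auto)
  then show ?thesis by (simp add: J_def)
qed

end

lemma elementary_process_grid:
  assumes \<delta>: "0 < \<delta>" and s: "0 < s" "s \<le> real J * \<delta>"
  obtains i where "i < J" "real i * \<delta> < s" "s \<le> real (Suc i) * \<delta>"
    "elementary_process J (\<lambda>i. real i * \<delta>) \<xi> s \<omega> = \<xi> i \<omega>"
proof -
  \<comment> \<open>Cells are open at the left, so the index is the ceiling of s/\<delta> minus 1,
    and a grid point belongs to the cell on its left.\<close>
  define i where "i = nat (\<lceil>s / \<delta>\<rceil> - 1)"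
  have c: "1 \<le> \<lceil>s / \<delta>\<rceil>" using \<delta> s by simp
  have i: "real_of_int \<lceil>s / \<delta>\<rceil> = real i + 1" using c by (simp add: i_def)
  have "real i < s / \<delta>" "s / \<delta> \<le> real i + 1"
    using i ceiling_correct[of "s / \<delta>"] by linarith+
  then have si: "real i * \<delta> < s" "s \<le> real (Suc i) * \<delta>" using \<delta> by (simp_all add: field_simps)
  have "real i * \<delta> < real J * \<delta>" using si s by linarith
  then have iJ: "i < J" using \<delta> by simp
  have "elementary_process J (\<lambda>i. real i * \<delta>) \<xi> s \<omega> = (\<Sum>l<J. if l = i then \<xi> i \<omega> else 0)"
    unfolding elementary_process_def
  proof (rule sum.cong)
    fix l assume "l \<in> {..<J}"
    show "\<xi> l \<omega> * indicator {real l * \<delta><..real (Suc l) * \<delta>} s = (if l = i then \<xi> i \<omega> else 0)"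
    proof (cases "l = i")
      case False
      then consider "Suc l \<le> i" | "Suc i \<le> l" by linarith
      then have "s \<notin> {real l * \<delta><..real (Suc l) * \<delta>}"
      proof cases
        case 1
        then have "real (Suc l) * \<delta> \<le> real i * \<delta>" using \<delta> by (intro mult_right_mono) auto
        then show ?thesis using si by auto
      next
        case 2
        then have "real (Suc i) * \<delta> \<le> real l * \<delta>" using \<delta> by (intro mult_right_mono) auto
        then show ?thesis using si by auto
      qed
      then show ?thesis using False by simp
    qed (use si in auto)
  qed simp
  also have "\<dots> = \<xi> i \<omega>" using iJ by simp
  finally show ?thesis using that iJ si by blast
qed

context brownian_motion
begin

text \<open>Left points lie further from t than s does, and \<kappa> decreases, so the integrand and
  its discretization are both at most B \<kappa>(t - s). This bound depends neither on \<omega> nor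
  on the grid, and dominated convergence applies twice, in s along almost every path and then in
  \<omega>; continuity of k and of the paths gives the pointwise limit.\<close>

lemma ito_sum_limit:
  fixes T B t :: real and k \<kappa> :: "real \<Rightarrow> real"
  assumes T: "0 < T" and j: "j \<le> 2 ^ n" and t: "t = real j * (T / 2 ^ n)"
    and ito: "has_ito_integral M F W t (\<lambda>s \<omega>. k (t - s) * g s \<omega>) I"
    and g: "\<And>s. 0 \<le> s \<Longrightarrow> s \<le> T \<Longrightarrow> g s \<in> borel_measurable (F s)" "\<And>s \<omega>. \<bar>g s \<omega>\<bar> \<le> B"
      "AE \<omega> in M. continuous_on {0..T} (\<lambda>s. g s \<omega>)"
    and k: "continuous_on {0<..} k" "\<And>u. 0 < u \<Longrightarrow> u \<le> T \<Longrightarrow> \<bar>k u\<bar> \<le> \<kappa> u"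
    and \<kappa>: "\<And>u v. 0 < u \<Longrightarrow> u \<le> v \<Longrightarrow> v \<le> T \<Longrightarrow> \<kappa> v \<le> \<kappa> u" "set_integrable lborel {0<..T} (\<lambda>u. (\<kappa> u)\<^sup>2)"
  shows "(\<lambda>r. \<integral>\<^sup>+\<omega>. ennreal ((I \<omega> - ito_sum W k g (T / 2 ^ (n + r)) (j * 2 ^ r) \<omega>)\<^sup>2) \<partial>M) \<longlonglongrightarrow> 0"
proof -
  have t0: "0 \<le> t" using T t by simp
  have tT: "t \<le> T" unfolding t by (rule dyadic_le[OF j T])
  have B: "0 \<le> B" using g(2)[of undefined undefined] by linarith
  define \<delta> where "\<delta> r = T / 2 ^ (n + r)" for r
  define J where "J r = j * 2 ^ r" for r :: nat
  define \<xi> where "\<xi> r i \<omega> = k (real (J r - i) * \<delta> r) * g (real i * \<delta> r) \<omega>" for r i \<omega>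
  have \<delta>: "0 < \<delta> r" for r using T by (simp add: \<delta>_def)
  have Jt: "real (J r) * \<delta> r = t" for r by (simp add: J_def \<delta>_def t power_add)
  have it: "real i * \<delta> r \<le> t" if "i \<le> J r" for i r
    using that \<delta>[of r] unfolding Jt[of r, symmetric] by (intro mult_right_mono) auto
  have ed: "elementary_data F (J r) (\<lambda>i. real i * \<delta> r) (\<xi> r)" for r
    unfolding elementary_data_def
  proof (intro conjI allI impI)
    fix i assume i: "i < J r"
    have iT: "0 \<le> real i * \<delta> r" "real i * \<delta> r \<le> T" using it[of i r] tT i \<delta>[of r] by auto
    show "real i * \<delta> r \<le> real (Suc i) * \<delta> r" using \<delta>[of r] by (intro mult_right_mono) auto
    show "\<xi> r i \<in> borel_measurable (F (real i * \<delta> r))" unfolding \<xi>_def using g(1)[OF iT] by simp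
    have "\<bar>\<xi> r i \<omega>\<bar> \<le> \<bar>k (real (J r - i) * \<delta> r)\<bar> * B" for \<omega>
      unfolding \<xi>_def abs_mult using g(2) by (intro mult_left_mono) auto
    then show "bounded (\<xi> r i ` space (F (real i * \<delta> r)))" by (auto simp: bounded_iff)
  qed simp
  define H where "H s \<omega> = k (t - s) * g s \<omega>" for s \<omega>
  define e where "e r = elementary_process (J r) (\<lambda>i. real i * \<delta> r) (\<xi> r)" for r
  define G where "G r \<omega> = (\<integral>\<^sup>+s\<in>{0..t}. ennreal ((H s \<omega> - e r s \<omega>)\<^sup>2) \<partial>lborel)" for r \<omega>
  have ito': "has_ito_integral M F W t H I" using ito by (simp add: H_def[abs_def])
  have He: "(\<lambda>(\<omega>, s). H s \<omega> - e r s \<omega>) \<in> borel_measurable (M \<Otimes>\<^sub>M restrict_space lborel {0..t})" for r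
    using borel_measurable_diff[OF progressive_joint[OF _ t0, of H] elementary_process_joint[OF ed]] ito'
    by (simp add: case_prod_beta' e_def has_ito_integral_def)
  have grid: "\<exists>u. u < s \<and> s \<le> u + \<delta> r \<and> 0 \<le> u \<and> u < t \<and> e r s \<omega> = k (t - u) * g u \<omega>"
    if s: "0 < s" "s \<le> t" for s r \<omega>
  proof -
    obtain i where i: "i < J r" "real i * \<delta> r < s" "s \<le> real (Suc i) * \<delta> r" "e r s \<omega> = \<xi> r i \<omega>"
      using elementary_process_grid[OF \<delta> s(1), of "J r" "r" "\<xi> r" \<omega>] s(2) unfolding Jt e_def by metis
    have "real (J r - i) * \<delta> r = t - real i * \<delta> r"
      using i(1) Jt[of r] by (simp add: of_nat_diff left_diff_distrib)
    then show ?thesis using i s \<delta>[of r] by (intro exI[of _ "real i * \<delta> r"]) (auto simp: \<xi>_def algebra_simps)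
  qed
  \<comment> \<open>The square of 2 B \<kappa>, extended by 0 outside (0,T].\<close>
  define w where "w u = indicator {0<..T} u * (4 * B\<^sup>2 * (\<kappa> u)\<^sup>2)" for u
  have w: "integrable lborel w"
  proof -
    have "integrable lborel (\<lambda>u. 4 * B\<^sup>2 * (indicator {0<..T} u *\<^sub>R (\<kappa> u)\<^sup>2))"
      using \<kappa>(2) unfolding set_integrable_def by (rule integrable_mult_right)
    then show ?thesis by (simp add: w_def[abs_def] mult.left_commute)
  qed
  then have wm[measurable]: "w \<in> borel_measurable borel" by auto
  have w0: "0 \<le> w u" for u by (simp add: w_def)
  have bd: "(H s \<omega> - e r s \<omega>)\<^sup>2 \<le> w (t - s)" if s: "0 < s" "s < t" for s r \<omega>
  proof -
    obtain u where u: "u < s" "0 \<le> u" "u < t" "e r s \<omega> = k (t - u) * g u \<omega>" using grid[of s r \<omega>] s by auto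
    have "\<bar>k (t - u)\<bar> \<le> \<kappa> (t - s)"
      using k(2)[of "t - u"] \<kappa>(1)[of "t - s" "t - u"] u s tT by simp
    moreover have "\<bar>k (t - s)\<bar> \<le> \<kappa> (t - s)" using k(2)[of "t - s"] s tT by simp
    ultimately have "\<bar>H s \<omega>\<bar> \<le> \<kappa> (t - s) * B" "\<bar>e r s \<omega>\<bar> \<le> \<kappa> (t - s) * B"
      unfolding H_def u(4) abs_mult using g(2) B by (auto intro!: mult_mono)
    then have "\<bar>H s \<omega> - e r s \<omega>\<bar> \<le> \<bar>2 * (\<kappa> (t - s) * B)\<bar>" by linarith
    then have "(H s \<omega> - e r s \<omega>)\<^sup>2 \<le> (2 * (\<kappa> (t - s) * B))\<^sup>2"
      by (rule iffD1[OF abs_le_square_iff])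
    also have "\<dots> = w (t - s)" using s tT by (simp add: w_def power_mult_distrib)
    finally show ?thesis .
  qed
  \<comment> \<open>The point s = 0 lies in no cell, and at s = t the kernel may be
    singular.\<close>
  have ne: "AE s in lborel. s \<noteq> 0 \<and> s \<noteq> t" using AE_lborel_singleton[of 0] AE_lborel_singleton[of t] by eventually_elim auto
  define C where "C = (\<integral>\<^sup>+s. ennreal (w (t - s)) \<partial>lborel)"
  have "C = (\<integral>\<^sup>+u. ennreal (w u) \<partial>lborel)"
    unfolding C_def using nn_integral_real_affine[of "\<lambda>u. ennreal (w u)" "-1" t] by simp
  then have C: "C < \<infinity>" using w w0 by (simp add: nn_integral_eq_integral)
  have GC: "G r \<omega> \<le> C" for r \<omega>
    unfolding G_def C_def using ne
    by (intro nn_integral_mono_AE, eventually_elim) (auto simp: indicator_def intro!: ennreal_leI bd)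
  have G0: "AE \<omega> in M. (\<lambda>r. G r \<omega>) \<longlonglongrightarrow> 0"
    using g(3) AE_space
  proof eventually_elim
    fix \<omega> assume cont: "continuous_on {0..T} (\<lambda>s. g s \<omega>)" and \<omega>: "\<omega> \<in> space M"
    have "(\<lambda>r. \<integral>\<^sup>+s. ennreal ((H s \<omega> - e r s \<omega>)\<^sup>2) * indicator {0..t} s \<partial>lborel) \<longlonglongrightarrow> (\<integral>\<^sup>+s. 0 \<partial>(lborel :: real measure))"
    proof (rule nn_integral_dominated_convergence[where w="\<lambda>s. ennreal (w (t - s))"])
      show "(\<lambda>s. ennreal ((H s \<omega> - e r s \<omega>)\<^sup>2) * indicator {0..t} s) \<in> borel_measurable lborel" for r
        by (rule section_measurable[OF He \<omega>])
      show "AE s in lborel. ennreal ((H s \<omega> - e r s \<omega>)\<^sup>2) * indicator {0..t} s \<le> ennreal (w (t - s))" for r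
        using ne by eventually_elim (auto simp: indicator_def intro!: ennreal_leI bd)
      show "(\<integral>\<^sup>+s. ennreal (w (t - s)) \<partial>lborel) < \<infinity>" using C by (simp add: C_def)
      show "AE s in lborel. (\<lambda>r. ennreal ((H s \<omega> - e r s \<omega>)\<^sup>2) * indicator {0..t} s) \<longlonglongrightarrow> 0"
        using ne
      proof eventually_elim
        fix s assume ne: "s \<noteq> 0 \<and> s \<noteq> t"
        show "(\<lambda>r. ennreal ((H s \<omega> - e r s \<omega>)\<^sup>2) * indicator {0..t} s) \<longlonglongrightarrow> 0"
        proof (cases "s \<in> {0..t}")
          case True
          then have s: "0 < s" "s < t" using ne by auto
          have "\<forall>r. \<exists>u. u < s \<and> s \<le> u + \<delta> r \<and> 0 \<le> u \<and> u < t \<and> e r s \<omega> = k (t - u) * g u \<omega>"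
            using grid[of s _ \<omega>] s by auto
          from choice[OF this] obtain u where "\<forall>r. u r < s \<and> s \<le> u r + \<delta> r \<and> 0 \<le> u r \<and> u r < t \<and> e r s \<omega> = k (t - u r) * g (u r) \<omega>"
            ..
          then have u: "\<And>r. u r < s" "\<And>r. s \<le> u r + \<delta> r" "\<And>r. 0 \<le> u r" "\<And>r. u r < t"
            "\<And>r. e r s \<omega> = k (t - u r) * g (u r) \<omega>" by blast+
          have "(\<lambda>r. T / 2 ^ n * (1 / 2) ^ r) \<longlonglongrightarrow> T / 2 ^ n * 0"
            by (intro tendsto_mult tendsto_const LIMSEQ_realpow_zero) auto
          then have "\<delta> \<longlonglongrightarrow> 0" by (simp add: \<delta>_def[abs_def] power_add power_one_over)
          then have "(\<lambda>r. s - \<delta> r) \<longlonglongrightarrow> s - 0" by (intro tendsto_intros)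
          then have us: "u \<longlonglongrightarrow> s"
            using u(1,2) by (intro tendsto_sandwich[OF _ _ _ tendsto_const, of "\<lambda>r. s - \<delta> r" u sequentially s])
              (auto simp: algebra_simps intro!: always_eventually less_imp_le)
          have "(\<lambda>r. k (t - u r)) \<longlonglongrightarrow> k (t - s)"
          proof (rule continuous_on_tendsto_compose[OF k(1)])
            show "(\<lambda>r. t - u r) \<longlonglongrightarrow> t - s" by (intro tendsto_diff tendsto_const us)
            show "t - s \<in> {0<..}" using s by simp
            show "\<forall>\<^sub>F r in sequentially. t - u r \<in> {0<..}" using u(4) by (intro always_eventually) simp
          qed
          moreover have "(\<lambda>r. g (u r) \<omega>) \<longlonglongrightarrow> g s \<omega>"
          proof (rule continuous_on_tendsto_compose[OF cont us])
            show "s \<in> {0..T}" using s tT by simp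
            have "u r \<in> {0..T}" for r using u(3)[of r] u(4)[of r] tT by simp
            then show "\<forall>\<^sub>F r in sequentially. u r \<in> {0..T}" by (intro always_eventually allI)
          qed
          ultimately have "(\<lambda>r. e r s \<omega>) \<longlonglongrightarrow> H s \<omega>" unfolding u(5) H_def by (rule tendsto_mult)
          then have "(\<lambda>r. (H s \<omega> - e r s \<omega>)\<^sup>2) \<longlonglongrightarrow> (H s \<omega> - H s \<omega>)\<^sup>2" by (intro tendsto_intros)
          then have "(\<lambda>r. ennreal ((H s \<omega> - e r s \<omega>)\<^sup>2)) \<longlonglongrightarrow> ennreal 0" by (intro tendsto_ennrealI) simp
          then show ?thesis using True by simp
        qed simp
      qed
    qed auto
    then show "(\<lambda>r. G r \<omega>) \<longlonglongrightarrow> 0" by (simp add: G_def)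
  qed
  have "(\<lambda>r. \<integral>\<^sup>+\<omega>. G r \<omega> \<partial>M) \<longlonglongrightarrow> (\<integral>\<^sup>+\<omega>. 0 \<partial>M)"
  proof (rule nn_integral_dominated_convergence[where w="\<lambda>_. C"])
    show "G r \<in> borel_measurable M" for r unfolding G_def[abs_def] by (rule inner_integral_measurable[OF He])
    show "(\<integral>\<^sup>+\<omega>. C \<partial>M) < \<infinity>" using C by (simp add: emeasure_space_1)
  qed (use GC G0 in auto)
  then have "(\<lambda>r. \<integral>\<^sup>+\<omega>. (\<integral>\<^sup>+s\<in>{0..t}. ennreal ((H s \<omega> - elementary_process (J r) (\<lambda>i. real i * \<delta> r) (\<xi> r) s \<omega>)\<^sup>2) \<partial>lborel) \<partial>M) \<longlonglongrightarrow> 0"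
    by (simp add: G_def e_def)
  from ito_integral_limit[OF ito' t0 ed this]
  have "(\<lambda>r. \<integral>\<^sup>+\<omega>. ennreal ((I \<omega> - elementary_integral W (J r) (\<lambda>i. real i * \<delta> r) (\<xi> r) t \<omega>)\<^sup>2) \<partial>M) \<longlonglongrightarrow> 0" .
  moreover have "elementary_integral W (J r) (\<lambda>i. real i * \<delta> r) (\<xi> r) t \<omega> = ito_sum W k g (\<delta> r) (J r) \<omega>" for r \<omega>
  proof -
    have "min t (real i * \<delta> r) = real i * \<delta> r" if "i \<le> J r" for i using it[OF that] by simp
    then show ?thesis unfolding elementary_integral_def ito_sum_def \<xi>_def
      by (intro sum.cong) (auto simp del: of_nat_Suc)
  qed
  ultimately show ?thesis by (simp add: \<delta>_def J_def)
qed

end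

section \<open>Maximal bounds for stochastic convolutions\<close>

lemma increment_bound_mono:
  assumes "increment_bound T b h A" "A \<le> A'"
  shows "increment_bound T b h A'"
  using assms mult_left_mono[OF assms(2)] unfolding increment_bound_def by (meson order_trans)

definition chaining_const :: "real \<Rightarrow> real" where
  "chaining_const b = 2 * 2 powr b / (2 powr b - 1)"

text \<open>The chaining factor to the power 2m, times the bound for the expected energy of a grid
  martingale whose integrand has unit moments: 2 from the sum over scales, a power of T from the
  scaling, (4 m^2)^m from the martingale inequality.\<close>

definition maximal_const :: "real \<Rightarrow> real \<Rightarrow> nat \<Rightarrow> real" where
  "maximal_const T b m = chaining_const b ^ (2 * m) * (2 * T powr (real m * (1 - 2 * b)) * (4 * (real m)\<^sup>2) ^ m)"

text \<open>A discrete Besov norm, to the power \<open>2m\<close>: its \<open>2m\<close>-th root controls the \<open>b\<close>-Hoelder constant of the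
  path on the grid.\<close>

definition dyadic_energy :: "real \<Rightarrow> nat \<Rightarrow> nat \<Rightarrow> real \<Rightarrow> (nat \<Rightarrow> real) \<Rightarrow> real" where
  "dyadic_energy b m n \<delta> P =
     (\<Sum>r\<le>n. \<Sum>k<2 ^ (n - r). ((P ((k + 1) * 2 ^ r) - P (k * 2 ^ r)) / (2 ^ r * \<delta>) powr b) ^ (2 * m))"

lemma dyadic_energy_nonneg: "0 \<le> dyadic_energy b m n \<delta> P"
  by (simp add: dyadic_energy_def sum_nonneg)

text \<open>Every scaled dyadic increment, to the power 2m, is one summand of the energy, hence the
  increment is at most its 2m-th root; chaining extends this to all pairs of grid points.\<close>

lemma dyadic_energy_holder:
  assumes m: "0 < m" and \<delta>: "0 < \<delta>" and b: "0 < b" and ij: "i \<le> j" "j \<le> 2 ^ n"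
  shows "\<bar>P j - P i\<bar> \<le> chaining_const b * root (2 * m) (dyadic_energy b m n \<delta> P) * (real (j - i) * \<delta>) powr b"
  unfolding chaining_const_def
proof (rule dyadic_chaining[where J="2 ^ n"])
  let ?Q = "dyadic_energy b m n \<delta> P"
  fix r k :: nat assume rk: "(k + 1) * 2 ^ r \<le> 2 ^ n"
  have "(2::nat) ^ r \<le> (k + 1) * 2 ^ r" by simp
  then have "(2::nat) ^ r \<le> 2 ^ n" using rk by linarith
  then have rn: "r \<le> n" by (rule power_le_imp_le_exp[rotated]) simp
  have "(k + 1) * 2 ^ r \<le> 2 ^ (n - r) * 2 ^ r" using rk rn by (simp only: power_add[symmetric] le_add_diff_inverse2)
  then have "k + 1 \<le> 2 ^ (n - r)" by (simp only: mult_le_cancel2) simp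
  then have k: "k < 2 ^ (n - r)" by simp
  let ?x = "(P ((k + 1) * 2 ^ r) - P (k * 2 ^ r)) / (2 ^ r * \<delta>) powr b"
  let ?S = "\<lambda>r. \<Sum>k<2 ^ (n - r). ((P ((k + 1) * 2 ^ r) - P (k * 2 ^ r)) / (2 ^ r * \<delta>) powr b) ^ (2 * m)"
  have "\<bar>?x\<bar> ^ (2 * m) = ?x ^ (2 * m)" by (rule power_even_abs) simp
  also have "\<dots> \<le> ?S r"
    using k by (intro member_le_sum[where f="\<lambda>k. ((P ((k + 1) * 2 ^ r) - P (k * 2 ^ r)) / (2 ^ r * \<delta>) powr b) ^ (2 * m)"]) auto
  also have "\<dots> \<le> ?Q"
    unfolding dyadic_energy_def using rn by (intro member_le_sum[where f="?S"]) (auto intro!: sum_nonneg)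
  finally have "root (2 * m) (\<bar>?x\<bar> ^ (2 * m)) \<le> root (2 * m) ?Q" using m by (intro real_root_le_mono) auto
  then have "\<bar>?x\<bar> \<le> root (2 * m) ?Q" using m by (simp add: real_root_power_cancel)
  then show "\<bar>P ((k + 1) * 2 ^ r) - P (k * 2 ^ r)\<bar> \<le> root (2 * m) ?Q * (2 ^ r * \<delta>) powr b"
    using \<delta> by (simp add: abs_divide pos_divide_le_eq)
qed (use assms dyadic_energy_nonneg in auto)

context brownian_motion
begin

definition grid_martingale :: "(real \<Rightarrow> 'a \<Rightarrow> real) \<Rightarrow> real \<Rightarrow> 'a \<Rightarrow> nat \<Rightarrow> real" where
  "grid_martingale g \<delta> \<omega> j = (\<Sum>i<j. g (real i * \<delta>) \<omega> * (W (real (Suc i) * \<delta>) \<omega> - W (real i * \<delta>) \<omega>))"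

text \<open>A deterministic bound for each \<omega>. Its right-hand side does not depend on j, so it
  dominates the maximum over all grid times at once.\<close>

lemma ito_sum_bound:
  assumes T: "0 < T" and b: "0 < b" and m: "0 < m" and j: "j \<le> 2 ^ n" and h: "increment_bound T b h A" and A: "0 \<le> A"
  shows "ito_sum W h g (T / 2 ^ n) j \<omega> ^ (2 * m)
    \<le> A ^ (2 * m) * (chaining_const b ^ (2 * m) * dyadic_energy b m n (T / 2 ^ n) (grid_martingale g (T / 2 ^ n) \<omega>))"
proof -
  define \<delta> where "\<delta> = T / 2 ^ n"
  have \<delta>: "0 < \<delta>" using T by (simp add: \<delta>_def)
  define P where "P = grid_martingale g \<delta> \<omega>"
  define Q where "Q = dyadic_energy b m n \<delta> P"
  define R where "R = chaining_const b * root (2 * m) Q"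
  have Q: "0 \<le> Q" by (simp add: Q_def dyadic_energy_nonneg)
  have cc: "0 \<le> chaining_const b" unfolding chaining_const_def using b by (intro divide_nonneg_pos) auto
  have R: "0 \<le> R" unfolding R_def using Q cc m by simp
  have inc: "P (Suc i) - P i = g (real i * \<delta>) \<omega> * (W (real (Suc i) * \<delta>) \<omega> - W (real i * \<delta>) \<omega>)" for i
    by (simp add: P_def grid_martingale_def)
  \<comment> \<open>The path seen backwards from j, so that the kernel is read at the distance d
    \<delta>.\<close>
  define N where "N d = P j - P (j - d)" for d
  have "ito_sum W h g \<delta> j \<omega> = (\<Sum>i<j. h (real (j - i) * \<delta>) * (P (Suc i) - P i))"
    unfolding ito_sum_def inc by (simp add: mult.assoc)
  also have "\<dots> = (\<Sum>d=1..j. h (real d * \<delta>) * (N d - N (d - 1)))"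
  proof (rule sum.reindex_bij_witness[where i="\<lambda>d. j - d" and j="\<lambda>i. j - i"])
    fix i assume i: "i \<in> {..<j}"
    have "j - (j - i) = i" "j - (j - i - 1) = Suc i" using i by auto
    then show "h (real (j - i) * \<delta>) * (N (j - i) - N (j - i - 1)) = h (real (j - i) * \<delta>) * (P (Suc i) - P i)"
      by (simp add: N_def)
  qed auto
  finally have eq: "ito_sum W h g \<delta> j \<omega> = (\<Sum>d=1..j. h (real d * \<delta>) * (N d - N (d - 1)))" .
  have "\<bar>N d\<bar> \<le> R * (real d * \<delta>) powr b" if "d \<le> j" for d
    using dyadic_energy_holder[OF m \<delta> b, of "j - d" j n P] that j by (simp add: N_def R_def Q_def)
  then have "\<bar>ito_sum W h g \<delta> j \<omega>\<bar> \<le> R * A"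
    unfolding eq using h[unfolded increment_bound_def, rule_format, OF j R, of N, folded \<delta>_def]
    by (simp add: N_def)
  then have "\<bar>ito_sum W h g \<delta> j \<omega>\<bar> ^ (2 * m) \<le> (R * A) ^ (2 * m)" by (intro power_mono) auto
  also have "\<dots> = A ^ (2 * m) * (chaining_const b ^ (2 * m) * root (2 * m) Q ^ (2 * m))"
    by (simp add: R_def power_mult_distrib mult_ac)
  also have "root (2 * m) Q ^ (2 * m) = Q" using Q m by (intro real_root_pow_pos2) auto
  finally show ?thesis by (simp add: power_even_abs \<delta>_def Q_def P_def)
qed

text \<open>An increment of the grid martingale is itself a martingale sum, started at time k
  \<delta>. The uniform bound G makes the m-th root of its moment bound proportional to its
  length.\<close>

lemma grid_martingale_moment:
  assumes \<delta>: "0 < \<delta>" and g: "\<And>i. i < n \<Longrightarrow> g (real i * \<delta>) \<in> borel_measurable (F (real i * \<delta>))"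
    and gi: "\<And>i. i < n \<Longrightarrow> integrable M (\<lambda>\<omega>. g (real i * \<delta>) \<omega> ^ (2 * m))"
    and G: "0 \<le> G" "\<And>i. i < n \<Longrightarrow> expectation (\<lambda>\<omega>. g (real i * \<delta>) \<omega> ^ (2 * m)) \<le> G ^ m" and kl: "k + l \<le> n"
  shows "integrable M (\<lambda>\<omega>. (grid_martingale g \<delta> \<omega> (k + l) - grid_martingale g \<delta> \<omega> k) ^ (2 * m))"
    and "expectation (\<lambda>\<omega>. (grid_martingale g \<delta> \<omega> (k + l) - grid_martingale g \<delta> \<omega> k) ^ (2 * m))
      \<le> (4 * (real m)\<^sup>2 * G * (real l * \<delta>)) ^ m"
proof -
  have eq: "grid_martingale g \<delta> \<omega> (k + l) - grid_martingale g \<delta> \<omega> k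
    = (\<Sum>i<l. g (real (k + i) * \<delta>) \<omega> * (W (real (k + Suc i) * \<delta>) \<omega> - W (real (k + i) * \<delta>) \<omega>))" for \<omega>
  proof -
    have "grid_martingale g \<delta> \<omega> (k + l) = grid_martingale g \<delta> \<omega> k
      + (\<Sum>i<l. g (real (k + i) * \<delta>) \<omega> * (W (real (k + Suc i) * \<delta>) \<omega> - W (real (k + i) * \<delta>) \<omega>))"
      unfolding grid_martingale_def by (induction l) (simp_all add: algebra_simps)
    then show ?thesis by simp
  qed
  have mono: "real (k + i) * \<delta> \<le> real (k + Suc i) * \<delta>" for i using \<delta> by (intro mult_right_mono) auto
  have ki: "k + i < n" if "i < l" for i using that kl by simp
  note g' = g[OF ki] gi[OF ki] G(2)[OF ki]
  note mom = martingale_sum_moment[where \<tau>="\<lambda>i. real (k + i) * \<delta>" and \<xi>="\<lambda>i. g (real (k + i) * \<delta>)" and j=l and m=m and \<beta>="\<lambda>_. G"]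
  show "integrable M (\<lambda>\<omega>. (grid_martingale g \<delta> \<omega> (k + l) - grid_martingale g \<delta> \<omega> k) ^ (2 * m))"
    unfolding eq using \<delta> g' G(1) by (intro mom(1) mono) simp_all
  have "(\<Sum>i<l. 4 * (real m)\<^sup>2 * G * (real (k + Suc i) * \<delta> - real (k + i) * \<delta>)) = 4 * (real m)\<^sup>2 * G * (real l * \<delta>)"
    by (simp add: algebra_simps)
  then show "expectation (\<lambda>\<omega>. (grid_martingale g \<delta> \<omega> (k + l) - grid_martingale g \<delta> \<omega> k) ^ (2 * m))
      \<le> (4 * (real m)\<^sup>2 * G * (real l * \<delta>)) ^ m"
    unfolding eq using mom(2)[OF _ mono g'(1,2) G(1) g'(3)] \<delta> by simp
qed

text \<open>At scale r there are 2^(n-r) increments of length x = T / 2^(n-r), and each contributes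
  at most a multiple of x^e with e = m (1 - 2b). As e \<ge> 2, the scale contributes at most a
  multiple of 2^(-(n-r)), so the sum is bounded uniformly in n. This dictates the size of m.\<close>

lemma dyadic_energy_expectation:
  assumes T: "0 < T" and m: "2 \<le> real m * (1 - 2 * b)"
    and g: "\<And>i. i < 2 ^ n \<Longrightarrow> g (real i * (T / 2 ^ n)) \<in> borel_measurable (F (real i * (T / 2 ^ n)))"
    and gi: "\<And>i. i < 2 ^ n \<Longrightarrow> integrable M (\<lambda>\<omega>. g (real i * (T / 2 ^ n)) \<omega> ^ (2 * m))"
    and G: "0 \<le> G" "\<And>i. i < 2 ^ n \<Longrightarrow> expectation (\<lambda>\<omega>. g (real i * (T / 2 ^ n)) \<omega> ^ (2 * m)) \<le> G ^ m"
  shows "integrable M (\<lambda>\<omega>. dyadic_energy b m n (T / 2 ^ n) (grid_martingale g (T / 2 ^ n) \<omega>))" (is ?int)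
    and "expectation (\<lambda>\<omega>. dyadic_energy b m n (T / 2 ^ n) (grid_martingale g (T / 2 ^ n) \<omega>))
      \<le> 2 * T powr (real m * (1 - 2 * b)) * (4 * (real m)\<^sup>2) ^ m * G ^ m" (is ?exp)
proof -
  define \<delta> where "\<delta> = T / 2 ^ n"
  have \<delta>: "0 < \<delta>" using T by (simp add: \<delta>_def)
  define e where "e = real m * (1 - 2 * b)"
  let ?P = "\<lambda>\<omega>. grid_martingale g \<delta> \<omega>"
  define D where "D r k \<omega> = (?P \<omega> ((k + 1) * 2 ^ r) - ?P \<omega> (k * 2 ^ r)) ^ (2 * m)" for r k \<omega>
  have kr: "k * 2 ^ r + 2 ^ r \<le> 2 ^ n" if "r \<le> n" "k < 2 ^ (n - r)" for k r :: nat
  proof -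
    have "(k + 1) * 2 ^ r \<le> 2 ^ (n - r) * 2 ^ r" using that by (intro mult_right_mono) auto
    then show ?thesis using that by (simp add: power_add[symmetric] algebra_simps)
  qed
  have mom: "integrable M (\<lambda>\<omega>. (?P \<omega> (k + l) - ?P \<omega> k) ^ (2 * m))"
    "expectation (\<lambda>\<omega>. (?P \<omega> (k + l) - ?P \<omega> k) ^ (2 * m)) \<le> (4 * (real m)\<^sup>2 * G * (real l * \<delta>)) ^ m"
    if "k + l \<le> 2 ^ n" for k l
    using grid_martingale_moment[OF \<delta> _ _ G(1) _ that, of g m] g gi G(2) unfolding \<delta>_def by blast+
  have Di: "integrable M (D r k)" and De: "expectation (D r k) \<le> (4 * (real m)\<^sup>2 * G * (2 ^ r * \<delta>)) ^ m"
    if "r \<le> n" "k < 2 ^ (n - r)" for r k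
    using mom(1)[OF kr[OF that]] mom(2)[OF kr[OF that]] unfolding D_def[abs_def] by (simp_all add: algebra_simps)
  have eq: "dyadic_energy b m n \<delta> (?P \<omega>) = (\<Sum>r\<le>n. \<Sum>k<(2::nat) ^ (n - r). D r k \<omega> / ((2 ^ r * \<delta>) powr b) ^ (2 * m))" for \<omega>
    by (simp add: dyadic_energy_def D_def power_divide)
  have i: "integrable M (\<lambda>\<omega>. dyadic_energy b m n \<delta> (?P \<omega>))"
    unfolding eq using Di by (intro Bochner_Integration.integrable_sum integrable_divide) auto
  then show ?int by (simp add: \<delta>_def)
  have "expectation (\<lambda>\<omega>. dyadic_energy b m n \<delta> (?P \<omega>))
      = (\<Sum>r\<le>n. \<Sum>k<(2::nat) ^ (n - r). expectation (D r k) / ((2 ^ r * \<delta>) powr b) ^ (2 * m))"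
    unfolding eq using Di by (subst Bochner_Integration.integral_sum; (intro sum.cong refl)?)
      (auto simp: Bochner_Integration.integral_sum intro!: Bochner_Integration.integrable_sum)
  also have "\<dots> \<le> (\<Sum>r\<le>n. \<Sum>k<(2::nat) ^ (n - r). (4 * (real m)\<^sup>2 * G * (2 ^ r * \<delta>)) ^ m / ((2 ^ r * \<delta>) powr b) ^ (2 * m))"
    using De by (intro sum_mono divide_right_mono) auto
  also have "\<dots> \<le> (\<Sum>r\<le>n. (4 * (real m)\<^sup>2 * G) ^ m * T powr e * (1 / 2) ^ (n - r))"
  proof (rule sum_mono)
    fix r assume "r \<in> {..n}"
    then have r: "r \<le> n" by simp
    define x where "x = 2 ^ r * \<delta>"
    have x: "0 < x" using \<delta> by (simp add: x_def)
    have xT: "x = T / 2 ^ (n - r)" using r by (simp add: x_def \<delta>_def power_diff)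
    have "x ^ m / (x powr b) ^ (2 * m) = x powr e"
    proof -
      have "(x powr b) ^ (2 * m) = x powr (b * (2 * real m))"
        using x by (simp add: powr_powr powr_realpow[symmetric])
      then show ?thesis using x by (simp add: powr_diff[symmetric] powr_realpow[symmetric] e_def algebra_simps)
    qed
    then have "(4 * (real m)\<^sup>2 * G * x) ^ m / (x powr b) ^ (2 * m) = (4 * (real m)\<^sup>2 * G) ^ m * x powr e"
      by (simp only: power_mult_distrib[of _ x] times_divide_eq_right[symmetric])
    then have "(\<Sum>k<(2::nat) ^ (n - r). (4 * (real m)\<^sup>2 * G * x) ^ m / (x powr b) ^ (2 * m))
        = (4 * (real m)\<^sup>2 * G) ^ m * (2 ^ (n - r) * x powr e)"
      by simp
    also have "2 ^ (n - r) * x powr e \<le> T powr e * (1 / 2) ^ (n - r)"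
    proof -
      have "(2 ^ (n - r)) powr e \<ge> (2 ^ (n - r)) powr (2::real)" using m by (intro powr_mono) (auto simp: e_def)
      then have "2 ^ (n - r) * 2 ^ (n - r) \<le> (2 ^ (n - r)) powr e" by (simp add: powr_numeral power2_eq_square)
      then have "2 ^ (n - r) / (2 ^ (n - r)) powr e \<le> 1 / 2 ^ (n - r)" by (simp add: field_simps)
      then have "T powr e * (2 ^ (n - r) / (2 ^ (n - r)) powr e) \<le> T powr e * (1 / 2 ^ (n - r))" by (intro mult_left_mono) auto
      then show ?thesis using T by (simp add: xT powr_divide power_one_over mult.commute)
    qed
    finally show "(\<Sum>k<(2::nat) ^ (n - r). (4 * (real m)\<^sup>2 * G * (2 ^ r * \<delta>)) ^ m / ((2 ^ r * \<delta>) powr b) ^ (2 * m))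
        \<le> (4 * (real m)\<^sup>2 * G) ^ m * T powr e * (1 / 2) ^ (n - r)"
      using G by (simp add: x_def mult.assoc mult_left_mono)
  qed
  also have "\<dots> = (4 * (real m)\<^sup>2 * G) ^ m * T powr e * (\<Sum>l\<le>n. (1 / 2) ^ l)"
    unfolding sum_distrib_left
    by (rule sum.reindex_bij_witness[where i="\<lambda>l. n - l" and j="\<lambda>r. n - r"]) auto
  also have "\<dots> \<le> (4 * (real m)\<^sup>2 * G) ^ m * T powr e * 2"
  proof (rule mult_left_mono)
    have "(\<Sum>l\<le>n. (1 / 2 :: real) ^ l) = 2 - (1 / 2) ^ n" by (induction n) auto
    then show "(\<Sum>l\<le>n. (1 / 2 :: real) ^ l) \<le> 2" by simp
  qed (use G in auto)
  finally show ?exp by (simp add: \<delta>_def e_def power_mult_distrib mult_ac)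
qed

end

section \<open>Moment bounds that survive the L^2 limit, and moments at fixed times\<close>

lemma power_add_le:
  fixes a b :: real
  assumes "0 \<le> a" "0 \<le> b" "0 < m"
  shows "a ^ m + b ^ m \<le> (a + b) ^ m"
  using assms(3)
proof (induction m rule: nat_induct_non_zero)
  case (Suc m)
  have "a ^ Suc m + b ^ Suc m \<le> (a + b) * (a ^ m + b ^ m)"
    using assms by (simp add: algebra_simps)
  also have "\<dots> \<le> (a + b) * (a + b) ^ m" using Suc assms by (intro mult_left_mono) auto
  finally show ?case by simp
qed simp

lemma power_even_add_le:
  fixes u v :: real
  shows "(u + v) ^ (2 * m) \<le> 4 ^ m * (u ^ (2 * m) + v ^ (2 * m))"
proof -
  define w where "w = max \<bar>u\<bar> \<bar>v\<bar>"
  have "(u + v) ^ (2 * m) = \<bar>u + v\<bar> ^ (2 * m)" by (rule power_even_abs[symmetric]) simp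
  also have "\<dots> \<le> (2 * w) ^ (2 * m)" by (intro power_mono) (auto simp: w_def)
  also have "\<dots> = 4 ^ m * w ^ (2 * m)" by (simp add: power_mult_distrib power_mult)
  also have "w ^ (2 * m) \<le> \<bar>u\<bar> ^ (2 * m) + \<bar>v\<bar> ^ (2 * m)" by (simp add: w_def max_def)
  finally show ?thesis by (simp add: power_even_abs)
qed

text \<open>The squared errors are added over the finite set I, so that one subsequence converges
  almost surely for all i together. Fatou's lemma is applied to the dominating variables U and not
  to the single powers, which lets one variable per refinement level control the whole
  supremum.\<close>

lemma nn_integral_Sup_power_le:
  fixes Z :: "'i \<Rightarrow> 'b \<Rightarrow> real" and S :: "nat \<Rightarrow> 'i \<Rightarrow> 'b \<Rightarrow> real"
  assumes fin: "finite I" and Z: "\<And>i. i \<in> I \<Longrightarrow> Z i \<in> borel_measurable N"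
    and S: "\<And>i r. i \<in> I \<Longrightarrow> S r i \<in> borel_measurable N"
    and lim: "\<And>i. i \<in> I \<Longrightarrow> (\<lambda>r. \<integral>\<^sup>+\<omega>. ennreal ((Z i \<omega> - S r i \<omega>)\<^sup>2) \<partial>N) \<longlonglongrightarrow> 0"
    and U: "\<And>r. U r \<in> borel_measurable N" "\<And>r i \<omega>. i \<in> I \<Longrightarrow> ennreal (S r i \<omega> ^ q) \<le> U r \<omega>"
      "\<And>r. (\<integral>\<^sup>+\<omega>. U r \<omega> \<partial>N) \<le> c"
  shows "(\<integral>\<^sup>+\<omega>. (SUP i\<in>I. ennreal (Z i \<omega> ^ q)) \<partial>N) \<le> c"
proof -
  define Y where "Y r \<omega> = (\<Sum>i\<in>I. (Z i \<omega> - S r i \<omega>)\<^sup>2)" for r \<omega>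
  have Ym[measurable]: "Y r \<in> borel_measurable N" for r
    unfolding Y_def[abs_def] using Z S by (intro borel_measurable_sum borel_measurable_power borel_measurable_diff)
  have Y0: "0 \<le> Y r \<omega>" for r \<omega> by (simp add: Y_def sum_nonneg)
  have "(\<integral>\<^sup>+\<omega>. ennreal (Y r \<omega>) \<partial>N) = (\<Sum>i\<in>I. \<integral>\<^sup>+\<omega>. ennreal ((Z i \<omega> - S r i \<omega>)\<^sup>2) \<partial>N)" for r
    unfolding Y_def using Z S by (subst nn_integral_sum[symmetric]) (auto simp: sum_ennreal)
  moreover have "(\<lambda>r. \<Sum>i\<in>I. \<integral>\<^sup>+\<omega>. ennreal ((Z i \<omega> - S r i \<omega>)\<^sup>2) \<partial>N) \<longlonglongrightarrow> (\<Sum>i\<in>I. 0)"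
    using lim by (intro tendsto_sum)
  ultimately have Y: "(\<lambda>r. \<integral>\<^sup>+\<omega>. ennreal (Y r \<omega>) \<partial>N) \<longlonglongrightarrow> 0" by simp
  then have "\<forall>\<^sub>F r in sequentially. (\<integral>\<^sup>+\<omega>. ennreal (Y r \<omega>) \<partial>N) < 1" by (rule order_tendstoD) simp
  then obtain r0 where r0: "\<And>r. r0 \<le> r \<Longrightarrow> (\<integral>\<^sup>+\<omega>. ennreal (Y r \<omega>) \<partial>N) < 1" by (auto simp: eventually_sequentially)
  \<comment> \<open>The subsequence theorem wants every member integrable, which is known only from
    r0 on.\<close>
  have Yi: "integrable N (Y (r + r0))" for r
    using r0[of "r + r0"] Y0 by (intro integrableI_nonneg) (auto intro: order.strict_trans)
  have "(\<lambda>r. \<integral>\<^sup>+\<omega>. ennreal (Y (r + r0) \<omega>) \<partial>N) \<longlonglongrightarrow> 0" using Y by (rule LIMSEQ_ignore_initial_segment)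
  then have "(\<lambda>r. ennreal (LINT \<omega>|N. Y (r + r0) \<omega>)) \<longlonglongrightarrow> 0"
    using Yi Y0 by (simp add: nn_integral_eq_integral)
  then have "(\<lambda>r. LINT \<omega>|N. norm (Y (r + r0) \<omega>)) \<longlonglongrightarrow> 0"
    using Y0 by (simp add: ennreal_tendsto_0_iff integral_nonneg_AE)
  from tendsto_L1_AE_subseq[OF Yi this] obtain s :: "nat \<Rightarrow> nat"
    where s: "AE \<omega> in N. (\<lambda>n. Y (s n + r0) \<omega>) \<longlonglongrightarrow> 0" by auto
  have "(\<integral>\<^sup>+\<omega>. (SUP i\<in>I. ennreal (Z i \<omega> ^ q)) \<partial>N) \<le> (\<integral>\<^sup>+\<omega>. liminf (\<lambda>n. U (s n + r0) \<omega>) \<partial>N)"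
  proof (rule nn_integral_mono_AE)
    show "AE \<omega> in N. (SUP i\<in>I. ennreal (Z i \<omega> ^ q)) \<le> liminf (\<lambda>n. U (s n + r0) \<omega>)"
      using s
    proof eventually_elim
      fix \<omega> assume lim: "(\<lambda>n. Y (s n + r0) \<omega>) \<longlonglongrightarrow> 0"
      show "(SUP i\<in>I. ennreal (Z i \<omega> ^ q)) \<le> liminf (\<lambda>n. U (s n + r0) \<omega>)"
      proof (rule SUP_least)
        fix i assume i: "i \<in> I"
        have "(\<lambda>n. (Z i \<omega> - S (s n + r0) i \<omega>)\<^sup>2) \<longlonglongrightarrow> 0"
        proof (rule tendsto_sandwich[OF _ _ tendsto_const lim])
          have "(Z i \<omega> - S r i \<omega>)\<^sup>2 \<le> Y r \<omega>" for r
            unfolding Y_def using i fin by (intro member_le_sum) auto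
          then show "\<forall>\<^sub>F n in sequentially. (Z i \<omega> - S (s n + r0) i \<omega>)\<^sup>2 \<le> Y (s n + r0) \<omega>" by simp
        qed simp
        then have "(\<lambda>n. sqrt ((Z i \<omega> - S (s n + r0) i \<omega>)\<^sup>2)) \<longlonglongrightarrow> sqrt 0" by (rule tendsto_real_sqrt)
        then have "(\<lambda>n. Z i \<omega> - S (s n + r0) i \<omega>) \<longlonglongrightarrow> 0" by (simp add: tendsto_rabs_zero_iff)
        then have "(\<lambda>n. Z i \<omega> - (Z i \<omega> - S (s n + r0) i \<omega>)) \<longlonglongrightarrow> Z i \<omega> - 0" by (intro tendsto_diff tendsto_const)
        then have "(\<lambda>n. ennreal (S (s n + r0) i \<omega> ^ q)) \<longlonglongrightarrow> ennreal (Z i \<omega> ^ q)"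
          by (intro tendsto_ennrealI tendsto_power) simp
        then have "ennreal (Z i \<omega> ^ q) = liminf (\<lambda>n. ennreal (S (s n + r0) i \<omega> ^ q))"
          by (rule lim_imp_Liminf[symmetric, rotated]) simp
        also have "\<dots> \<le> liminf (\<lambda>n. U (s n + r0) \<omega>)"
          using U(2)[OF i] by (intro Liminf_mono always_eventually allI)
        finally show "ennreal (Z i \<omega> ^ q) \<le> liminf (\<lambda>n. U (s n + r0) \<omega>)" .
      qed
    qed
  qed
  also have "\<dots> \<le> liminf (\<lambda>n. \<integral>\<^sup>+\<omega>. U (s n + r0) \<omega> \<partial>N)"
    using U(1) by (intro nn_integral_liminf)
  also have "\<dots> \<le> liminf (\<lambda>n. c)" using U(3) by (intro Liminf_mono always_eventually allI)
  also have "\<dots> = c" by (rule Liminf_const) simp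
  finally show ?thesis .
qed

context brownian_motion
begin

lemma ito_sum_measurable:
  assumes "0 < \<delta>" "\<And>i. i < j \<Longrightarrow> g (real i * \<delta>) \<in> borel_measurable M"
  shows "ito_sum W k g \<delta> j \<in> borel_measurable M"
  unfolding ito_sum_def[abs_def] using assms
  by (intro borel_measurable_sum borel_measurable_times borel_measurable_diff W_measurable_M) auto

text \<open>The exponential weight reproduces itself: e^(r i \<delta>) = e^(r j \<delta>) e^(-r (j -
  i) \<delta>) produces a Riemann sum of \<kappa>^2 e^(-ru), which lies below its integral. The
  moments of the convolution thus grow at the same rate as those of g, with G replaced by 4 m^2
  \<epsilon> G.\<close>

lemma ito_sum_moment:
  assumes T: "0 < T" and j: "j \<le> 2 ^ n"
    and g: "\<And>i. i < 2 ^ n \<Longrightarrow> g (real i * (T / 2 ^ n)) \<in> borel_measurable (F (real i * (T / 2 ^ n)))"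
    and gi: "\<And>i. i < 2 ^ n \<Longrightarrow> integrable M (\<lambda>\<omega>. g (real i * (T / 2 ^ n)) \<omega> ^ (2 * m))"
    and G: "0 \<le> G" "\<And>i. i < 2 ^ n \<Longrightarrow>
      expectation (\<lambda>\<omega>. g (real i * (T / 2 ^ n)) \<omega> ^ (2 * m)) \<le> (G * exp (r * (real i * (T / 2 ^ n)))) ^ m"
    and r: "0 \<le> r" and k: "\<And>u. 0 < u \<Longrightarrow> u \<le> T \<Longrightarrow> \<bar>k u\<bar> \<le> \<kappa> u"
    and \<kappa>: "\<And>u v. 0 < u \<Longrightarrow> u \<le> v \<Longrightarrow> v \<le> T \<Longrightarrow> \<kappa> v \<le> \<kappa> u" "set_integrable lborel {0<..T} (\<lambda>u. (\<kappa> u)\<^sup>2)"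
    and \<epsilon>: "(LINT u:{0<..T}|lborel. (\<kappa> u)\<^sup>2 * exp (- r * u)) \<le> \<epsilon>"
  shows "integrable M (\<lambda>\<omega>. ito_sum W k g (T / 2 ^ n) j \<omega> ^ (2 * m))"
    and "expectation (\<lambda>\<omega>. ito_sum W k g (T / 2 ^ n) j \<omega> ^ (2 * m))
      \<le> (4 * (real m)\<^sup>2 * \<epsilon> * G * exp (r * (real j * (T / 2 ^ n)))) ^ m"
proof -
  define \<delta> where "\<delta> = T / 2 ^ n"
  have \<delta>: "0 < \<delta>" using T by (simp add: \<delta>_def)
  have dT: "real d * \<delta> \<le> T" if "d \<le> j" for d
    unfolding \<delta>_def using that j T by (intro dyadic_le) auto
  have ij: "i < 2 ^ n" if "i < j" for i using that j by simp
  note g' = g[OF ij, folded \<delta>_def] gi[OF ij, folded \<delta>_def] G(2)[OF ij, folded \<delta>_def]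
  define \<xi> where "\<xi> i \<omega> = k (real (j - i) * \<delta>) * g (real i * \<delta>) \<omega>" for i \<omega>
  define \<beta> where "\<beta> i = (\<kappa> (real (j - i) * \<delta>))\<^sup>2 * (G * exp (r * (real i * \<delta>)))" for i
  have eq: "ito_sum W k g \<delta> j \<omega> = (\<Sum>i<j. \<xi> i \<omega> * (W (real (Suc i) * \<delta>) \<omega> - W (real i * \<delta>) \<omega>))" for \<omega>
    by (simp add: ito_sum_def \<xi>_def)
  have \<xi>m: "\<xi> i \<in> borel_measurable (F (real i * \<delta>))" if "i < j" for i
    unfolding \<xi>_def[abs_def] using g'(1)[OF that] by simp
  have pw: "\<xi> i \<omega> ^ (2 * m) = k (real (j - i) * \<delta>) ^ (2 * m) * g (real i * \<delta>) \<omega> ^ (2 * m)" for i \<omega>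
    by (simp add: \<xi>_def power_mult_distrib)
  have \<xi>i: "integrable M (\<lambda>\<omega>. \<xi> i \<omega> ^ (2 * m))" if "i < j" for i
    unfolding pw using g'(2)[OF that] by simp
  have \<beta>0: "0 \<le> \<beta> i" for i using G(1) by (simp add: \<beta>_def)
  have \<xi>\<beta>: "expectation (\<lambda>\<omega>. \<xi> i \<omega> ^ (2 * m)) \<le> \<beta> i ^ m" if i: "i < j" for i
  proof -
    have u: "0 < real (j - i) * \<delta>" "real (j - i) * \<delta> \<le> T" using i \<delta> dT[of "j - i"] by auto
    have "expectation (\<lambda>\<omega>. \<xi> i \<omega> ^ (2 * m)) = ((k (real (j - i) * \<delta>))\<^sup>2) ^ m * expectation (\<lambda>\<omega>. g (real i * \<delta>) \<omega> ^ (2 * m))"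
      unfolding pw using g'(2)[OF i] by (simp add: power_mult)
    also have "\<dots> \<le> ((\<kappa> (real (j - i) * \<delta>))\<^sup>2) ^ m * (G * exp (r * (real i * \<delta>))) ^ m"
    proof (rule mult_mono)
      have "\<bar>k (real (j - i) * \<delta>)\<bar>\<^sup>2 \<le> (\<kappa> (real (j - i) * \<delta>))\<^sup>2" using k[OF u] by (intro power_mono) auto
      then show "((k (real (j - i) * \<delta>))\<^sup>2) ^ m \<le> ((\<kappa> (real (j - i) * \<delta>))\<^sup>2) ^ m"
        unfolding power2_abs by (rule power_mono) simp
    qed (use g'(3)[OF i] in auto)
    finally show ?thesis by (simp add: \<beta>_def power_mult_distrib)
  qed
  have mono: "real i * \<delta> \<le> real (Suc i) * \<delta>" for i using \<delta> by (intro mult_right_mono) auto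
  note mom = martingale_sum_moment[where \<tau>="\<lambda>i. real i * \<delta>", OF _ mono \<xi>m \<xi>i \<beta>0 \<xi>\<beta>, simplified of_nat_0 mult_zero_left]
  show "integrable M (\<lambda>\<omega>. ito_sum W k g (T / 2 ^ n) j \<omega> ^ (2 * m))"
    unfolding \<delta>_def[symmetric] eq by (rule mom(1)) auto
  have "expectation (\<lambda>\<omega>. ito_sum W k g \<delta> j \<omega> ^ (2 * m)) \<le> (\<Sum>i<j. 4 * (real m)\<^sup>2 * \<beta> i * (real (Suc i) * \<delta> - real i * \<delta>)) ^ m"
    unfolding eq by (rule mom(2)) auto
  also have "\<dots> \<le> (4 * (real m)\<^sup>2 * \<epsilon> * G * exp (r * (real j * \<delta>))) ^ m"
  proof (rule power_mono)
    let ?f = "\<lambda>u. (\<kappa> u)\<^sup>2 * exp (- r * u)"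
    have "(\<Sum>i<j. 4 * (real m)\<^sup>2 * \<beta> i * (real (Suc i) * \<delta> - real i * \<delta>))
        = (\<Sum>d=1..j. 4 * (real m)\<^sup>2 * G * exp (r * (real j * \<delta>)) * (?f (real d * \<delta>) * \<delta>))"
    proof (rule sum.reindex_bij_witness[where i="\<lambda>d. j - d" and j="\<lambda>i. j - i"])
      fix i assume i: "i \<in> {..<j}"
      have "exp (r * (real i * \<delta>)) = exp (r * (real j * \<delta>)) * exp (- r * (real (j - i) * \<delta>))"
        using i by (simp add: mult_exp_exp of_nat_diff algebra_simps)
      then show "4 * (real m)\<^sup>2 * G * exp (r * (real j * \<delta>)) * (?f (real (j - i) * \<delta>) * \<delta>)
        = 4 * (real m)\<^sup>2 * \<beta> i * (real (Suc i) * \<delta> - real i * \<delta>)"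
        by (simp add: \<beta>_def algebra_simps)
    qed auto
    then have sum_eq: "(\<Sum>i<j. 4 * (real m)\<^sup>2 * \<beta> i * (real (Suc i) * \<delta> - real i * \<delta>))
        = 4 * (real m)\<^sup>2 * G * exp (r * (real j * \<delta>)) * (\<Sum>d=1..j. ?f (real d * \<delta>) * \<delta>)"
      by (simp add: sum_distrib_left)
    have "(\<Sum>d=1..j. ?f (real d * \<delta>) * \<delta>) \<le> (LINT u:{0<..T}|lborel. ?f u)"
    proof (rule riemann_sum_le_integral)
      fix u v :: real assume uv: "0 < u" "u \<le> v" "v \<le> T"
      have "0 \<le> \<kappa> v" using k[of v] uv by simp
      then show "?f v \<le> ?f u" using \<kappa>(1)[OF uv] r uv by (intro mult_mono power_mono) (auto simp: mult_left_mono)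
    qed (use \<delta> dT[of j] discounted_energy_integrable[OF \<kappa>(2) r] in auto)
    also have "\<dots> \<le> \<epsilon>" by (rule \<epsilon>)
    finally have "4 * (real m)\<^sup>2 * G * exp (r * (real j * \<delta>)) * (\<Sum>d=1..j. ?f (real d * \<delta>) * \<delta>)
        \<le> 4 * (real m)\<^sup>2 * G * exp (r * (real j * \<delta>)) * \<epsilon>"
      using G(1) by (intro mult_left_mono) auto
    then show "(\<Sum>i<j. 4 * (real m)\<^sup>2 * \<beta> i * (real (Suc i) * \<delta> - real i * \<delta>)) \<le> 4 * (real m)\<^sup>2 * \<epsilon> * G * exp (r * (real j * \<delta>))"
      unfolding sum_eq by (simp only: mult_ac)
    show "0 \<le> (\<Sum>i<j. 4 * (real m)\<^sup>2 * \<beta> i * (real (Suc i) * \<delta> - real i * \<delta>))"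
      using \<beta>0 mono by (intro sum_nonneg mult_nonneg_nonneg) auto
  qed
  finally show "expectation (\<lambda>\<omega>. ito_sum W k g (T / 2 ^ n) j \<omega> ^ (2 * m))
      \<le> (4 * (real m)\<^sup>2 * \<epsilon> * G * exp (r * (real j * (T / 2 ^ n)))) ^ m"
    by (simp add: \<delta>_def)
qed

lemma progressive_adapted:
  assumes "progressive_on F T Z" "0 \<le> s" "s \<le> T"
  shows "Z s \<in> borel_measurable (F s)"
proof -
  have "(\<lambda>(u, \<omega>). Z u \<omega>) \<in> borel_measurable (restrict_space borel {0..s} \<Otimes>\<^sub>M F s)"
    using assms by (auto simp: progressive_on_def)
  moreover have "s \<in> space (restrict_space borel {0..s})" using assms by simp
  ultimately show ?thesis using measurable_compose[OF measurable_Pair1'] by fastforce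
qed

end

section \<open>Stability of Volterra equations\<close>

text \<open>Z belongs to the reference kernel \<open>k\<close>, Y to the perturbed kernel
  \<open>k'\<close>; \<open>\<kappa>\<close> and \<open>\<kappa>'\<close> are decreasing
  square-integrable majorants. The factor 32 in \<open>\<rho>_large\<close> is 4 from splitting an
  even power of a sum, 4 from the martingale constant 4 m^2, and 2 to leave a contraction by
  1/2.\<close>

locale volterra_pair = brownian_motion M F W
  for M :: "'a measure" and F :: "real \<Rightarrow> 'a measure" and W :: "real \<Rightarrow> 'a \<Rightarrow> real" +
  fixes T b B L A \<Phi> \<rho> :: real and m :: nat and \<sigma> x0 \<kappa> \<kappa>' k k' :: "real \<Rightarrow> real" and Y Z :: "real \<Rightarrow> 'a \<Rightarrow> real"
  assumes T_pos: "0 < T" and b_pos: "0 < b" and m_large: "2 \<le> real m * (1 - 2 * b)"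
    and \<sigma>_bound: "\<And>z. \<bar>\<sigma> z\<bar> \<le> B" and \<sigma>_lipschitz: "\<And>y z. \<bar>\<sigma> y - \<sigma> z\<bar> \<le> L * \<bar>y - z\<bar>"
    and \<kappa>_antimono: "\<And>u v. 0 < u \<Longrightarrow> u \<le> v \<Longrightarrow> v \<le> T \<Longrightarrow> \<kappa> v \<le> \<kappa> u"
    and \<kappa>_square: "set_integrable lborel {0<..T} (\<lambda>u. (\<kappa> u)\<^sup>2)"
    and \<kappa>'_antimono: "\<And>u v. 0 < u \<Longrightarrow> u \<le> v \<Longrightarrow> v \<le> T \<Longrightarrow> \<kappa>' v \<le> \<kappa>' u"
    and \<kappa>'_square: "set_integrable lborel {0<..T} (\<lambda>u. (\<kappa>' u)\<^sup>2)"
    and k_cont: "continuous_on {0<..} k" and k_le: "\<And>u. 0 < u \<Longrightarrow> u \<le> T \<Longrightarrow> \<bar>k u\<bar> \<le> \<kappa> u"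
    and k'_cont: "continuous_on {0<..} k'" and k'_le: "\<And>u. 0 < u \<Longrightarrow> u \<le> T \<Longrightarrow> \<bar>k' u\<bar> \<le> \<kappa>' u"
    and k_increment: "increment_bound T b k \<Phi>" and \<Phi>_nonneg: "0 \<le> \<Phi>"
    and diff_increment: "increment_bound T b (\<lambda>u. k' u - k u) A" and A_nonneg: "0 \<le> A"
    and solution_k: "volterra_solution M F W T x0 \<sigma> k Z"
    and solution_k': "volterra_solution M F W T x0 \<sigma> k' Y"
    and \<rho>_nonneg: "0 \<le> \<rho>"
    and \<rho>_large: "32 * (real m)\<^sup>2 * L\<^sup>2 * (LINT u:{0<..T}|lborel. (\<kappa> u)\<^sup>2 * exp (- \<rho> * u)) \<le> 1"
begin

definition "gap s \<omega> = Y s \<omega> - Z s \<omega>"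

definition "gY s \<omega> = \<sigma> (Y s \<omega>)"
definition "gZ s \<omega> = \<sigma> (Z s \<omega>)"
definition "g_gap s \<omega> = gY s \<omega> - gZ s \<omega>"

definition "grid n j = real j * (T / 2 ^ n)"

text \<open>n fixes the grid on which the solutions are compared, r refines the sums towards the Ito
  integrals; the index \<open>j * 2 ^ r\<close> keeps the time at \<open>grid n j\<close>.\<close>

definition "gap_approx n r j \<omega> = ito_sum W k' gY (T / 2 ^ (n + r)) (j * 2 ^ r) \<omega> - ito_sum W k gZ (T / 2 ^ (n + r)) (j * 2 ^ r) \<omega>"

lemma m_pos: "0 < m" using m_large by (cases m) auto

lemma L_nonneg: "0 \<le> L" using \<sigma>_lipschitz[of 1 0] by (smt (verit) zero_le_mult_iff)

lemma \<sigma>_continuous: "continuous_on UNIV \<sigma>"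
proof -
  have "L-lipschitz_on UNIV \<sigma>"
    using \<sigma>_lipschitz L_nonneg by (auto simp: lipschitz_on_def dist_real_def)
  then show ?thesis by (rule lipschitz_on_continuous_on)
qed

lemma \<sigma>_measurable[measurable]: "\<sigma> \<in> borel_measurable borel"
  by (rule borel_measurable_continuous_onI[OF \<sigma>_continuous])

lemma grid_range: "j \<le> 2 ^ n \<Longrightarrow> 0 \<le> grid n j" "j \<le> 2 ^ n \<Longrightarrow> grid n j \<le> T"
  unfolding grid_def using dyadic_le[of j n T] T_pos by auto

lemma grid_refine: "grid (n + r) (j * 2 ^ r) = grid n j"
  by (simp add: grid_def power_add)

lemma adapted_YZ:
  assumes "0 \<le> s" "s \<le> T"
  shows "Y s \<in> borel_measurable (F s)" "Z s \<in> borel_measurable (F s)"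
  using solution_k solution_k' assms by (auto simp: volterra_solution_def intro: progressive_adapted)

lemma adapted_g:
  assumes "0 \<le> s" "s \<le> T"
  shows "gY s \<in> borel_measurable (F s)" "gZ s \<in> borel_measurable (F s)" "g_gap s \<in> borel_measurable (F s)"
proof -
  show "gY s \<in> borel_measurable (F s)" "gZ s \<in> borel_measurable (F s)"
    unfolding gY_def[abs_def] gZ_def[abs_def]
    using adapted_YZ[OF assms] by (auto intro: measurable_compose[OF _ \<sigma>_measurable])
  then show "g_gap s \<in> borel_measurable (F s)" unfolding g_gap_def[abs_def] by (rule borel_measurable_diff)
qed

lemma measurable_g:
  assumes "0 \<le> s" "s \<le> T"
  shows "gY s \<in> borel_measurable M" "gZ s \<in> borel_measurable M" "g_gap s \<in> borel_measurable M" "gap s \<in> borel_measurable M"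
  using adapted_g[OF assms] adapted_YZ[OF assms] F_measurable[OF assms(1)]
  unfolding gap_def[abs_def] by (auto intro!: borel_measurable_diff)

lemma g_le: "\<bar>gY s \<omega>\<bar> \<le> B" "\<bar>gZ s \<omega>\<bar> \<le> B" "\<bar>g_gap s \<omega>\<bar> \<le> 2 * B" "\<bar>g_gap s \<omega>\<bar> \<le> L * \<bar>gap s \<omega>\<bar>"
  using \<sigma>_bound[of "Y s \<omega>"] \<sigma>_bound[of "Z s \<omega>"] \<sigma>_lipschitz[of "Y s \<omega>" "Z s \<omega>"]
  by (auto simp: gY_def gZ_def g_gap_def gap_def)

lemma bounded_power_moment:
  fixes f :: "'a \<Rightarrow> real" and c :: real
  assumes "f \<in> borel_measurable M" "\<And>\<omega>. \<bar>f \<omega>\<bar> \<le> c"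
  shows "integrable M (\<lambda>\<omega>. f \<omega> ^ (2 * m))" "expectation (\<lambda>\<omega>. f \<omega> ^ (2 * m)) \<le> (c\<^sup>2) ^ m"
proof -
  have le: "f \<omega> ^ (2 * m) \<le> (c\<^sup>2) ^ m" for \<omega>
    using power_mono[OF assms(2), of \<omega> "2 * m"] by (simp add: power_even_abs power_mult)
  show i: "integrable M (\<lambda>\<omega>. f \<omega> ^ (2 * m))"
    by (rule integrable_const_bound[where B="(c\<^sup>2) ^ m"]) (use le assms(1) in auto)
  show "expectation (\<lambda>\<omega>. f \<omega> ^ (2 * m)) \<le> (c\<^sup>2) ^ m"
    using integral_mono[OF i integrable_const le] by (simp add: prob_space)
qed

text \<open>The forcing x0 cancels, and the sums of the two equations converge separately, each with
  the majorant of its own kernel.\<close>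

lemma gap_approx_limit:
  assumes j: "j \<le> 2 ^ n"
  shows "(\<lambda>r. \<integral>\<^sup>+\<omega>. ennreal ((gap (grid n j) \<omega> - gap_approx n r j \<omega>)\<^sup>2) \<partial>M) \<longlonglongrightarrow> 0"
proof -
  define t where "t = grid n j"
  have t: "t \<in> {0..T}" using grid_range[OF j] by (simp add: t_def)
  obtain I where I: "has_ito_integral M F W t (\<lambda>s \<omega>. k (t - s) * \<sigma> (Z s \<omega>)) I" "AE \<omega> in M. Z t \<omega> = x0 t + I \<omega>"
    using solution_k t unfolding volterra_solution_def by blast
  obtain I' where I': "has_ito_integral M F W t (\<lambda>s \<omega>. k' (t - s) * \<sigma> (Y s \<omega>)) I'" "AE \<omega> in M. Y t \<omega> = x0 t + I' \<omega>"
    using solution_k' t unfolding volterra_solution_def by blast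
  have cont: "AE \<omega> in M. continuous_on {0..T} (\<lambda>s. gZ s \<omega>)" "AE \<omega> in M. continuous_on {0..T} (\<lambda>s. gY s \<omega>)"
  proof -
    have *: "AE \<omega> in M. continuous_on {0..T} (\<lambda>s. Z s \<omega>)" "AE \<omega> in M. continuous_on {0..T} (\<lambda>s. Y s \<omega>)"
      using solution_k solution_k' unfolding volterra_solution_def by blast+
    show "AE \<omega> in M. continuous_on {0..T} (\<lambda>s. gZ s \<omega>)"
      using *(1) unfolding gZ_def by eventually_elim (rule continuous_on_compose2[OF \<sigma>_continuous], auto)
    show "AE \<omega> in M. continuous_on {0..T} (\<lambda>s. gY s \<omega>)"
      using *(2) unfolding gY_def by eventually_elim (rule continuous_on_compose2[OF \<sigma>_continuous], auto)
  qed
  let ?S = "\<lambda>r. ito_sum W k gZ (T / 2 ^ (n + r)) (j * 2 ^ r)"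
  let ?S' = "\<lambda>r. ito_sum W k' gY (T / 2 ^ (n + r)) (j * 2 ^ r)"
  have lim: "(\<lambda>r. \<integral>\<^sup>+\<omega>. ennreal ((I \<omega> - ?S r \<omega>)\<^sup>2) \<partial>M) \<longlonglongrightarrow> 0"
    using I(1) by (intro ito_sum_limit[OF T_pos j, where t=t and B=B and \<kappa>=\<kappa>])
      (auto simp: t_def grid_def gZ_def[symmetric] k_cont k_le \<kappa>_square g_le intro: adapted_g cont \<kappa>_antimono)
  have lim': "(\<lambda>r. \<integral>\<^sup>+\<omega>. ennreal ((I' \<omega> - ?S' r \<omega>)\<^sup>2) \<partial>M) \<longlonglongrightarrow> 0"
    using I'(1) by (intro ito_sum_limit[OF T_pos j, where t=t and B=B and \<kappa>=\<kappa>'])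
      (auto simp: t_def grid_def gY_def[symmetric] k'_cont k'_le \<kappa>'_square g_le intro: adapted_g cont \<kappa>'_antimono)
  have Im[measurable]: "I \<in> borel_measurable M" "I' \<in> borel_measurable M"
    using I(1) I'(1) by (auto simp: has_ito_integral_def)
  have Sm[measurable]: "?S r \<in> borel_measurable M" "?S' r \<in> borel_measurable M" for r
  proof -
    have "0 \<le> real i * (T / 2 ^ (n + r)) \<and> real i * (T / 2 ^ (n + r)) \<le> T" if "i < j * 2 ^ r" for i
    proof -
      have "i \<le> 2 ^ n * 2 ^ r" using that j by (meson le_trans less_imp_le mult_le_mono1)
      then show ?thesis using grid_range[of i "n + r"] by (simp add: power_add grid_def)
    qed
    then show "?S r \<in> borel_measurable M" "?S' r \<in> borel_measurable M"
      using T_pos by (auto intro!: ito_sum_measurable measurable_g)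
  qed
  have bound: "(\<integral>\<^sup>+\<omega>. ennreal ((gap t \<omega> - gap_approx n r j \<omega>)\<^sup>2) \<partial>M)
      \<le> 2 * (\<integral>\<^sup>+\<omega>. ennreal ((I' \<omega> - ?S' r \<omega>)\<^sup>2) \<partial>M) + 2 * (\<integral>\<^sup>+\<omega>. ennreal ((I \<omega> - ?S r \<omega>)\<^sup>2) \<partial>M)" for r
  proof -
    have "(\<integral>\<^sup>+\<omega>. ennreal ((gap t \<omega> - gap_approx n r j \<omega>)\<^sup>2) \<partial>M)
        \<le> (\<integral>\<^sup>+\<omega>. 2 * ennreal ((I' \<omega> - ?S' r \<omega>)\<^sup>2) + 2 * ennreal ((I \<omega> - ?S r \<omega>)\<^sup>2) \<partial>M)"
    proof (rule nn_integral_mono_AE)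
      show "AE \<omega> in M. ennreal ((gap t \<omega> - gap_approx n r j \<omega>)\<^sup>2)
          \<le> 2 * ennreal ((I' \<omega> - ?S' r \<omega>)\<^sup>2) + 2 * ennreal ((I \<omega> - ?S r \<omega>)\<^sup>2)"
        using I(2) I'(2)
      proof eventually_elim
        fix \<omega> assume eq: "Z t \<omega> = x0 t + I \<omega>" "Y t \<omega> = x0 t + I' \<omega>"
        show "ennreal ((gap t \<omega> - gap_approx n r j \<omega>)\<^sup>2)
          \<le> 2 * ennreal ((I' \<omega> - ?S' r \<omega>)\<^sup>2) + 2 * ennreal ((I \<omega> - ?S r \<omega>)\<^sup>2)"
        proof -
          have "gap t \<omega> - gap_approx n r j \<omega> = (I' \<omega> - ?S' r \<omega>) - (I \<omega> - ?S r \<omega>)"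
            using eq by (simp add: gap_def gap_approx_def)
          then show ?thesis using ennreal_sq_triangle[of "I' \<omega> - ?S' r \<omega>" "I \<omega> - ?S r \<omega>" 0]
            by (simp only: diff_0 diff_0_right power2_minus)
        qed
      qed
    qed
    also have "\<dots> = 2 * (\<integral>\<^sup>+\<omega>. ennreal ((I' \<omega> - ?S' r \<omega>)\<^sup>2) \<partial>M) + 2 * (\<integral>\<^sup>+\<omega>. ennreal ((I \<omega> - ?S r \<omega>)\<^sup>2) \<partial>M)"
      by (subst nn_integral_add) (auto simp: nn_integral_cmult)
    finally show ?thesis .
  qed
  have "(\<lambda>r. 2 * (\<integral>\<^sup>+\<omega>. ennreal ((I' \<omega> - ?S' r \<omega>)\<^sup>2) \<partial>M) + 2 * (\<integral>\<^sup>+\<omega>. ennreal ((I \<omega> - ?S r \<omega>)\<^sup>2) \<partial>M)) \<longlonglongrightarrow> 2 * 0 + 2 * 0"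
    by (rule tendsto_add[OF ennreal_tendsto_cmult[OF _ lim'] ennreal_tendsto_cmult[OF _ lim]]) simp_all
  then have lim0: "(\<lambda>r. 2 * (\<integral>\<^sup>+\<omega>. ennreal ((I' \<omega> - ?S' r \<omega>)\<^sup>2) \<partial>M) + 2 * (\<integral>\<^sup>+\<omega>. ennreal ((I \<omega> - ?S r \<omega>)\<^sup>2) \<partial>M)) \<longlonglongrightarrow> 0"
    by (simp only: mult_zero_right add_0_right)
  have "(\<lambda>r. \<integral>\<^sup>+\<omega>. ennreal ((gap t \<omega> - gap_approx n r j \<omega>)\<^sup>2) \<partial>M) \<longlonglongrightarrow> 0"
  proof (rule tendsto_sandwich[OF _ _ tendsto_const lim0])
    show "\<forall>\<^sub>F r in sequentially. 0 \<le> (\<integral>\<^sup>+\<omega>. ennreal ((gap t \<omega> - gap_approx n r j \<omega>)\<^sup>2) \<partial>M)"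
      by (intro always_eventually allI zero_le)
  qed (intro always_eventually allI bound)
  then show ?thesis by (simp add: t_def)
qed

lemma refined_le:
  fixes j n r :: nat
  assumes "j \<le> 2 ^ n" shows "j * 2 ^ r \<le> 2 ^ (n + r)"
  using mult_right_mono[OF assms, of "2 ^ r"] by (simp add: power_add)

lemma grid_points:
  assumes "i < 2 ^ l"
  shows "0 \<le> real i * (T / 2 ^ l)" "real i * (T / 2 ^ l) \<le> T"
  using grid_range[of i l] assms by (auto simp: grid_def)

lemma ito_sum_grid_measurable:
  assumes "j \<le> 2 ^ l" "\<And>s. 0 \<le> s \<Longrightarrow> s \<le> T \<Longrightarrow> g s \<in> borel_measurable M"
  shows "ito_sum W h g (T / 2 ^ l) j \<in> borel_measurable M"
proof (rule ito_sum_measurable)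
  fix i assume "i < j"
  then have "i < 2 ^ l" using assms(1) by simp
  then show "g (real i * (T / 2 ^ l)) \<in> borel_measurable M" by (intro assms(2) grid_points)
qed (use T_pos in simp)

lemma gap_approx_measurable:
  assumes "j \<le> 2 ^ n"
  shows "gap_approx n r j \<in> borel_measurable M"
  unfolding gap_approx_def[abs_def] using refined_le[OF assms]
  by (intro borel_measurable_diff ito_sum_grid_measurable measurable_g)

lemma gap_Sup_le:
  assumes I: "I \<subseteq> {..2 ^ n}"
    and U: "\<And>r. U r \<in> borel_measurable M" "\<And>r j \<omega>. j \<in> I \<Longrightarrow> gap_approx n r j \<omega> ^ (2 * m) \<le> U r \<omega>"
      "\<And>r. integrable M (U r)" "\<And>r. expectation (U r) \<le> c"
    and ne: "I \<noteq> {}"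
  shows "(\<integral>\<^sup>+\<omega>. (SUP j\<in>I. ennreal (gap (grid n j) \<omega> ^ (2 * m))) \<partial>M) \<le> ennreal c"
proof (rule nn_integral_Sup_power_le[where S="gap_approx n" and U="\<lambda>r \<omega>. ennreal (U r \<omega>)"])
  show "finite I" using I by (rule finite_subset) simp
  fix j assume j: "j \<in> I"
  then have jn: "j \<le> 2 ^ n" using I by auto
  show "gap (grid n j) \<in> borel_measurable M" using grid_range[OF jn] by (intro measurable_g)
  show "gap_approx n r j \<in> borel_measurable M" for r by (rule gap_approx_measurable[OF jn])
  show "(\<lambda>r. \<integral>\<^sup>+\<omega>. ennreal ((gap (grid n j) \<omega> - gap_approx n r j \<omega>)\<^sup>2) \<partial>M) \<longlonglongrightarrow> 0"
    by (rule gap_approx_limit[OF jn])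
  show "ennreal (gap_approx n r j \<omega> ^ (2 * m)) \<le> ennreal (U r \<omega>)" for r \<omega>
    using U(2)[OF j] by (rule ennreal_leI)
next
  \<comment> \<open>U is nonnegative because it dominates an even power, for which some index in I
    is needed.\<close>
  obtain j where j: "j \<in> I" using ne by blast
  have U0: "0 \<le> U r \<omega>" for r \<omega> using order_trans[OF _ U(2)[OF j, of r \<omega>]] by simp
  show "(\<integral>\<^sup>+\<omega>. ennreal (U r \<omega>) \<partial>M) \<le> ennreal c" for r
    using U0 U(3,4)[of r] by (simp add: nn_integral_eq_integral ennreal_leI)
qed (use U in auto)

text \<open>Splitting off the kernel difference: the first sum is small because of the kernels, the second one
  because of the solutions.\<close>

lemma gap_approx_split:
  "gap_approx n r j \<omega> = ito_sum W (\<lambda>u. k' u - k u) gY (T / 2 ^ (n + r)) (j * 2 ^ r) \<omega>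
    + ito_sum W k g_gap (T / 2 ^ (n + r)) (j * 2 ^ r) \<omega>"
  unfolding gap_approx_def ito_sum_def g_gap_def sum_subtractf[symmetric] sum.distrib[symmetric]
  by (intro sum.cong) (auto simp: algebra_simps)

lemma g_moment:
  assumes i: "i < 2 ^ l"
  shows "integrable M (\<lambda>\<omega>. gY (real i * (T / 2 ^ l)) \<omega> ^ (2 * m))"
    "expectation (\<lambda>\<omega>. gY (real i * (T / 2 ^ l)) \<omega> ^ (2 * m)) \<le> (B\<^sup>2 * exp (\<rho> * (real i * (T / 2 ^ l)))) ^ m"
    "integrable M (\<lambda>\<omega>. gZ (real i * (T / 2 ^ l)) \<omega> ^ (2 * m))"
    "expectation (\<lambda>\<omega>. gZ (real i * (T / 2 ^ l)) \<omega> ^ (2 * m)) \<le> (B\<^sup>2 * exp (\<rho> * (real i * (T / 2 ^ l)))) ^ m"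
proof -
  note bm = bounded_power_moment[OF measurable_g(1)[OF grid_points[OF i]] g_le(1)]
    bounded_power_moment[OF measurable_g(2)[OF grid_points[OF i]] g_le(2)]
  have gB: "(B\<^sup>2) ^ m \<le> (B\<^sup>2 * exp (\<rho> * (real i * (T / 2 ^ l)))) ^ m"
  proof (rule power_mono)
    have "0 \<le> \<rho> * (real i * (T / 2 ^ l))" using \<rho>_nonneg grid_points(1)[OF i] by (rule mult_nonneg_nonneg)
    then have "1 \<le> exp (\<rho> * (real i * (T / 2 ^ l)))" by (simp only: one_le_exp_iff)
    then have "B\<^sup>2 * 1 \<le> B\<^sup>2 * exp (\<rho> * (real i * (T / 2 ^ l)))" by (intro mult_left_mono) auto
    then show "B\<^sup>2 \<le> B\<^sup>2 * exp (\<rho> * (real i * (T / 2 ^ l)))" by simp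
  qed simp
  show "integrable M (\<lambda>\<omega>. gY (real i * (T / 2 ^ l)) \<omega> ^ (2 * m))"
    "expectation (\<lambda>\<omega>. gY (real i * (T / 2 ^ l)) \<omega> ^ (2 * m)) \<le> (B\<^sup>2 * exp (\<rho> * (real i * (T / 2 ^ l)))) ^ m"
    "integrable M (\<lambda>\<omega>. gZ (real i * (T / 2 ^ l)) \<omega> ^ (2 * m))"
    "expectation (\<lambda>\<omega>. gZ (real i * (T / 2 ^ l)) \<omega> ^ (2 * m)) \<le> (B\<^sup>2 * exp (\<rho> * (real i * (T / 2 ^ l)))) ^ m"
    using bm(1,3) order_trans[OF bm(2) gB] order_trans[OF bm(4) gB] by blast+
qed

text \<open>Refinement changes neither the time \<open>grid n j\<close> nor the energy integral, so
  the bound is free of r, as the passage to the limit requires.\<close>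

lemma refined_moment:
  assumes j: "j \<le> 2 ^ n" and g: "\<And>s. 0 \<le> s \<Longrightarrow> s \<le> T \<Longrightarrow> g s \<in> borel_measurable (F s)"
    and gi: "\<And>i l. i < 2 ^ l \<Longrightarrow> integrable M (\<lambda>\<omega>. g (real i * (T / 2 ^ l)) \<omega> ^ (2 * m))"
    and G: "0 \<le> G" "\<And>i l. i < 2 ^ l \<Longrightarrow>
      expectation (\<lambda>\<omega>. g (real i * (T / 2 ^ l)) \<omega> ^ (2 * m)) \<le> (G * exp (\<rho> * (real i * (T / 2 ^ l)))) ^ m"
    and h: "\<And>u. 0 < u \<Longrightarrow> u \<le> T \<Longrightarrow> \<bar>h u\<bar> \<le> \<eta> u"
    and \<eta>: "\<And>u v. 0 < u \<Longrightarrow> u \<le> v \<Longrightarrow> v \<le> T \<Longrightarrow> \<eta> v \<le> \<eta> u" "set_integrable lborel {0<..T} (\<lambda>u. (\<eta> u)\<^sup>2)"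
  shows "integrable M (\<lambda>\<omega>. ito_sum W h g (T / 2 ^ (n + r)) (j * 2 ^ r) \<omega> ^ (2 * m))"
    and "expectation (\<lambda>\<omega>. ito_sum W h g (T / 2 ^ (n + r)) (j * 2 ^ r) \<omega> ^ (2 * m))
      \<le> (4 * (real m)\<^sup>2 * (LINT u:{0<..T}|lborel. (\<eta> u)\<^sup>2 * exp (- \<rho> * u)) * G * exp (\<rho> * grid n j)) ^ m"
proof -
  note mom = ito_sum_moment[OF T_pos refined_le[OF j], where g=g and m=m and G=G and r=\<rho> and k=h and \<kappa>=\<eta>,
      OF g[OF grid_points] gi G(1) G(2) \<rho>_nonneg h \<eta> order.refl]
  show "integrable M (\<lambda>\<omega>. ito_sum W h g (T / 2 ^ (n + r)) (j * 2 ^ r) \<omega> ^ (2 * m))"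
    by (rule mom(1)) auto
  show "expectation (\<lambda>\<omega>. ito_sum W h g (T / 2 ^ (n + r)) (j * 2 ^ r) \<omega> ^ (2 * m))
      \<le> (4 * (real m)\<^sup>2 * (LINT u:{0<..T}|lborel. (\<eta> u)\<^sup>2 * exp (- \<rho> * u)) * G * exp (\<rho> * grid n j)) ^ m"
    unfolding grid_refine[of n r j, symmetric] grid_def[of "n + r"] by (rule mom(2)) auto
qed

text \<open>The squared L^(2m) norm of the gap, discounted by e^(-\<rho>t), is at most c at every
  dyadic time; the m-th power outside lets c enter linearly. The integral is extended-valued, so
  integrability of the gap is not presupposed.\<close>

definition "gap_moment_le c \<longleftrightarrow> (\<forall>n j. j \<le> 2 ^ n \<longrightarrow>
  (\<integral>\<^sup>+\<omega>. ennreal (gap (grid n j) \<omega> ^ (2 * m)) \<partial>M) \<le> ennreal ((c * exp (\<rho> * grid n j)) ^ m))"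

text \<open>The finiteness without which the contraction could not start. Both sums are bounded
  crudely through |\<sigma>| \<le> B, so this c depends on both majorants, \<open>\<kappa>'\<close>
  included; the iteration in \<open>gap_moment\<close> removes that dependence.\<close>

lemma ex_gap_moment_le: "\<exists>c\<ge>0. gap_moment_le c"
proof -
  define e where "e = (LINT u:{0<..T}|lborel. (\<kappa> u)\<^sup>2 * exp (- \<rho> * u))"
  define e' where "e' = (LINT u:{0<..T}|lborel. (\<kappa>' u)\<^sup>2 * exp (- \<rho> * u))"
  have e0: "0 \<le> e" "0 \<le> e'" by (auto simp: e_def e'_def set_lebesgue_integral_def integral_nonneg_AE)
  define c where "c = 4 * (4 * (real m)\<^sup>2 * e' * B\<^sup>2 + 4 * (real m)\<^sup>2 * e * B\<^sup>2)"
  have "gap_moment_le c"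
    unfolding gap_moment_le_def
  proof (intro allI impI)
    fix n j :: nat assume j: "j \<le> 2 ^ n"
    let ?S = "\<lambda>r. ito_sum W k gZ (T / 2 ^ (n + r)) (j * 2 ^ r)"
    let ?S' = "\<lambda>r. ito_sum W k' gY (T / 2 ^ (n + r)) (j * 2 ^ r)"
    define E where "E = exp (\<rho> * grid n j)"
    have S: "integrable M (\<lambda>\<omega>. ?S r \<omega> ^ (2 * m))" "expectation (\<lambda>\<omega>. ?S r \<omega> ^ (2 * m)) \<le> (4 * (real m)\<^sup>2 * e * B\<^sup>2 * E) ^ m" for r
      unfolding e_def E_def
      by (rule refined_moment[where g=gZ and G="B\<^sup>2" and \<eta>="\<kappa>", OF j adapted_g(2) g_moment(3) _ g_moment(4) k_le \<kappa>_antimono \<kappa>_square];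
        (assumption | simp)?)+
    have S': "integrable M (\<lambda>\<omega>. ?S' r \<omega> ^ (2 * m))" "expectation (\<lambda>\<omega>. ?S' r \<omega> ^ (2 * m)) \<le> (4 * (real m)\<^sup>2 * e' * B\<^sup>2 * E) ^ m" for r
      unfolding e'_def E_def
      by (rule refined_moment[where g=gY and G="B\<^sup>2" and \<eta>="\<kappa>'", OF j adapted_g(1) g_moment(1) _ g_moment(2) k'_le \<kappa>'_antimono \<kappa>'_square];
        (assumption | simp)?)+
    have "(\<integral>\<^sup>+\<omega>. (SUP j\<in>{j}. ennreal (gap (grid n j) \<omega> ^ (2 * m))) \<partial>M) \<le> ennreal ((c * E) ^ m)"
    proof (rule gap_Sup_le[where U="\<lambda>r \<omega>. 4 ^ m * (?S' r \<omega> ^ (2 * m) + ?S r \<omega> ^ (2 * m))"])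
      show "(\<lambda>\<omega>. 4 ^ m * (?S' r \<omega> ^ (2 * m) + ?S r \<omega> ^ (2 * m))) \<in> borel_measurable M" for r
        using borel_measurable_integrable[OF S(1)[of r]] borel_measurable_integrable[OF S'(1)[of r]] by simp
      show "gap_approx n r j' \<omega> ^ (2 * m) \<le> 4 ^ m * (?S' r \<omega> ^ (2 * m) + ?S r \<omega> ^ (2 * m))" if "j' \<in> {j}" for j' r \<omega>
        using power_even_add_le[of "?S' r \<omega>" "- ?S r \<omega>" m] that by (simp add: gap_approx_def)
      show "integrable M (\<lambda>\<omega>. 4 ^ m * (?S' r \<omega> ^ (2 * m) + ?S r \<omega> ^ (2 * m)))" for r using S S' by simp
      show "expectation (\<lambda>\<omega>. 4 ^ m * (?S' r \<omega> ^ (2 * m) + ?S r \<omega> ^ (2 * m))) \<le> (c * E) ^ m" for r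
      proof -
        have "expectation (\<lambda>\<omega>. 4 ^ m * (?S' r \<omega> ^ (2 * m) + ?S r \<omega> ^ (2 * m)))
          \<le> 4 ^ m * ((4 * (real m)\<^sup>2 * e' * B\<^sup>2 * E) ^ m + (4 * (real m)\<^sup>2 * e * B\<^sup>2 * E) ^ m)"
          using S S' by (simp add: add_mono)
        \<comment> \<open>Superadditivity of the m-th power puts both terms under a single power,
          the form that \<open>gap_moment_le\<close> asks for.\<close>
        also have "\<dots> \<le> 4 ^ m * (4 * (real m)\<^sup>2 * e' * B\<^sup>2 * E + 4 * (real m)\<^sup>2 * e * B\<^sup>2 * E) ^ m"
          using e0 m_pos by (intro mult_left_mono power_add_le) (auto simp: E_def)
        also have "\<dots> = (c * E) ^ m" by (simp only: power_mult_distrib[symmetric]) (simp add: c_def algebra_simps)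
        finally show ?thesis .
      qed
    qed (use j in auto)
    then show "(\<integral>\<^sup>+\<omega>. ennreal (gap (grid n j) \<omega> ^ (2 * m)) \<partial>M) \<le> ennreal ((c * exp (\<rho> * grid n j)) ^ m)"
      by (simp add: E_def)
  qed
  moreover have "0 \<le> c" using e0 by (simp add: c_def)
  ultimately show ?thesis by blast
qed

text \<open>Integrability comes from |g_gap| \<le> 2B, the size from the Lipschitz bound; it is the
  latter that inherits the smallness of the gap.\<close>

lemma g_gap_moment:
  assumes "gap_moment_le c" "0 \<le> c" "i < 2 ^ l"
  shows "integrable M (\<lambda>\<omega>. g_gap (real i * (T / 2 ^ l)) \<omega> ^ (2 * m))"
    and "expectation (\<lambda>\<omega>. g_gap (real i * (T / 2 ^ l)) \<omega> ^ (2 * m)) \<le> (L\<^sup>2 * c * exp (\<rho> * (real i * (T / 2 ^ l)))) ^ m"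
proof -
  let ?s = "real i * (T / 2 ^ l)"
  note s = grid_points[OF assms(3)]
  show i: "integrable M (\<lambda>\<omega>. g_gap ?s \<omega> ^ (2 * m))"
    by (rule bounded_power_moment(1)[OF measurable_g(3)[OF s] g_le(3)])
  have "ennreal (expectation (\<lambda>\<omega>. g_gap ?s \<omega> ^ (2 * m))) = (\<integral>\<^sup>+\<omega>. ennreal (g_gap ?s \<omega> ^ (2 * m)) \<partial>M)"
    using i by (simp add: nn_integral_eq_integral)
  also have "\<dots> \<le> (\<integral>\<^sup>+\<omega>. ennreal ((L\<^sup>2) ^ m) * ennreal (gap ?s \<omega> ^ (2 * m)) \<partial>M)"
  proof (rule nn_integral_mono)
    fix \<omega>
    have "g_gap ?s \<omega> ^ (2 * m) \<le> (L * \<bar>gap ?s \<omega>\<bar>) ^ (2 * m)"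
      using power_mono[OF g_le(4), of ?s \<omega> "2 * m"] by (simp add: power_even_abs)
    also have "\<dots> = (L\<^sup>2) ^ m * gap ?s \<omega> ^ (2 * m)" by (simp add: power_mult_distrib power_even_abs power_mult)
    finally show "ennreal (g_gap ?s \<omega> ^ (2 * m)) \<le> ennreal ((L\<^sup>2) ^ m) * ennreal (gap ?s \<omega> ^ (2 * m))"
      by (simp add: ennreal_mult[symmetric] ennreal_leI)
  qed
  also have "\<dots> = ennreal ((L\<^sup>2) ^ m) * (\<integral>\<^sup>+\<omega>. ennreal (gap ?s \<omega> ^ (2 * m)) \<partial>M)"
    using measurable_g(4)[OF s] by (intro nn_integral_cmult) simp
  also have "\<dots> \<le> ennreal ((L\<^sup>2) ^ m) * ennreal ((c * exp (\<rho> * ?s)) ^ m)"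
    using assms by (intro mult_left_mono) (auto simp: gap_moment_le_def grid_def)
  also have "\<dots> = ennreal ((L\<^sup>2 * c * exp (\<rho> * ?s)) ^ m)"
    using assms by (simp add: ennreal_mult[symmetric] power_mult_distrib mult.assoc)
  finally show "expectation (\<lambda>\<omega>. g_gap ?s \<omega> ^ (2 * m)) \<le> (L\<^sup>2 * c * exp (\<rho> * ?s)) ^ m"
    using assms by (subst (asm) ennreal_le_iff) auto
qed

text \<open>By \<open>ito_sum_bound\<close>, A^(2m) times this variable dominates the 2m-th power of
  the sum with integrand \<open>gY\<close> for every kernel of increment bound A, at all times of
  the grid.\<close>

definition "maximal_gY n \<omega> = chaining_const b ^ (2 * m) * dyadic_energy b m n (T / 2 ^ n) (grid_martingale gY (T / 2 ^ n) \<omega>)"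
definition "maximal_gap n \<omega> = chaining_const b ^ (2 * m) * dyadic_energy b m n (T / 2 ^ n) (grid_martingale g_gap (T / 2 ^ n) \<omega>)"

lemma maximal_gY_moment:
  "integrable M (maximal_gY n)" "expectation (maximal_gY n) \<le> maximal_const T b m * (B\<^sup>2) ^ m"
proof -
  note bm = bounded_power_moment[OF measurable_g(1) g_le(1)]
  note de = dyadic_energy_expectation[OF T_pos m_large, where n=n and g=gY and G="B\<^sup>2",
      OF adapted_g(1)[OF grid_points] bm(1)[OF grid_points] _ bm(2)[OF grid_points]]
  show "integrable M (maximal_gY n)" unfolding maximal_gY_def[abs_def] by (intro integrable_mult_right de(1)) auto
  have "expectation (maximal_gY n) = chaining_const b ^ (2 * m) * expectation (\<lambda>\<omega>. dyadic_energy b m n (T / 2 ^ n) (grid_martingale gY (T / 2 ^ n) \<omega>))"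
    unfolding maximal_gY_def[abs_def] by simp
  also have "\<dots> \<le> chaining_const b ^ (2 * m) * (2 * T powr (real m * (1 - 2 * b)) * (4 * (real m)\<^sup>2) ^ m * (B\<^sup>2) ^ m)"
    by (intro mult_left_mono de(2)) auto
  finally show "expectation (maximal_gY n) \<le> maximal_const T b m * (B\<^sup>2) ^ m"
    by (simp add: maximal_const_def mult_ac)
qed

lemma maximal_gap_moment:
  assumes "gap_moment_le c" "0 \<le> c"
  shows "integrable M (maximal_gap n)" "expectation (maximal_gap n) \<le> maximal_const T b m * (L\<^sup>2 * c * exp (\<rho> * T)) ^ m"
proof -
  have gm: "expectation (\<lambda>\<omega>. g_gap (real i * (T / 2 ^ n)) \<omega> ^ (2 * m)) \<le> (L\<^sup>2 * c * exp (\<rho> * T)) ^ m" if "i < 2 ^ n" for i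
  proof (rule order_trans[OF g_gap_moment(2)[OF assms that]])
    show "(L\<^sup>2 * c * exp (\<rho> * (real i * (T / 2 ^ n)))) ^ m \<le> (L\<^sup>2 * c * exp (\<rho> * T)) ^ m"
    proof (rule power_mono, rule mult_left_mono)
      show "exp (\<rho> * (real i * (T / 2 ^ n))) \<le> exp (\<rho> * T)"
        unfolding exp_le_cancel_iff using grid_points(2)[OF that] \<rho>_nonneg by (rule mult_left_mono)
    qed (use assms in auto)
  qed
  note de = dyadic_energy_expectation[OF T_pos m_large, where n=n and g=g_gap and G="L\<^sup>2 * c * exp (\<rho> * T)",
      OF adapted_g(3)[OF grid_points] g_gap_moment(1)[OF assms] _ gm]
  show "integrable M (maximal_gap n)" unfolding maximal_gap_def[abs_def] using assms by (intro integrable_mult_right de(1)) auto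
  have "expectation (maximal_gap n) = chaining_const b ^ (2 * m) * expectation (\<lambda>\<omega>. dyadic_energy b m n (T / 2 ^ n) (grid_martingale g_gap (T / 2 ^ n) \<omega>))"
    unfolding maximal_gap_def[abs_def] by simp
  also have "\<dots> \<le> chaining_const b ^ (2 * m) * (2 * T powr (real m * (1 - 2 * b)) * (4 * (real m)\<^sup>2) ^ m * (L\<^sup>2 * c * exp (\<rho> * T)) ^ m)"
    using assms by (intro mult_left_mono de(2)) auto
  finally show "expectation (maximal_gap n) \<le> maximal_const T b m * (L\<^sup>2 * c * exp (\<rho> * T)) ^ m"
    by (simp add: maximal_const_def mult_ac)
qed

text \<open>The squared size of the kernel-difference term. The maximum with 1 stands in for an m-th
  root, since x \<le> (max 1 x)^m; A enters as a pure square, so that the final bound is linear in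
  A.\<close>

definition "kernel_gap = A\<^sup>2 * (max 1 (maximal_const T b m) * B\<^sup>2)"

lemma kernel_gap_nonneg: "0 \<le> kernel_gap"
  by (simp add: kernel_gap_def)

text \<open>Gronwall's lemma as a contraction on the constants \<open>c\<close> that are admissible at all dyadic times: no
  regularity in time of the moments is used.\<close>

lemma gap_moment_step:
  assumes c: "gap_moment_le c" "0 \<le> c"
  shows "gap_moment_le (4 * kernel_gap + c / 2)"
  unfolding gap_moment_le_def
proof (intro allI impI)
  fix n j :: nat assume j: "j \<le> 2 ^ n"
  define e where "e = (LINT u:{0<..T}|lborel. (\<kappa> u)\<^sup>2 * exp (- \<rho> * u))"
  have e0: "0 \<le> e" by (auto simp: e_def set_lebesgue_integral_def integral_nonneg_AE)
  define E where "E = exp (\<rho> * grid n j)"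
  have E1: "1 \<le> E" using grid_range[OF j] \<rho>_nonneg by (simp add: E_def)
  let ?S = "\<lambda>r. ito_sum W k g_gap (T / 2 ^ (n + r)) (j * 2 ^ r)"
  have S: "integrable M (\<lambda>\<omega>. ?S r \<omega> ^ (2 * m))" "expectation (\<lambda>\<omega>. ?S r \<omega> ^ (2 * m)) \<le> (4 * (real m)\<^sup>2 * e * (L\<^sup>2 * c) * E) ^ m" for r
    unfolding e_def E_def
    by (rule refined_moment[where g=g_gap and G="L\<^sup>2 * c" and \<eta>="\<kappa>", OF j adapted_g(3) g_gap_moment(1)[OF c] _ g_gap_moment(2)[OF c] k_le \<kappa>_antimono \<kappa>_square];
      (assumption | simp add: c)?)+
  have Ak: "A ^ (2 * m) * (maximal_const T b m * (B\<^sup>2) ^ m) \<le> kernel_gap ^ m"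
  proof -
    have "maximal_const T b m \<le> max 1 (maximal_const T b m)" by simp
    also have "\<dots> \<le> max 1 (maximal_const T b m) ^ m" using m_pos by (intro self_le_power) auto
    finally show ?thesis
      by (auto simp: kernel_gap_def power_mult_distrib power_mult[symmetric] intro!: mult_left_mono mult_right_mono)
  qed
  have "(\<integral>\<^sup>+\<omega>. (SUP j\<in>{j}. ennreal (gap (grid n j) \<omega> ^ (2 * m))) \<partial>M) \<le> ennreal (((4 * kernel_gap + c / 2) * E) ^ m)"
  \<comment> \<open>The kernel-difference sum is estimated by chaining even at a fixed time, because
    A is an increment bound and not an energy norm; the other sum uses the discounted energy of
    \<open>\<kappa>\<close>, which \<rho> makes small.\<close>
  proof (rule gap_Sup_le[where U="\<lambda>r \<omega>. 4 ^ m * (A ^ (2 * m) * maximal_gY (n + r) \<omega> + ?S r \<omega> ^ (2 * m))"])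
    show i: "integrable M (\<lambda>\<omega>. 4 ^ m * (A ^ (2 * m) * maximal_gY (n + r) \<omega> + ?S r \<omega> ^ (2 * m)))" for r
      using S(1)[of r] maximal_gY_moment(1)[of "n + r"] by simp
    then show "(\<lambda>\<omega>. 4 ^ m * (A ^ (2 * m) * maximal_gY (n + r) \<omega> + ?S r \<omega> ^ (2 * m))) \<in> borel_measurable M" for r
      by (rule borel_measurable_integrable)
    show "gap_approx n r j' \<omega> ^ (2 * m) \<le> 4 ^ m * (A ^ (2 * m) * maximal_gY (n + r) \<omega> + ?S r \<omega> ^ (2 * m))" if "j' \<in> {j}" for j' r \<omega>
    proof -
      have "gap_approx n r j \<omega> ^ (2 * m)
        \<le> 4 ^ m * (ito_sum W (\<lambda>u. k' u - k u) gY (T / 2 ^ (n + r)) (j * 2 ^ r) \<omega> ^ (2 * m) + ?S r \<omega> ^ (2 * m))"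
        unfolding gap_approx_split by (rule power_even_add_le)
      also have "\<dots> \<le> 4 ^ m * (A ^ (2 * m) * maximal_gY (n + r) \<omega> + ?S r \<omega> ^ (2 * m))"
        unfolding maximal_gY_def
        by (intro mult_left_mono add_right_mono ito_sum_bound[OF T_pos b_pos m_pos refined_le[OF j] diff_increment A_nonneg]) auto
      finally show ?thesis using that by simp
    qed
    show "expectation (\<lambda>\<omega>. 4 ^ m * (A ^ (2 * m) * maximal_gY (n + r) \<omega> + ?S r \<omega> ^ (2 * m))) \<le> ((4 * kernel_gap + c / 2) * E) ^ m" for r
    proof -
      have "expectation (\<lambda>\<omega>. 4 ^ m * (A ^ (2 * m) * maximal_gY (n + r) \<omega> + ?S r \<omega> ^ (2 * m)))
        = 4 ^ m * (A ^ (2 * m) * expectation (maximal_gY (n + r)) + expectation (\<lambda>\<omega>. ?S r \<omega> ^ (2 * m)))"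
        using S(1)[of r] maximal_gY_moment(1)[of "n + r"] by simp
      also have "\<dots> \<le> 4 ^ m * (kernel_gap ^ m + (4 * (real m)\<^sup>2 * e * (L\<^sup>2 * c) * E) ^ m)"
        using A_nonneg by (intro mult_left_mono add_mono order_trans[OF _ Ak] S(2) maximal_gY_moment(2)) auto
      also have "\<dots> \<le> 4 ^ m * (kernel_gap + 4 * (real m)\<^sup>2 * e * (L\<^sup>2 * c) * E) ^ m"
        using kernel_gap_nonneg e0 c E1 m_pos by (intro mult_left_mono power_add_le) auto
      also have "\<dots> = (4 * kernel_gap + 16 * (real m)\<^sup>2 * e * (L\<^sup>2 * c) * E) ^ m"
        by (simp only: power_mult_distrib[symmetric]) (simp add: algebra_simps)
      also have "\<dots> \<le> ((4 * kernel_gap + c / 2) * E) ^ m"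
      proof (rule power_mono)
        \<comment> \<open>This is twice the coefficient 16 m^2 e L^2 of the second term, which hence
          costs at most c/2; E \<ge> 1 brings \<open>kernel_gap\<close> under the same
          exponential.\<close>
        have "32 * (real m)\<^sup>2 * L\<^sup>2 * e * (c * E) \<le> 1 * (c * E)"
          using \<rho>_large c E1 unfolding e_def by (intro mult_right_mono) auto
        moreover have "kernel_gap * 1 \<le> kernel_gap * E" using E1 kernel_gap_nonneg by (intro mult_left_mono) auto
        ultimately show "4 * kernel_gap + 16 * (real m)\<^sup>2 * e * (L\<^sup>2 * c) * E \<le> (4 * kernel_gap + c / 2) * E"
          by (simp add: algebra_simps)
        show "0 \<le> 4 * kernel_gap + 16 * (real m)\<^sup>2 * e * (L\<^sup>2 * c) * E"
          using kernel_gap_nonneg e0 c E1 by simp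
      qed
      finally show ?thesis .
    qed
  qed (use j in auto)
  then show "(\<integral>\<^sup>+\<omega>. ennreal (gap (grid n j) \<omega> ^ (2 * m)) \<partial>M) \<le> ennreal (((4 * kernel_gap + c / 2) * exp (\<rho> * grid n j)) ^ m)"
    by (simp add: E_def)
qed

text \<open>8 \<open>kernel_gap\<close> is the fixed point of c -> 4 \<open>kernel_gap\<close> +
  c/2. Starting above it, the excess is halved at each step, and the limit forgets the initial
  c.\<close>

lemma gap_moment: "gap_moment_le (8 * kernel_gap)"
proof -
  obtain c where c: "0 \<le> c" "gap_moment_le c" using ex_gap_moment_le by blast
  have it: "gap_moment_le (8 * kernel_gap + c / 2 ^ i)" for i
  proof (induction i)
    case 0
    have le: "(c * exp (\<rho> * s)) ^ m \<le> ((8 * kernel_gap + c) * exp (\<rho> * s)) ^ m" for s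
      using c kernel_gap_nonneg by (intro power_mono mult_right_mono) auto
    show ?case unfolding gap_moment_le_def
    proof (intro allI impI)
      fix n j :: nat assume "j \<le> 2 ^ n"
      then have "(\<integral>\<^sup>+\<omega>. ennreal (gap (grid n j) \<omega> ^ (2 * m)) \<partial>M) \<le> ennreal ((c * exp (\<rho> * grid n j)) ^ m)"
        using c(2) by (simp add: gap_moment_le_def)
      also have "\<dots> \<le> ennreal (((8 * kernel_gap + c / 2 ^ 0) * exp (\<rho> * grid n j)) ^ m)"
        using le by (intro ennreal_leI) simp
      finally show "(\<integral>\<^sup>+\<omega>. ennreal (gap (grid n j) \<omega> ^ (2 * m)) \<partial>M)
          \<le> ennreal (((8 * kernel_gap + c / 2 ^ 0) * exp (\<rho> * grid n j)) ^ m)" .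
    qed
  next
    case (Suc i)
    have "4 * kernel_gap + (8 * kernel_gap + c / 2 ^ i) / 2 = 8 * kernel_gap + c / 2 ^ Suc i"
      by (simp add: add_divide_distrib)
    moreover have "0 \<le> 8 * kernel_gap + c / 2 ^ i" using c kernel_gap_nonneg by simp
    ultimately show ?case using gap_moment_step[OF Suc] by (simp only: refl)
  qed
  show ?thesis
    unfolding gap_moment_le_def
  proof (intro allI impI)
    fix n j :: nat assume j: "j \<le> 2 ^ n"
    have "(\<lambda>i. c * (1 / 2) ^ i) \<longlonglongrightarrow> c * 0" by (intro tendsto_mult tendsto_const LIMSEQ_realpow_zero) auto
    then have c0: "(\<lambda>i. c / 2 ^ i) \<longlonglongrightarrow> 0" by (simp add: power_one_over)
    have "(\<lambda>i. ennreal (((8 * kernel_gap + c / 2 ^ i) * exp (\<rho> * grid n j)) ^ m)) \<longlonglongrightarrow> ennreal (((8 * kernel_gap + 0) * exp (\<rho> * grid n j)) ^ m)"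
      by (intro tendsto_ennrealI tendsto_intros c0)
    then show "(\<integral>\<^sup>+\<omega>. ennreal (gap (grid n j) \<omega> ^ (2 * m)) \<partial>M) \<le> ennreal ((8 * kernel_gap * exp (\<rho> * grid n j)) ^ m)"
      using it j by (intro LIMSEQ_le_const[of "\<lambda>i. ennreal (((8 * kernel_gap + c / 2 ^ i) * exp (\<rho> * grid n j)) ^ m)"])
        (auto simp: gap_moment_le_def)
  qed
qed

end

text \<open>What remains of the bound for the 2m-th moment of the supremum once A^(2m) is factored
  out. Neither \<open>\<kappa>'\<close> nor A occurs, so it is the same for all N, n and nodes as
  soon as \<open>\<Phi>\<close> and \<open>\<rho>\<close> are.\<close>

definition stability_const :: "real \<Rightarrow> real \<Rightarrow> nat \<Rightarrow> real \<Rightarrow> real \<Rightarrow> real \<Rightarrow> real \<Rightarrow> real" where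
  "stability_const T b m B L \<Phi> \<rho> = 4 ^ m * (maximal_const T b m * (B\<^sup>2) ^ m
     + \<Phi> ^ (2 * m) * (maximal_const T b m * (L\<^sup>2 * (8 * (max 1 (maximal_const T b m) * B\<^sup>2)) * exp (\<rho> * T)) ^ m))"

context volterra_pair
begin

text \<open>Now the Lipschitz term is treated by chaining as well: its dominating variable serves
  all j at once, and its expectation is small by the fixed-time moments, so the whole supremum is of
  order A^(2m).\<close>

lemma gap_grid_Sup:
  "(\<integral>\<^sup>+\<omega>. (SUP j\<in>{..2 ^ n}. ennreal (gap (grid n j) \<omega> ^ (2 * m))) \<partial>M) \<le> ennreal (A ^ (2 * m) * stability_const T b m B L \<Phi> \<rho>)"
proof (rule gap_Sup_le[where U="\<lambda>r \<omega>. 4 ^ m * (A ^ (2 * m) * maximal_gY (n + r) \<omega> + \<Phi> ^ (2 * m) * maximal_gap (n + r) \<omega>)"])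
  have k0: "0 \<le> 8 * kernel_gap" using kernel_gap_nonneg by simp
  note mg = maximal_gap_moment[OF gap_moment k0]
  show i: "integrable M (\<lambda>\<omega>. 4 ^ m * (A ^ (2 * m) * maximal_gY (n + r) \<omega> + \<Phi> ^ (2 * m) * maximal_gap (n + r) \<omega>))" for r
    using mg(1)[of "n + r"] maximal_gY_moment(1)[of "n + r"] by simp
  then show "(\<lambda>\<omega>. 4 ^ m * (A ^ (2 * m) * maximal_gY (n + r) \<omega> + \<Phi> ^ (2 * m) * maximal_gap (n + r) \<omega>)) \<in> borel_measurable M" for r
    by (rule borel_measurable_integrable)
  show "gap_approx n r j \<omega> ^ (2 * m) \<le> 4 ^ m * (A ^ (2 * m) * maximal_gY (n + r) \<omega> + \<Phi> ^ (2 * m) * maximal_gap (n + r) \<omega>)"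
    if "j \<in> {..2 ^ n}" for j r \<omega>
  proof -
    have j: "j \<le> 2 ^ n" using that by simp
    have "gap_approx n r j \<omega> ^ (2 * m)
      \<le> 4 ^ m * (ito_sum W (\<lambda>u. k' u - k u) gY (T / 2 ^ (n + r)) (j * 2 ^ r) \<omega> ^ (2 * m)
        + ito_sum W k g_gap (T / 2 ^ (n + r)) (j * 2 ^ r) \<omega> ^ (2 * m))"
      unfolding gap_approx_split by (rule power_even_add_le)
    also have "\<dots> \<le> 4 ^ m * (A ^ (2 * m) * maximal_gY (n + r) \<omega> + \<Phi> ^ (2 * m) * maximal_gap (n + r) \<omega>)"
      unfolding maximal_gY_def maximal_gap_def
      by (intro mult_left_mono add_mono ito_sum_bound[OF T_pos b_pos m_pos refined_le[OF j] diff_increment A_nonneg]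
          ito_sum_bound[OF T_pos b_pos m_pos refined_le[OF j] k_increment \<Phi>_nonneg]) auto
    finally show ?thesis .
  qed
  show "expectation (\<lambda>\<omega>. 4 ^ m * (A ^ (2 * m) * maximal_gY (n + r) \<omega> + \<Phi> ^ (2 * m) * maximal_gap (n + r) \<omega>))
    \<le> A ^ (2 * m) * stability_const T b m B L \<Phi> \<rho>" for r
  proof -
    have "expectation (\<lambda>\<omega>. 4 ^ m * (A ^ (2 * m) * maximal_gY (n + r) \<omega> + \<Phi> ^ (2 * m) * maximal_gap (n + r) \<omega>))
      = 4 ^ m * (A ^ (2 * m) * expectation (maximal_gY (n + r)) + \<Phi> ^ (2 * m) * expectation (maximal_gap (n + r)))"
      using mg(1)[of "n + r"] maximal_gY_moment(1)[of "n + r"] by simp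
    also have "\<dots> \<le> 4 ^ m * (A ^ (2 * m) * (maximal_const T b m * (B\<^sup>2) ^ m)
        + \<Phi> ^ (2 * m) * (maximal_const T b m * (L\<^sup>2 * (8 * kernel_gap) * exp (\<rho> * T)) ^ m))"
      using A_nonneg \<Phi>_nonneg by (intro mult_left_mono add_mono mg(2) maximal_gY_moment(2)) auto
    \<comment> \<open>\<open>kernel_gap\<close> is quadratic in A, so its m-th power carries the
      same factor A^(2m) as the first term.\<close>
    also have "(L\<^sup>2 * (8 * kernel_gap) * exp (\<rho> * T)) ^ m
        = A ^ (2 * m) * (L\<^sup>2 * (8 * (max 1 (maximal_const T b m) * B\<^sup>2)) * exp (\<rho> * T)) ^ m"
      unfolding kernel_gap_def power_mult power_mult_distrib[symmetric] by (simp add: mult_ac)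
    finally show ?thesis by (simp add: stability_const_def algebra_simps)
  qed
qed auto

end

section \<open>From even moments on grids to the norm of the supremum\<close>

lemma ennreal_powr_mono: "a \<le> b \<Longrightarrow> 0 \<le> p \<Longrightarrow> ennreal_powr a p \<le> ennreal_powr b p"
  by (auto simp: ennreal_powr_def top_unique less_top intro!: ennreal_leI powr_mono2 enn2real_mono)

lemma ennreal_powr_ennreal: "0 \<le> x \<Longrightarrow> ennreal_powr (ennreal x) p = ennreal (x powr p)"
  by (simp add: ennreal_powr_def)

text \<open>Interpolation by the pointwise bound \<open>s\<^sup>p \<le> l\<^sup>p (1 + (s / l)\<^sup>q)\<close>, with \<open>l\<close> of the order of the \<open>L\<^sup>q\<close> norm.\<close>

lemma Lp_norm_le_of_even_moment:
  fixes S V :: "'a \<Rightarrow> ennreal"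
  assumes "prob_space M" and V[measurable]: "V \<in> borel_measurable M" and VS: "AE \<omega> in M. \<forall>s. ennreal s \<le> S \<omega> \<longrightarrow> 0 \<le> s \<longrightarrow> ennreal (s ^ q) \<le> V \<omega>"
    and Vl: "(\<integral>\<^sup>+\<omega>. V \<omega> \<partial>M) \<le> ennreal (l ^ q)" and l: "0 < l" and p: "1 \<le> p" "p \<le> real q"
  shows "ennreal_powr (\<integral>\<^sup>+\<omega>. ennreal_powr (S \<omega>) p \<partial>M) (1 / p) \<le> ennreal (2 * l)"
proof -
  interpret prob_space M by fact
  have q: "0 < q" using p by (cases q) auto
  have "(\<integral>\<^sup>+\<omega>. ennreal_powr (S \<omega>) p \<partial>M) \<le> (\<integral>\<^sup>+\<omega>. ennreal (l powr p) * (1 + ennreal (1 / l ^ q) * V \<omega>) \<partial>M)"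
  proof (rule nn_integral_mono_AE)
    show "AE \<omega> in M. ennreal_powr (S \<omega>) p \<le> ennreal (l powr p) * (1 + ennreal (1 / l ^ q) * V \<omega>)"
      using VS
    proof eventually_elim
      fix \<omega> assume V: "\<forall>s. ennreal s \<le> S \<omega> \<longrightarrow> 0 \<le> s \<longrightarrow> ennreal (s ^ q) \<le> V \<omega>"
      show "ennreal_powr (S \<omega>) p \<le> ennreal (l powr p) * (1 + ennreal (1 / l ^ q) * V \<omega>)"
      proof (cases "V \<omega>")
        case top
        then show ?thesis using l by (simp add: ennreal_mult_top)
      next
        case (real v)
        \<comment> \<open>The assumption on V is tested at s = 1 + v, where s^q \<ge> s > v.\<close>
        have "S \<omega> \<noteq> \<infinity>"
        proof
          assume "S \<omega> = \<infinity>"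
          then have "ennreal ((1 + v) ^ q) \<le> V \<omega>" using V real by simp
          then have "(1 + v) ^ q \<le> v" using real by simp
          moreover have "1 + v \<le> (1 + v) ^ q" using real q by (intro self_le_power) auto
          ultimately show False by simp
        qed
        then obtain s where s: "S \<omega> = ennreal s" "0 \<le> s" by (cases "S \<omega>") auto
        have sv: "s ^ q \<le> v" using V s real by simp
        have "(s / l) powr p \<le> 1 + (s / l) ^ q"
        proof (cases "s / l \<le> 1")
          case True
          then have "(s / l) powr p \<le> 1" using s l p by (intro powr_le1) auto
          then show ?thesis using s l by (simp add: add_increasing2)
        next
          case False
          then have "(s / l) powr p \<le> (s / l) powr real q" using p by (intro powr_mono) auto
          also have "\<dots> = (s / l) ^ q" using False by (intro powr_realpow) auto
          finally show ?thesis by simp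
        qed
        also have "\<dots> \<le> 1 + 1 / l ^ q * v" using sv l by (simp add: power_divide divide_right_mono)
        finally have "l powr p * (s / l) powr p \<le> l powr p * (1 + 1 / l ^ q * v)" by (intro mult_left_mono) auto
        moreover have "l powr p * (s / l) powr p = s powr p" using s l by (simp add: powr_mult[symmetric])
        ultimately have "ennreal (s powr p) \<le> ennreal (l powr p * (1 + 1 / l ^ q * v))" by (intro ennreal_leI) simp
        also have "\<dots> = ennreal (l powr p) * (1 + ennreal (1 / l ^ q) * V \<omega>)"
        proof -
          have "ennreal (1 / l ^ q) * ennreal v = ennreal (1 / l ^ q * v)"
            using l real by (intro ennreal_mult[symmetric]) auto
          moreover have "1 + ennreal (1 / l ^ q * v) = ennreal (1 + 1 / l ^ q * v)"
            using l real ennreal_plus[of 1 "1 / l ^ q * v"] by simp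
          moreover have "ennreal (l powr p * (1 + 1 / l ^ q * v)) = ennreal (l powr p) * ennreal (1 + 1 / l ^ q * v)"
            using l real by (intro ennreal_mult) auto
          ultimately show ?thesis by (simp only: real)
        qed
        finally show ?thesis using s by (simp add: ennreal_powr_ennreal)
      qed
    qed
  qed
  also have "\<dots> = ennreal (l powr p) * (1 + ennreal (1 / l ^ q) * (\<integral>\<^sup>+\<omega>. V \<omega> \<partial>M))"
    by (simp add: nn_integral_cmult nn_integral_add emeasure_space_1)
  also have "\<dots> \<le> ennreal (l powr p) * (1 + ennreal (1 / l ^ q) * ennreal (l ^ q))"
    using Vl by (intro mult_left_mono add_left_mono) auto
  also have "ennreal (1 / l ^ q) * ennreal (l ^ q) = 1" using l by (simp add: ennreal_mult[symmetric])
  also have "ennreal (l powr p) * (1 + 1) = ennreal (2 * l powr p)"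
    by (simp add: ennreal_mult mult.commute)
  finally have "ennreal_powr (\<integral>\<^sup>+\<omega>. ennreal_powr (S \<omega>) p \<partial>M) (1 / p) \<le> ennreal_powr (ennreal (2 * l powr p)) (1 / p)"
    using p by (intro ennreal_powr_mono) auto
  also have "\<dots> = ennreal (2 powr (1 / p) * l)"
    using l p by (simp add: ennreal_powr_ennreal powr_mult powr_powr)
  also have "\<dots> \<le> ennreal (2 powr 1 * l)"
    using l p by (intro ennreal_leI mult_right_mono powr_mono) auto
  finally show ?thesis using l by simp
qed

lemma dyadic_approximation:
  assumes T: "0 < T" and t: "0 \<le> t" "t \<le> T"
  obtains j :: "nat \<Rightarrow> nat" where "\<And>n. j n \<le> 2 ^ n" "(\<lambda>n. real (j n) * (T / 2 ^ n)) \<longlonglongrightarrow> t"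
proof -
  define j where "j n = nat \<lfloor>t / T * 2 ^ n\<rfloor>" for n :: nat
  have j: "real (j n) \<le> t / T * 2 ^ n" "t / T * 2 ^ n < real (j n) + 1" for n
  proof -
    have "0 \<le> t / T * 2 ^ n" using T t by simp
    then have "real (j n) = real_of_int \<lfloor>t / T * 2 ^ n\<rfloor>" unfolding j_def by simp
    then show "real (j n) \<le> t / T * 2 ^ n" "t / T * 2 ^ n < real (j n) + 1" by linarith+
  qed
  have "j n \<le> 2 ^ n" for n
  proof -
    have "t / T * 2 ^ n \<le> 1 * 2 ^ n" using T t by (intro mult_right_mono) auto
    from order_trans[OF j(1) this] have "real (j n) \<le> real (2 ^ n)" by simp
    then show ?thesis by (simp only: of_nat_le_iff)
  qed
  moreover have "(\<lambda>n. real (j n) * (T / 2 ^ n)) \<longlonglongrightarrow> t"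
  proof (rule tendsto_sandwich[OF _ _ _ tendsto_const])
    have "(\<lambda>n. t - T * (1 / 2) ^ n) \<longlonglongrightarrow> t - T * 0" by (intro tendsto_intros LIMSEQ_realpow_zero) auto
    then show "(\<lambda>n. t - T * (1 / 2) ^ n) \<longlonglongrightarrow> t" by simp
    show "\<forall>\<^sub>F n in sequentially. t - T * (1 / 2) ^ n \<le> real (j n) * (T / 2 ^ n)"
    proof (intro always_eventually allI)
      fix n
      have "t / T * 2 ^ n * (T / 2 ^ n) \<le> (real (j n) + 1) * (T / 2 ^ n)" using j(2)[of n] T by (intro mult_right_mono) auto
      then show "t - T * (1 / 2) ^ n \<le> real (j n) * (T / 2 ^ n)" using T by (simp add: power_one_over algebra_simps add_divide_distrib)
    qed
    show "\<forall>\<^sub>F n in sequentially. real (j n) * (T / 2 ^ n) \<le> t"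
    proof (intro always_eventually allI)
      fix n
      have "real (j n) * (T / 2 ^ n) \<le> t / T * 2 ^ n * (T / 2 ^ n)" using j(1)[of n] T by (intro mult_right_mono) auto
      then show "real (j n) * (T / 2 ^ n) \<le> t" using T by simp
    qed
  qed
  ultimately show ?thesis using that by blast
qed

context volterra_pair
begin

text \<open>The suprema over the nested dyadic grids increase, and by path continuity their limit
  dominates the 2m-th power of the gap at every time of [0,T]. This limit is a measurable majorant,
  which spares a measurability claim for the uncountable supremum. A > 0 and the maximum with 1 keep
  the interpolation level l positive.\<close>

lemma Lp_norm_sup_dist_le:
  assumes p: "1 \<le> p" "p \<le> real (2 * m)" and A: "0 < A"
  shows "Lp_norm_sup_dist M p T Y Z \<le> ennreal (2 * root (2 * m) (max 1 (stability_const T b m B L \<Phi> \<rho>)) * A)"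
proof -
  define c where "c = max 1 (stability_const T b m B L \<Phi> \<rho>)"
  define l where "l = root (2 * m) c * A"
  have c1: "1 \<le> c" by (simp add: c_def)
  have l: "0 < l" using A c1 m_pos by (simp add: l_def)
  have lq: "l ^ (2 * m) = A ^ (2 * m) * c" using c1 m_pos by (simp add: l_def power_mult_distrib mult.commute)
  define V where "V n \<omega> = (SUP j\<in>{..2 ^ n}. ennreal (gap (grid n j) \<omega> ^ (2 * m)))" for n \<omega>
  have Vm[measurable]: "V n \<in> borel_measurable M" for n
    unfolding V_def[abs_def]
  proof (rule borel_measurable_SUP)
    fix j :: nat assume "j \<in> {..2 ^ n}"
    then have "gap (grid n j) \<in> borel_measurable M" by (intro measurable_g grid_range) auto
    then show "(\<lambda>\<omega>. ennreal (gap (grid n j) \<omega> ^ (2 * m))) \<in> borel_measurable M" by simp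
  qed simp
  have Vinc: "incseq V"
  proof (rule incseq_SucI, rule le_funI)
    fix n \<omega>
    show "V n \<omega> \<le> V (Suc n) \<omega>"
      unfolding V_def
    proof (rule SUP_mono)
      fix j :: nat assume "j \<in> {..2 ^ n}"
      then show "\<exists>j'\<in>{..2 ^ Suc n}. ennreal (gap (grid n j) \<omega> ^ (2 * m)) \<le> ennreal (gap (grid (Suc n) j') \<omega> ^ (2 * m))"
        using grid_refine[of n 1 j] by (intro bexI[of _ "j * 2"]) auto
    qed
  qed
  have "(\<integral>\<^sup>+\<omega>. V n \<omega> \<partial>M) \<le> ennreal (l ^ (2 * m))" for n
  proof -
    have "(\<integral>\<^sup>+\<omega>. V n \<omega> \<partial>M) \<le> ennreal (A ^ (2 * m) * stability_const T b m B L \<Phi> \<rho>)"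
      unfolding V_def by (rule gap_grid_Sup)
    also have "\<dots> \<le> ennreal (l ^ (2 * m))"
      unfolding lq c_def by (intro ennreal_leI mult_left_mono) auto
    finally show ?thesis .
  qed
  then have Vl: "(\<integral>\<^sup>+\<omega>. (SUP n. V n \<omega>) \<partial>M) \<le> ennreal (l ^ (2 * m))"
    by (subst nn_integral_monotone_convergence_SUP[OF Vinc Vm]) (auto intro: SUP_least)
  have cont: "AE \<omega> in M. continuous_on {0..T} (\<lambda>t. Y t \<omega>) \<and> continuous_on {0..T} (\<lambda>t. Z t \<omega>)"
    using solution_k solution_k' unfolding volterra_solution_def by (intro AE_conjI) blast+
  have "AE \<omega> in M. \<forall>s. ennreal s \<le> (SUP t\<in>{0..T}. ennreal \<bar>Y t \<omega> - Z t \<omega>\<bar>) \<longrightarrow> 0 \<le> s \<longrightarrow> ennreal (s ^ (2 * m)) \<le> (SUP n. V n \<omega>)"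
    using cont
  proof eventually_elim
    fix \<omega> assume cont: "continuous_on {0..T} (\<lambda>t. Y t \<omega>) \<and> continuous_on {0..T} (\<lambda>t. Z t \<omega>)"
    let ?v = "SUP n. V n \<omega>"
    have gv: "ennreal (gap t \<omega> ^ (2 * m)) \<le> ?v" if t: "t \<in> {0..T}" for t
    proof -
      obtain j where j: "\<And>n. j n \<le> 2 ^ n" "(\<lambda>n. real (j n) * (T / 2 ^ n)) \<longlonglongrightarrow> t"
        using dyadic_approximation[OF T_pos, of t] t by auto
      have jt: "(\<lambda>n. grid n (j n)) \<longlonglongrightarrow> t" using j(2) by (simp add: grid_def)
      have "continuous_on {0..T} (\<lambda>t. gap t \<omega>)" unfolding gap_def using cont by (intro continuous_on_diff) auto
      then have "(\<lambda>n. gap (grid n (j n)) \<omega>) \<longlonglongrightarrow> gap t \<omega>"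
      proof (rule continuous_on_tendsto_compose[OF _ jt t])
        show "\<forall>\<^sub>F n in sequentially. grid n (j n) \<in> {0..T}"
          using grid_range[OF j(1)] by (intro always_eventually allI) auto
      qed
      then have "(\<lambda>n. ennreal (gap (grid n (j n)) \<omega> ^ (2 * m))) \<longlonglongrightarrow> ennreal (gap t \<omega> ^ (2 * m))"
        by (intro tendsto_ennrealI tendsto_power)
      moreover have "ennreal (gap (grid n (j n)) \<omega> ^ (2 * m)) \<le> ?v" for n
      proof -
        have "ennreal (gap (grid n (j n)) \<omega> ^ (2 * m)) \<le> V n \<omega>"
          unfolding V_def using j(1)[of n] by (intro SUP_upper) auto
        also have "\<dots> \<le> ?v" by (intro SUP_upper) auto
        finally show ?thesis .
      qed
      ultimately show ?thesis by (intro LIMSEQ_le_const2[where X="\<lambda>n. ennreal (gap (grid n (j n)) \<omega> ^ (2 * m))"]) blast+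
    qed
    show "\<forall>s. ennreal s \<le> (SUP t\<in>{0..T}. ennreal \<bar>Y t \<omega> - Z t \<omega>\<bar>) \<longrightarrow> 0 \<le> s \<longrightarrow> ennreal (s ^ (2 * m)) \<le> ?v"
    proof (intro allI impI)
      fix s assume s: "ennreal s \<le> (SUP t\<in>{0..T}. ennreal \<bar>Y t \<omega> - Z t \<omega>\<bar>)" "0 \<le> s"
      show "ennreal (s ^ (2 * m)) \<le> ?v"
      proof (cases ?v)
        case (real v)
        have "\<bar>Y t \<omega> - Z t \<omega>\<bar> \<le> root (2 * m) v" if "t \<in> {0..T}" for t
        proof -
          have "\<bar>gap t \<omega>\<bar> ^ (2 * m) \<le> v" using gv[OF that] real by (simp add: power_even_abs)
          then have "root (2 * m) (\<bar>gap t \<omega>\<bar> ^ (2 * m)) \<le> root (2 * m) v" using m_pos by (intro real_root_le_mono) auto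
          then show ?thesis using m_pos by (simp add: real_root_power_cancel gap_def)
        qed
        then have "(SUP t\<in>{0..T}. ennreal \<bar>Y t \<omega> - Z t \<omega>\<bar>) \<le> ennreal (root (2 * m) v)"
          by (intro SUP_least ennreal_leI)
        then have "ennreal s \<le> ennreal (root (2 * m) v)" using s(1) by simp
        then have "s \<le> root (2 * m) v" using real m_pos by (simp add: ennreal_le_iff)
        then have "s ^ (2 * m) \<le> root (2 * m) v ^ (2 * m)" using s(2) by (intro power_mono)
        also have "\<dots> = v" using real m_pos by (intro real_root_pow_pos2) auto
        finally show ?thesis using real by (simp add: ennreal_leI)
      next
        case top
        then show ?thesis by (simp only: top_greatest)
      qed
    qed
  qed
  from Lp_norm_le_of_even_moment[OF prob_space_axioms _ this Vl l p] have
    "Lp_norm_sup_dist M p T Y Z \<le> ennreal (2 * l)"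
    unfolding Lp_norm_sup_dist_def by simp
  then show ?thesis by (simp add: l_def c_def mult.assoc)
qed

end

lemma Lp_norm_sup_dist_commute: "Lp_norm_sup_dist M p T Y Z = Lp_norm_sup_dist M p T Z Y"
  by (simp add: Lp_norm_sup_dist_def abs_minus_commute)

section \<open>The discretized kernel\<close>

text \<open>A mixed second difference of e^(-zw), estimated by the mean value theorem first in z and
  then in w: up to sign the mixed derivative is (1 - zw) e^(-zw), of modulus at most 1 for z, w
  \<ge> 0. The bound therefore does not grow with the size of x and y, and so not with N.\<close>

lemma exp_difference_lipschitz:
  fixes x y u v :: real
  assumes "0 \<le> x" "0 \<le> y" "0 \<le> u" "u \<le> v"
  shows "\<bar>(exp (- y * v) - exp (- y * u)) - (exp (- x * v) - exp (- x * u))\<bar> \<le> \<bar>y - x\<bar> * (v - u)"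
proof -
  have d: "\<bar>u * exp (- z * u) - v * exp (- z * v)\<bar> \<le> v - u" if z: "0 \<le> z" for z
  proof -
    have "norm (u * exp (- z * u) - v * exp (- z * v)) \<le> 1 * norm (u - v)"
    proof (rule field_differentiable_bound)
      show "((\<lambda>w. w * exp (- z * w)) has_field_derivative (1 - z * w) * exp (- z * w)) (at w within {0..})" for w
        by (auto intro!: derivative_eq_intros simp: algebra_simps)
      fix w :: real assume "w \<in> {0..}"
      then have s: "0 \<le> z * w" using z by simp
      have "\<bar>1 - z * w\<bar> \<le> 1 + z * w" using s by simp
      also have "\<dots> \<le> exp (z * w)" by (rule exp_ge_add_one_self)
      finally have "\<bar>1 - z * w\<bar> * exp (- z * w) \<le> exp (z * w) * exp (- z * w)" by (intro mult_right_mono) auto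
      also have "\<dots> = 1" by (simp add: mult_exp_exp)
      finally show "norm ((1 - z * w) * exp (- z * w)) \<le> 1" by (simp add: abs_mult)
    qed (use assms in auto)
    then show ?thesis using assms by simp
  qed
  have "norm ((exp (- y * v) - exp (- y * u)) - (exp (- x * v) - exp (- x * u))) \<le> (v - u) * norm (y - x)"
  proof (rule field_differentiable_bound)
    show "((\<lambda>z. exp (- z * v) - exp (- z * u)) has_field_derivative (u * exp (- z * u) - v * exp (- z * v))) (at z within {0..})" for z
      by (auto intro!: derivative_eq_intros simp: algebra_simps)
    show "norm (u * exp (- z * u) - v * exp (- z * v)) \<le> v - u" if "z \<in> {0..}" for z
      using d[of z] that by simp
  qed (use assms in auto)
  then show ?thesis by (simp add: mult.commute)
qed

lemma grid_point_0: "grid_point N n 0 = 0"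
  by (simp add: grid_point_def)

lemma grid_point_mono: "0 < N \<Longrightarrow> i \<le> j \<Longrightarrow> grid_point N n i \<le> grid_point N n j"
  by (simp add: grid_point_def divide_right_mono mult_right_mono)

lemma grid_point_n: "1 \<le> n \<Longrightarrow> grid_point N n n = N"
  by (simp add: grid_point_def)

lemma grid_point_step: "1 \<le> i \<Longrightarrow> grid_point N n i - grid_point N n (i - 1) = N / real n"
  by (simp add: grid_point_def of_nat_diff diff_divide_distrib[symmetric] algebra_simps)

lemma set_integral_cells:
  fixes f :: "real \<Rightarrow> real"
  assumes int: "set_integrable \<mu> {0..<N} f" and sets: "\<And>a b. 0 \<le> a \<Longrightarrow> {a..<b} \<in> sets \<mu>" and n: "1 \<le> n" and N: "0 < N"
  shows "(LINT x:{0..<N}|\<mu>. f x) = (\<Sum>i=1..n. LINT x:{grid_point N n (i - 1)..<grid_point N n i}|\<mu>. f x)"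
proof -
  have "(LINT x:{0..<grid_point N n k}|\<mu>. f x) = (\<Sum>i=1..k. LINT x:{grid_point N n (i - 1)..<grid_point N n i}|\<mu>. f x)"
    if "k \<le> n" for k
    using that
  proof (induction k)
    case 0
    then show ?case by (simp add: grid_point_0 set_lebesgue_integral_def)
  next
    case (Suc k)
    have g: "0 \<le> grid_point N n k" "grid_point N n k \<le> grid_point N n (Suc k)" "grid_point N n (Suc k) \<le> N"
      using grid_point_mono[OF N, of 0 k n] grid_point_mono[OF N, of k "Suc k" n] grid_point_mono[OF N, of "Suc k" n n]
        grid_point_0 grid_point_n[OF n] Suc.prems by simp_all
    have sub: "set_integrable \<mu> {a..<b} f" if "0 \<le> a" "b \<le> N" for a b
      by (rule set_integrable_subset[OF int sets]) (use that in auto)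
    have "{0..<grid_point N n (Suc k)} = {0..<grid_point N n k} \<union> {grid_point N n k..<grid_point N n (Suc k)}"
      using g by auto
    then have "(LINT x:{0..<grid_point N n (Suc k)}|\<mu>. f x)
        = (LINT x:{0..<grid_point N n k}|\<mu>. f x) + (LINT x:{grid_point N n k..<grid_point N n (Suc k)}|\<mu>. f x)"
      using g by (simp only:, intro set_integral_Un sub) auto
    then show ?case using Suc by simp
  qed
  from this[of n] show ?thesis by (simp add: grid_point_n[OF n])
qed

text \<open>Each weight is the mass of its cell, so the kernel difference is a sum of integrals of
  e^(-x_i w) - e^(-y w) with y in the cell of x_i. There |x_i - y| \<le> N/n, and the masses of the
  cells add up to \<mu>([0,N)).\<close>

lemma discretized_kernel_lipschitz:
  assumes cm: "completely_monotone_with K \<mu>" and N: "0 < N" and n: "1 \<le> n"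
    and x: "\<And>i. i \<in> {1..n} \<Longrightarrow> x i \<in> {grid_point N n (i - 1)..<grid_point N n i}" and u: "0 \<le> u" "u \<le> v"
  shows "\<bar>(discretized_kernel \<mu> N n x v - truncated_kernel \<mu> N v) - (discretized_kernel \<mu> N n x u - truncated_kernel \<mu> N u)\<bar>
    \<le> measure \<mu> {0..<N} * N / real n * (v - u)"
proof -
  define c where "c i = {grid_point N n (i - 1)..<grid_point N n i}" for i
  have sets: "{a..<b} \<in> sets \<mu>" if "0 \<le> a" for a b
    using that by (auto simp: cm_sets_iff[OF cm])
  have g0: "0 \<le> grid_point N n i" for i using grid_point_mono[OF N, of 0 i n] by (simp add: grid_point_0)
  have cs: "c i \<in> sets \<mu>" for i unfolding c_def by (rule sets[OF g0])
  have c_sub: "c i \<subseteq> {0..<N}" if "i \<in> {1..n}" for i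
    using g0[of "i - 1"] grid_point_mono[OF N, of i n n] grid_point_n[OF n] that unfolding c_def by (auto intro: less_le_trans order_trans)
  have fin: "emeasure \<mu> {0..<N} < \<infinity>" by (rule cm_finite[OF cm])
  have bounded_int: "set_integrable \<mu> C f"
    if f: "f \<in> borel_measurable borel" "\<And>y. 0 \<le> y \<Longrightarrow> \<bar>f y\<bar> \<le> b" and C: "C \<in> sets \<mu>" "C \<subseteq> {0..<N}" for f :: "real \<Rightarrow> real" and b C
    unfolding set_integrable_def
  proof (rule Bochner_Integration.integrable_bound)
    show "integrable \<mu> (\<lambda>y. b * indicator {0..<N} y)"
      using fin sets[of 0 N] by (intro integrable_mult_right) (simp add: integrable_real_indicator)
    show "AE y in \<mu>. norm (indicator C y *\<^sub>R f y) \<le> norm (b * indicator {0..<N} y)"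
      using f(2) C(2) by (intro AE_I2) (force simp: indicator_def cm_space[OF cm])
    show "(\<lambda>y. indicator C y *\<^sub>R f y) \<in> borel_measurable \<mu>"
      using cm_measurable[OF cm f(1)] C(1) by (intro borel_measurable_scaleR borel_measurable_indicator)
  qed
  have Nx: "0 \<le> x i" if "i \<in> {1..n}" for i using x[OF that] g0[of "i - 1"] by auto
  have exp_int: "set_integrable \<mu> C (\<lambda>y. exp (- y * w))" if "0 \<le> w" "C \<in> sets \<mu>" "C \<subseteq> {0..<N}" for w C
    using that by (intro bounded_int[where b=1]) auto
  have const_int: "set_integrable \<mu> C (\<lambda>y. a)" if "C \<in> sets \<mu>" "C \<subseteq> {0..<N}" for a :: real and C
    using that by (intro bounded_int[where b="\<bar>a\<bar>"]) auto
  have cfin: "emeasure \<mu> (c i) < \<infinity>" if "i \<in> {1..n}" for i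
    using emeasure_mono[OF c_sub[OF that] sets[of 0 N]] fin by (auto intro: le_less_trans)
  have const: "(LINT y:c i|\<mu>. a) = measure \<mu> (c i) * a" if "i \<in> {1..n}" for a :: real and i
    using set_integral_const[of "c i" \<mu> a] cs[of i] cfin[OF that] by (simp add: less_top)
  have diff: "discretized_kernel \<mu> N n x w - truncated_kernel \<mu> N w = (\<Sum>i=1..n. LINT y:c i|\<mu>. exp (- x i * w) - exp (- y * w))"
    if w: "0 \<le> w" for w
  proof -
    have "truncated_kernel \<mu> N w = (\<Sum>i=1..n. LINT y:c i|\<mu>. exp (- y * w))"
      unfolding truncated_kernel_def c_def
      by (rule set_integral_cells[OF exp_int[OF w] sets n N]) (use sets[of 0 N] in auto)
    moreover have "discretized_kernel \<mu> N n x w = (\<Sum>i=1..n. LINT y:c i|\<mu>. exp (- x i * w))"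
      unfolding discretized_kernel_def grid_weight_def c_def[symmetric] using const by (intro sum.cong) auto
    ultimately show ?thesis
      unfolding sum_subtractf[symmetric]
      by (simp add: sum_subtractf[symmetric], intro sum.cong refl set_integral_diff(2)[symmetric] exp_int[OF w, simplified] const_int cs c_sub) auto
  qed
  let ?f = "\<lambda>i y. (exp (- x i * v) - exp (- y * v)) - (exp (- x i * u) - exp (- y * u))"
  have v0: "0 \<le> v" using u by simp
  have f_int: "set_integrable \<mu> (c i) (?f i)" if "i \<in> {1..n}" for i
    using that v0 u(1) by (intro set_integral_diff(1) exp_int const_int cs c_sub) auto
  have eq: "(discretized_kernel \<mu> N n x v - truncated_kernel \<mu> N v) - (discretized_kernel \<mu> N n x u - truncated_kernel \<mu> N u)
      = (\<Sum>i=1..n. LINT y:c i|\<mu>. ?f i y)"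
    unfolding diff[OF v0] diff[OF u(1)] sum_subtractf[symmetric]
    by (intro sum.cong refl set_integral_diff(2)[symmetric] set_integral_diff(1) exp_int const_int cs c_sub v0 u(1)) auto
  have "\<bar>\<Sum>i=1..n. LINT y:c i|\<mu>. ?f i y\<bar> \<le> (\<Sum>i=1..n. \<bar>LINT y:c i|\<mu>. ?f i y\<bar>)" by (rule sum_abs)
  also have "\<dots> \<le> (\<Sum>i=1..n. LINT y:c i|\<mu>. N / real n * (v - u))"
  proof (rule sum_mono)
    fix i assume i: "i \<in> {1..n}"
    have "\<bar>?f i y\<bar> \<le> N / real n * (v - u)" if y: "y \<in> c i" for y
    proof -
      have "0 \<le> y" using y c_sub[OF i] by auto
      then have "\<bar>?f i y\<bar> \<le> \<bar>x i - y\<bar> * (v - u)"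
        using exp_difference_lipschitz[of y "x i" u v] Nx[OF i] u by (simp add: algebra_simps)
      also have "\<dots> \<le> N / real n * (v - u)"
        using x[OF i] y grid_point_step[of i N n] i u unfolding c_def by (intro mult_right_mono) auto
      finally show ?thesis .
    qed
    then show "\<bar>LINT y:c i|\<mu>. ?f i y\<bar> \<le> (LINT y:c i|\<mu>. N / real n * (v - u))"
      unfolding set_lebesgue_integral_def
      using f_int[OF i] const_int[OF cs c_sub[OF i], of "N / real n * (v - u)"]
      by (intro integral_abs_bound_integral) (auto simp: set_integrable_def indicator_def)
  qed
  also have "\<dots> = (LINT y:{0..<N}|\<mu>. N / real n * (v - u))"
    unfolding c_def by (rule set_integral_cells[symmetric, OF const_int sets n N]) (use sets[of 0 N] in auto)
  also have "\<dots> = measure \<mu> {0..<N} * N / real n * (v - u)"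
    using set_integral_const[of "{0..<N}" \<mu> "N / real n * (v - u)"] sets[of 0 N] fin by (simp add: less_top)
  finally show ?thesis unfolding eq .
qed

text \<open>Both kernels equal \<mu>([0,N)) at 0, because the weights are exact cell masses. This
  supplies the condition h(0) = 0 of \<open>increment_bound_lipschitz\<close>.\<close>

lemma discretized_kernel_0:
  assumes cm: "completely_monotone_with K \<mu>" and N: "0 < N" and n: "1 \<le> n"
  shows "discretized_kernel \<mu> N n x 0 = truncated_kernel \<mu> N 0"
proof -
  have sets: "{a..<b} \<in> sets \<mu>" if "0 \<le> a" for a b
    using that by (auto simp: cm_sets_iff[OF cm])
  have g0: "0 \<le> grid_point N n i" for i using grid_point_mono[OF N, of 0 i n] by (simp add: grid_point_0)
  have fin: "emeasure \<mu> {a..<b} < \<infinity>" if "0 \<le> a" for a b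
    using emeasure_mono[of "{a..<b}" "{0..<b}" \<mu>] that sets[of 0 b] cm_finite[OF cm, of b] by (auto intro: le_less_trans)
  have const: "(LINT y:{a..<b}|\<mu>. 1) = measure \<mu> {a..<b}" if "0 \<le> a" for a b
    using set_integral_const[of "{a..<b}" \<mu> "1 :: real"] sets[OF that] fin[OF that] by (simp add: less_top)
  have "set_integrable \<mu> {0..<N} (\<lambda>y. 1 :: real)"
    using fin[of 0 N] sets[of 0 N] by (simp add: set_integrable_def)
  from set_integral_cells[OF this sets n N] show ?thesis
    unfolding discretized_kernel_def truncated_kernel_def grid_weight_def using const g0 by simp
qed

section \<open>Choice of the parameters and the two error estimates\<close>

theorem proposition4p2:
  fixes M :: "'a measure" and F :: "real \<Rightarrow> 'a measure" and W :: "real \<Rightarrow> 'a \<Rightarrow> real"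
    and T \<gamma> p :: real and K \<sigma> x0 :: "real \<Rightarrow> real" and \<mu> :: "real measure"
  assumes "brownian_motion M F W"
    and "T > 0"
    and "\<gamma> > 2" and "in_Lp_on \<gamma> {0..T} K" and "completely_monotone_with K \<mu>"
    and "bounded (range \<sigma>)" and "\<exists>L. L-lipschitz_on UNIV \<sigma>"
    and "continuous_on {0..T} x0"
    and "p \<ge> 1"
  shows "\<exists>C::real. C > 0 \<and> (\<forall>N>0.
    (\<forall>X XN.
       volterra_solution M F W T x0 \<sigma> K X \<longrightarrow>
       volterra_solution M F W T x0 \<sigma> (truncated_kernel \<mu> N) XN \<longrightarrow>
       Lp_norm_sup_dist M p T X XN
         \<le> ennreal C * (\<integral>\<^sup>+x\<in>{N..}. ennreal (x powr (- 1 / \<gamma>)) \<partial>\<mu>)) \<and>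
    (\<forall>n\<ge>1. \<forall>x XN XNn.
       (\<forall>i\<in>{1..n}. x i \<in> {grid_point N n (i - 1)..<grid_point N n i}) \<longrightarrow>
       volterra_solution M F W T x0 \<sigma> (truncated_kernel \<mu> N) XN \<longrightarrow>
       volterra_solution M F W T x0 \<sigma> (discretized_kernel \<mu> N n x) XNn \<longrightarrow>
       Lp_norm_sup_dist M p T XN XNn
         \<le> ennreal (C * (measure \<mu> {0..<N} * N / real n))))"
proof -
  note T = assms(2) and \<gamma> = assms(3) and Lp = assms(4) and cm = assms(5) and p = assms(9)
  \<comment> \<open>The midpoint of 1/\<gamma> and 1/2, which differ since \<gamma> > 2.\<close>
  define b where "b = (1 / \<gamma> + 1 / 2) / 2"
  have b: "1 / \<gamma> < b" "b < 1 / 2" "0 < b" "b \<le> 1"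
    using \<gamma> by (auto simp: b_def field_simps)
  \<comment> \<open>m0 makes the sum over scales converge, m1 puts p below the even exponent 2m;
    enlarging m keeps both.\<close>
  obtain m0 :: nat where m0: "2 / (1 - 2 * b) < real m0" using reals_Archimedean2 by blast
  obtain m1 :: nat where m1: "p < real m1" using reals_Archimedean2 by blast
  define m where "m = max m0 m1"
  have "2 / (1 - 2 * b) \<le> real m" using m0 by (simp add: m_def)
  then have m: "2 \<le> real m * (1 - 2 * b)" using b by (simp add: pos_divide_le_eq)
  have pm: "p \<le> real (2 * m)" using m1 p by (simp add: m_def)
  obtain B where B: "\<And>z. \<bar>\<sigma> z\<bar> \<le> B" using assms(6) by (auto simp: bounded_iff)
  obtain L where "L-lipschitz_on UNIV \<sigma>" using assms(7) by blast
  then have L: "\<bar>\<sigma> y - \<sigma> z\<bar> \<le> L * \<bar>y - z\<bar>" for y z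
    using lipschitz_onD[of L UNIV \<sigma> y z] by (simp add: dist_real_def)
  have K_sq: "set_integrable lborel {0<..T} (\<lambda>u. (K u)\<^sup>2)" by (rule cm_square_integrable[OF T \<gamma> Lp])
  \<comment> \<open>The target 1/(a + 1) below, instead of 1/a, covers L = 0.\<close>
  define a where "a = 32 * (real m)\<^sup>2 * L\<^sup>2"
  have a: "0 \<le> a" by (simp add: a_def)
  obtain \<rho> where \<rho>: "0 \<le> \<rho>" "(LINT u:{0<..T}|lborel. (K u)\<^sup>2 * exp (- \<rho> * u)) < 1 / (a + 1)"
    using discounted_energy_small[OF K_sq, of "1 / (a + 1)"] a by auto
  have "a * (LINT u:{0<..T}|lborel. (K u)\<^sup>2 * exp (- \<rho> * u)) \<le> a * (1 / (a + 1))"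
    using \<rho>(2) a by (intro mult_left_mono) auto
  also have "\<dots> \<le> 1" using a by (simp add: divide_le_eq)
  finally have \<rho>_large: "32 * (real m)\<^sup>2 * L\<^sup>2 * (LINT u:{0<..T}|lborel. (K u)\<^sup>2 * exp (- \<rho> * u)) \<le> 1"
    by (simp add: a_def)
  have ou: "integrable \<mu> (ou_weight T b)" using \<gamma> by (intro ou_weight_integrable[OF cm T _ Lp b(1)]) simp
  define \<Phi> where "\<Phi> = (LINT x|\<mu>. ou_weight T b x)"
  have \<Phi>0: "0 \<le> \<Phi>" unfolding \<Phi>_def by (intro integral_nonneg_AE AE_I2 ou_weight_nonneg)
  define C0 where "C0 = 2 * root (2 * m) (max 1 (stability_const T b m B L \<Phi> \<rho>))"
  have m_pos: "0 < m" using m by (cases m) auto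
  have C0: "0 < C0" unfolding C0_def using m_pos by simp
  have ou_set: "set_integrable \<mu> A (ou_weight T b)" if "A \<in> sets \<mu>" for A
    unfolding set_integrable_def by (rule integrable_mult_indicator[OF that ou])
  have sN: "{0..<N} \<in> sets \<mu>" "{N..} \<in> sets \<mu>" if "0 < N" for N
    using that by (auto simp: cm_sets_iff[OF cm])
  \<comment> \<open>Restricting the integral of a nonnegative weight to [0,N) can only decrease it,
    so \<Phi> serves every N.\<close>
  have tk_inc: "increment_bound T b (truncated_kernel \<mu> N) \<Phi>" if N: "0 < N" for N
  proof (rule increment_bound_mono[OF increment_bound_cm[OF cm sN(1)[OF N] _ T b(3,4) ou_set[OF sN(1)[OF N]]]])
    show "(LINT x:{0..<N}|\<mu>. ou_weight T b x) \<le> \<Phi>"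
      unfolding \<Phi>_def set_lebesgue_integral_def using ou_set[OF sN(1)[OF N]] ou ou_weight_nonneg
      by (intro integral_mono) (auto simp: set_integrable_def indicator_def)
  qed (simp add: truncated_kernel_def)
  have tk_cont: "continuous_on {0<..} (truncated_kernel \<mu> N)" if "0 < N" for N
    using cm_kernel_continuous[OF cm sN(1)[OF that]] by (simp add: truncated_kernel_def[abs_def])
  have tk_le: "\<bar>truncated_kernel \<mu> N u\<bar> \<le> K u" if "0 < N" "0 < u" for N u
    using cm_kernel_le[OF cm sN(1)[OF that(1)] that(2)] cm_kernel_nonneg[of \<mu> "{0..<N}" u]
    by (simp add: truncated_kernel_def)
  \<comment> \<open>Serves both estimates: \<open>k'\<close> will be K or the discretized kernel. C0
    is fixed before N, A, \<open>k'\<close> and \<open>\<kappa>'\<close> are chosen.\<close>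
  have core: "Lp_norm_sup_dist M p T Y Z \<le> ennreal (C0 * A)"
    if N: "0 < N" and A: "0 \<le> A" and inc: "increment_bound T b (\<lambda>u. k' u - truncated_kernel \<mu> N u) A"
      and \<kappa>': "\<And>u v. 0 < u \<Longrightarrow> u \<le> v \<Longrightarrow> v \<le> T \<Longrightarrow> \<kappa>' v \<le> \<kappa>' u" "set_integrable lborel {0<..T} (\<lambda>u. (\<kappa>' u)\<^sup>2)"
      and k': "continuous_on {0<..} k'" "\<And>u. 0 < u \<Longrightarrow> u \<le> T \<Longrightarrow> \<bar>k' u\<bar> \<le> \<kappa>' u"
      and Z: "volterra_solution M F W T x0 \<sigma> (truncated_kernel \<mu> N) Z" and Y: "volterra_solution M F W T x0 \<sigma> k' Y"
    for N A k' \<kappa>' Y Z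
  proof -
    have le: "Lp_norm_sup_dist M p T Y Z \<le> ennreal (C0 * (A + 1 / real (Suc i)))" for i
    proof -
      \<comment> \<open>The bound for a pair requires A > 0, while A = 0 may occur, for instance
        when \<mu> has no mass on [N,\<infinity>). The excess tends to 0 afterwards.\<close>
      define A' where "A' = A + 1 / real (Suc i)"
      have A': "0 < A'" "A \<le> A'" using A by (auto simp: A'_def intro: add_nonneg_pos)
      interpret volterra_pair M F W T b B L A' \<Phi> \<rho> m \<sigma> x0 K \<kappa>' "truncated_kernel \<mu> N" k' Y Z
      proof (intro volterra_pair.intro volterra_pair_axioms.intro)
        show "increment_bound T b (\<lambda>u. k' u - truncated_kernel \<mu> N u) A'"
          by (rule increment_bound_mono[OF inc A'(2)])
      qed (use assms(1) T b m B L K_sq \<kappa>' tk_cont[OF N] tk_le[OF N] k' tk_inc[OF N] \<Phi>0 A' Z Y \<rho>(1) \<rho>_large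
          cm_antimono[OF cm] in \<open>simp_all\<close>)
      show ?thesis unfolding C0_def A'_def[symmetric] by (rule Lp_norm_sup_dist_le[OF p pm A'(1)])
    qed
    have "(\<lambda>i. C0 * (A + 1 / real (Suc i))) \<longlonglongrightarrow> C0 * (A + 0)"
      by (intro tendsto_mult tendsto_add tendsto_const LIMSEQ_Suc lim_const_over_n)
    then have "(\<lambda>i. ennreal (C0 * (A + 1 / real (Suc i)))) \<longlonglongrightarrow> ennreal (C0 * A)"
      by (intro tendsto_ennrealI) simp
    then show ?thesis by (rule LIMSEQ_le_const) (use le in blast)
  qed
  \<comment> \<open>T^b is for x < 1, where x^(-1/\<gamma>) \<ge> 1, and 2 for x \<ge> 1, where b >
    1/\<gamma> gives x^(-b) \<le> x^(-1/\<gamma>); c2 is the constant of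
    \<open>increment_bound_lipschitz\<close>.\<close>
  define c1 where "c1 = max 2 (T powr b)"
  define c2 where "c2 = 2 * T * T powr b"
  define C where "C = C0 * max c1 c2"
  have "0 < c1" by (simp add: c1_def less_max_iff_disj)
  then have C: "0 < C" using C0 by (simp add: C_def less_max_iff_disj)
  have first: "Lp_norm_sup_dist M p T X XN \<le> ennreal C * (\<integral>\<^sup>+x\<in>{N..}. ennreal (x powr (- 1 / \<gamma>)) \<partial>\<mu>)"
    if N: "0 < N" and X: "volterra_solution M F W T x0 \<sigma> K X"
      and XN: "volterra_solution M F W T x0 \<sigma> (truncated_kernel \<mu> N) XN" for N X XN
  proof (cases "(\<integral>\<^sup>+x\<in>{N..}. ennreal (x powr (- 1 / \<gamma>)) \<partial>\<mu>) = \<infinity>")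
    case True
    then show ?thesis using C by (simp add: ennreal_mult_top)
  next
    case False
    define A where "A = (LINT x:{N..}|\<mu>. ou_weight T b x)"
    have A0: "0 \<le> A" unfolding A_def set_lebesgue_integral_def
      by (intro integral_nonneg_AE AE_I2) (simp add: ou_weight_nonneg)
    have "increment_bound T b (\<lambda>u. K u - truncated_kernel \<mu> N u) A"
      unfolding A_def by (rule increment_bound_cm[OF cm sN(2)[OF N] _ T b(3,4) ou_set[OF sN(2)[OF N]]])
        (rule cm_kernel_tail[OF cm _ N])
    moreover have "continuous_on {0<..} K"
      using cm_kernel_continuous[OF cm sets.top]
      by (rule continuous_on_eq) (simp add: cm_full[OF cm])
    moreover have "\<bar>K u\<bar> \<le> K u" if "0 < u" for u using cm_nonneg[OF cm that] by simp
    ultimately have "Lp_norm_sup_dist M p T X XN \<le> ennreal (C0 * A)"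
      using cm_antimono[OF cm] K_sq by (intro core[OF N A0, where k'=K and \<kappa>'=K] XN X) auto
    also have "\<dots> = ennreal C0 * ennreal A" using C0 A0 by (intro ennreal_mult) auto
    also have "ennreal A = (\<integral>\<^sup>+x. ennreal (indicator {N..} x *\<^sub>R ou_weight T b x) \<partial>\<mu>)"
      unfolding A_def set_lebesgue_integral_def using ou_set[OF sN(2)[OF N]]
      by (intro nn_integral_eq_integral[symmetric]) (auto simp: set_integrable_def ou_weight_nonneg)
    also have "\<dots> \<le> (\<integral>\<^sup>+x. ennreal c1 * (ennreal (x powr (- 1 / \<gamma>)) * indicator {N..} x) \<partial>\<mu>)"
    proof (rule nn_integral_mono)
      fix x
      have "ou_weight T b x \<le> c1 * x powr (- 1 / \<gamma>)" if x: "N \<le> x"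
      proof (cases "x < 1")
        case True
        have "x powr (1 / \<gamma>) \<le> 1" using True x N \<gamma> by (intro powr_le1) auto
        then have "1 \<le> x powr (- 1 / \<gamma>)" using x N by (simp add: powr_minus one_le_inverse)
        then have "T powr b * 1 \<le> c1 * x powr (- 1 / \<gamma>)" by (intro mult_mono) (auto simp: c1_def)
        then show ?thesis using True by (simp add: ou_weight_def)
      next
        case False
        have "x powr (- b) \<le> x powr (- 1 / \<gamma>)" using False b(1) by (intro powr_mono) auto
        then have "2 * x powr (- b) \<le> c1 * x powr (- 1 / \<gamma>)" by (intro mult_mono) (auto simp: c1_def)
        then show ?thesis using False by (simp add: ou_weight_def)
      qed
      then show "ennreal (indicator {N..} x *\<^sub>R ou_weight T b x) \<le> ennreal c1 * (ennreal (x powr (- 1 / \<gamma>)) * indicator {N..} x)"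
        using \<open>0 < c1\<close> by (auto simp: indicator_def ennreal_mult[symmetric] intro!: ennreal_leI)
    qed
    also have "\<dots> = ennreal c1 * (\<integral>\<^sup>+x\<in>{N..}. ennreal (x powr (- 1 / \<gamma>)) \<partial>\<mu>)"
    proof (rule nn_integral_cmult)
      have "(\<lambda>x. ennreal (x powr (- 1 / \<gamma>))) \<in> borel_measurable \<mu>"
        by (rule measurable_compose[OF cm_measurable[OF cm] measurable_ennreal]) simp
      then show "(\<lambda>x. ennreal (x powr (- 1 / \<gamma>)) * indicator {N..} x) \<in> borel_measurable \<mu>"
        using sN(2)[OF N] by (intro borel_measurable_times_ennreal borel_measurable_indicator)
    qed
    finally have "Lp_norm_sup_dist M p T X XN
        \<le> ennreal C0 * (ennreal c1 * (\<integral>\<^sup>+x\<in>{N..}. ennreal (x powr (- 1 / \<gamma>)) \<partial>\<mu>))"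
      by (simp add: mult_left_mono)
    also have "\<dots> = ennreal (C0 * c1) * (\<integral>\<^sup>+x\<in>{N..}. ennreal (x powr (- 1 / \<gamma>)) \<partial>\<mu>)"
      using C0 \<open>0 < c1\<close> by (simp add: ennreal_mult mult.assoc)
    also have "\<dots> \<le> ennreal C * (\<integral>\<^sup>+x\<in>{N..}. ennreal (x powr (- 1 / \<gamma>)) \<partial>\<mu>)"
      using C0 by (intro mult_right_mono ennreal_leI) (auto simp: C_def)
    finally show ?thesis .
  qed
  have second: "Lp_norm_sup_dist M p T XN XNn \<le> ennreal (C * (measure \<mu> {0..<N} * N / real n))"
    if N: "0 < N" and n: "1 \<le> n" and x: "\<forall>i\<in>{1..n}. x i \<in> {grid_point N n (i - 1)..<grid_point N n i}"
      and XN: "volterra_solution M F W T x0 \<sigma> (truncated_kernel \<mu> N) XN"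
      and XNn: "volterra_solution M F W T x0 \<sigma> (discretized_kernel \<mu> N n x) XNn" for N n x XN XNn
  proof -
    define d where "d = measure \<mu> {0..<N} * N / real n"
    have d0: "0 \<le> d" using N by (simp add: d_def)
    \<comment> \<open>A crude constant majorant of the discretized kernel. It depends on N and n,
      but enters only as \<open>\<kappa>'\<close> and so leaves no trace in the constant.\<close>
    define w where "w = (\<Sum>i=1..n. grid_weight \<mu> N n i)"
    have inc: "increment_bound T b (\<lambda>u. discretized_kernel \<mu> N n x u - truncated_kernel \<mu> N u) (2 * T * T powr b * d)"
    proof (rule increment_bound_lipschitz[OF T b(3) d0])
      show "discretized_kernel \<mu> N n x 0 - truncated_kernel \<mu> N 0 = 0"
        using discretized_kernel_0[OF cm N n] by simp
    qed (use discretized_kernel_lipschitz[OF cm N n] x in \<open>auto simp: d_def\<close>)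
    have "Lp_norm_sup_dist M p T XNn XN \<le> ennreal (C0 * (2 * T * T powr b * d))"
    proof (rule core[OF N _ inc, where \<kappa>'="\<lambda>_. w"])
      show "0 \<le> 2 * T * T powr b * d" using T d0 by simp
      show "set_integrable lborel {0<..T} (\<lambda>u. w\<^sup>2)"
        unfolding set_integrable_def by (intro integrable_scaleR_left integrable_indicator_bounded) auto
      show "continuous_on {0<..} (discretized_kernel \<mu> N n x)"
        unfolding discretized_kernel_def[abs_def] by (intro continuous_intros)
      fix u :: real assume u: "0 < u"
      have xi: "0 \<le> x i" if "i \<in> {1..n}" for i
      proof -
        have "grid_point N n (i - 1) \<le> x i" using x that by auto
        moreover have "0 \<le> grid_point N n (i - 1)" using N by (simp add: grid_point_def)
        ultimately show ?thesis by simp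
      qed
      have "\<bar>discretized_kernel \<mu> N n x u\<bar> \<le> (\<Sum>i=1..n. \<bar>grid_weight \<mu> N n i * exp (- x i * u)\<bar>)"
        unfolding discretized_kernel_def by (rule sum_abs)
      also have "\<dots> \<le> w"
        unfolding w_def using xi u by (intro sum_mono) (auto simp: abs_mult grid_weight_def intro!: mult_left_le)
      finally show "\<bar>discretized_kernel \<mu> N n x u\<bar> \<le> w" .
    qed (use XN XNn in auto)
    also have "\<dots> \<le> ennreal (C * d)"
    proof (rule ennreal_leI)
      have "C0 * c2 * d \<le> C * d" using C0 d0 by (intro mult_right_mono) (auto simp: C_def)
      then show "C0 * (2 * T * T powr b * d) \<le> C * d" by (simp add: c2_def mult_ac)
    qed
    finally show ?thesis by (simp add: Lp_norm_sup_dist_commute[of M p T XN] d_def)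
  qed
  show ?thesis using C first second by (intro exI[of _ C]) auto
qed

end
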